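(* Let $\mathbb{G}=\mathbb{R}^q\times\mathbb{R}^m$ be a step-two group with identity $o$ and sub-Riemannian exponential map $\exp$ based at $o$, and let $\Omega_*^{(k)}$, $\phi_k$ be as defined in the context. For every $k\in\{1,2,3,\dots\}$ there exists a one-to-one correspondence, compatible with the $g$- and $\theta$-components (i.e. preserving $g$ and $\theta$), between $$\{(g,\zeta,\theta):\ \zeta\in\mathbb{R}^q,\ \theta\in\Omega_*^{(k)},\ \exp(\zeta,2\theta)=g\ne o\}$$ and $$\{(g,\mathbf{s},\theta):\ g\in\mathbb{G},\ g\ne o,\ \mathbf{s}\in(\mathbb{R}^q)^k,\ \theta\in\Omega_*^{(k)},\ \nabla_{(\mathbf{s},\theta)}\phi_k(g;\mathbf{s},\theta)=0\}.$$
   Context: **Step-two group.** Let $q,m\in\{1,2,\dots\}$ and let $\mathbb{U}=\{U^{(1)},\dots,U^{(m)}\}$ be linearly independent real skew-symmetric $q\times q$ matrices. For $x,x'\in\mathbb{R}^q$ put $\langle\mathbb{U}x,x'\rangle=(\langle U^{(1)}x,x'\rangle,\dots,\langle U^{(m)}x,x'\rangle)\in\mathbb{R}^m$. The step-two group $\mathbb{G}$ is $\mathbb{R}^q\times\mathbb{R}^m$ with the law $(x,t)\cdot(x',t')=(x+x',\,t+t'+\tfrac12\langle\mathbb{U}x,x'\rangle)$ and identity $o=(0,0)$. Let $X_l(g)=\frac{\partial}{\partial x_l}+\frac12\sum_{j=1}^m\big(\sum_{i=1}^q U^{(j)}_{l,i}x_i\big)\frac{\partial}{\partial t_j}$, $1\le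 l\le q$; the sub-Riemannian structure is the one for which $X_1,\dots,X_q$ are orthonormal. **Exponential map.** $\exp:T_o^*\mathbb{G}\cong\mathbb{R}^q\times\mathbb{R}^m\to\mathbb{G}$: $\exp(\zeta,\tau)$ is the endpoint at time $1$ of the normal geodesic starting from $o$ with initial covector $(\zeta,\tau)$, i.e. of the projection to $\mathbb{G}$ of the integral curve, with initial condition $(o;\zeta,\tau)$, of the sub-Riemannian Hamiltonian $H(g,p)=\frac12\sum_{l=1}^q\langle p,X_l(g)\rangle^2$ on $T^*\mathbb{G}$. **Matrices.** For $\lambda\in\mathbb{R}^m$ (or $\mathbb{C}^m$, by linearity), $\widetilde U(\lambda)=\sum_{j=1}^m\lambda_jU^{(j)}$ and $U(\lambda)=i\,\widetilde U(\lambda)$. For $\tau\in\mathbb{R}^m$, $U(\tau)$ is Hermitian, and $U(i\tau)=iU(\tau)$. Functions of these matrices are defined by functional calculus; $\|\cdot\|$ is the operator norm on $\mathbb{C}^q$. **Bessel-related functions.** For $k\in\{1,2,\dots\}$, $0<\mathcal{Z}_{k,1}<\mathcal{Z}_{k,2}<\cdots$ are the positive zeros of the Bessel function $J_{k+1/2}$, and $\mathrm{R}_k(z)=2\sum_{l=1}^{\infty}\frac{z^2}{\mathcal{Z}_{k,l}^2+z^2}$ for $z\in\mathbb{C}\setminus\{\pm i\mathcal{Z}_{k,l}\}$. **Reference sets and functions.** For $k\ge1$, $\Omega_*^{(k)}=\{\tau\in\mathbb{R}^m:\|U(\tau)\|<\mathcal{Z}_{k,1}\}$, and for $g=(x,t)$,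 $\mathbf{s}=(\mathbf{s}_1,\dots,\mathbf{s}_k)\in(\mathbb{R}^q)^k$, $\tau\in\Omega_*^{(k)}$, $$\phi_k(g;\mathbf{s},\tau)=|x|^2+\sum_{j=1}^k2(2j+1)|\mathbf{s}_j|^2+2\langle\mathrm{R}_k(U(i\tau))\mathbf{s}_k,\mathbf{s}_k\rangle+4\Big(t+\tfrac1{\sqrt2}\langle\mathbb{U}x,\mathbf{s}_1\rangle+\sum_{j=2}^k\langle\mathbb{U}\mathbf{s}_{j-1},\mathbf{s}_j\rangle\Big)\cdot\tau .$$ $\nabla_{(\mathbf{s},\theta)}$ denotes the gradient in the joint variables $(\mathbf{s},\theta)$. *)

theory Defs
  imports "HOL-Analysis.Analysis"
begin

section \<open>Step-two groups\<close>

text \<open>The structure matrices $U^{(1)},\dots,U^{(m)}$ are a family \<open>U\<close> indexed by a finite type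
  \<open>'m\<close>. Linear independence is that of the indexed family, hence the injectivity.\<close>

definition step_two :: "('m::finite \<Rightarrow> real^'q^'q) \<Rightarrow> bool" where
  "step_two U \<longleftrightarrow> inj U \<and> independent (range U) \<and> (\<forall>j. transpose (U j) = - U j)"

type_synonym ('q, 'm) grp = "(real^'q) \<times> (real^'m)"

definition bracket :: "('m::finite \<Rightarrow> real^'q^'q) \<Rightarrow> real^'q \<Rightarrow> real^'q \<Rightarrow> real^'m" where
  "bracket U x x' = (\<chi> j. (U j *v x) \<bullet> x')"

definition gmult :: "('m::finite \<Rightarrow> real^'q^'q) \<Rightarrow> ('q,'m) grp \<Rightarrow> ('q,'m) grp \<Rightarrow> ('q,'m) grp" where
  "gmult U g h = (fst g + fst h, snd g + snd h + (1/2) *\<^sub>R bracket U (fst g) (fst h))"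

definition gid :: "('q::finite,'m::finite) grp" where
  "gid = (0, 0)"

lemma gmult_gid: "gmult U gid g = g" "gmult U g gid = g"
  by (auto simp: gmult_def gid_def bracket_def prod_eq_iff vec_eq_iff)

section \<open>The sub-Riemannian exponential map\<close>

text \<open>The coefficient vector of $X_l$ at \<open>g\<close> in the coordinates $(x,t)$.\<close>

definition Xfield :: "('m::finite \<Rightarrow> real^'q^'q) \<Rightarrow> 'q \<Rightarrow> ('q,'m) grp \<Rightarrow> ('q,'m) grp" where
  "Xfield U l g = (axis l 1, \<chi> j. (1/2) * (\<Sum>i\<in>UNIV. U j $ l $ i * fst g $ i))"

text \<open>Cotangent spaces are identified with $\mathbb{R}^q\times\mathbb{R}^m$ through the global
  coordinates, so that the pairing is the Euclidean inner product.\<close>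

definition sr_ham :: "('m::finite \<Rightarrow> real^'q^'q) \<Rightarrow> ('q,'m) grp \<Rightarrow> ('q,'m) grp \<Rightarrow> real" where
  "sr_ham U g p = (1/2) * (\<Sum>l\<in>UNIV. (p \<bullet> Xfield U l g)^2)"

text \<open>Integral curves on $[0,1]$ of the Hamiltonian vector field
  $g' = \partial H/\partial p$, $p' = -\partial H/\partial g$.\<close>

definition ham_curve ::
  "('a::real_inner \<Rightarrow> 'a \<Rightarrow> real) \<Rightarrow> (real \<Rightarrow> 'a) \<Rightarrow> (real \<Rightarrow> 'a) \<Rightarrow> bool" where
  "ham_curve H g p \<longleftrightarrow> (\<forall>r\<in>{0..1}. \<exists>Hg Hp.
      GDERIV (\<lambda>y. H y (p r)) (g r) :> Hg \<and>
      GDERIV (\<lambda>y. H (g r) y) (p r) :> Hp \<and>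
      (g has_vector_derivative Hp) (at r within {0..1}) \<and>
      (p has_vector_derivative - Hg) (at r within {0..1}))"

definition sr_exp :: "('m::finite \<Rightarrow> real^'q^'q) \<Rightarrow> (real^'q) \<times> (real^'m) \<Rightarrow> ('q,'m) grp" where
  "sr_exp U p0 = (THE g1. \<exists>g p. ham_curve (sr_ham U) g p \<and> g 0 = gid \<and> p 0 = p0 \<and> g 1 = g1)"

section \<open>Matrices and functional calculus\<close>

definition Utilde :: "('m::finite \<Rightarrow> real^'q^'q) \<Rightarrow> complex^'m \<Rightarrow> complex^'q^'q" where
  "Utilde U z = (\<chi> a b. \<Sum>j\<in>UNIV. z $ j * of_real (U j $ a $ b))"

definition Umat :: "('m::finite \<Rightarrow> real^'q^'q) \<Rightarrow> complex^'m \<Rightarrow> complex^'q^'q" where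
  "Umat U z = (\<chi> a b. \<i> * Utilde U z $ a $ b)"

definition cvec :: "real^'n \<Rightarrow> complex^'n" where
  "cvec v = (\<chi> a. of_real (v $ a))"

definition ctransp :: "complex^'n^'n \<Rightarrow> complex^'n^'n" where
  "ctransp A = (\<chi> a b. cnj (A $ b $ a))"

definition diag_mat :: "complex^'n \<Rightarrow> complex^'n^'n" where
  "diag_mat d = (\<chi> a b. if a = b then d $ a else 0)"

text \<open>Functional calculus of a normal matrix: $f(P D P^*) = P f(D) P^*$ for unitary \<open>P\<close> and
  diagonal \<open>D\<close>; the result does not depend on the chosen diagonalization.\<close>

definition mat_fun :: "(complex \<Rightarrow> complex) \<Rightarrow> complex^'n^'n \<Rightarrow> complex^'n^'n" where
  "mat_fun f A = (THE B. \<exists>P d. P ** ctransp P = mat 1 \<and> ctransp P ** P = mat 1 \<and>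
      A = P ** diag_mat d ** ctransp P \<and>
      B = P ** diag_mat (\<chi> a. f (d $ a)) ** ctransp P)"

section \<open>Bessel-related functions\<close>

text \<open>$J_\nu(x)$ for $x>0$.\<close>

definition bessel_J :: "real \<Rightarrow> real \<Rightarrow> real" where
  "bessel_J \<nu> x = (\<Sum>n. (-1)^n / (fact n * Gamma (\<nu> + real n + 1)) * (x/2) powr (2 * real n + \<nu>))"

text \<open>The increasing enumeration of the positive zeros of $J_{k+1/2}$. It starts at \<open>0\<close>:
  \<open>bessel_zero k n\<close> is $\mathcal{Z}_{k,n+1}$.\<close>

definition bessel_zero :: "nat \<Rightarrow> nat \<Rightarrow> real" where
  "bessel_zero k = (THE z. strict_mono z \<and> range z = {x. 0 < x \<and> bessel_J (real k + 1/2) x = 0})"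

definition Rfun :: "nat \<Rightarrow> complex \<Rightarrow> complex" where
  "Rfun k z = 2 * (\<Sum>n. z^2 / (of_real (bessel_zero k n)^2 + z^2))"

section \<open>Reference sets and functions\<close>

definition Omega :: "('m::finite \<Rightarrow> real^'q^'q) \<Rightarrow> nat \<Rightarrow> (real^'m) set" where
  "Omega U k = {\<tau>. onorm (\<lambda>v. Umat U (cvec \<tau>) *v v) < bessel_zero k 0}"

text \<open>An element of $(\mathbb{R}^q)^k$ is a vector over a finite linearly ordered index type \<open>'k\<close>
  with \<open>k = CARD('k)\<close>; \<open>blk s j\<close>, for $1\le j\le k$, is its $j$-th component $\mathbf{s}_j$.\<close>

definition blk :: "'a^'k::{finite,linorder} \<Rightarrow> nat \<Rightarrow> 'a" where
  "blk s j = s $ (sorted_list_of_set UNIV ! (j - 1))"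

text \<open>The library inner product on \<open>complex^'q\<close> is the real part of the Hermitian one. This loses
  nothing here: the Hermitian product below is real, since \<open>Umat U (\<i> *s cvec \<tau>)\<close> is a real matrix
  and \<open>Rfun\<close> commutes with complex conjugation.\<close>

definition phi :: "('m::finite \<Rightarrow> real^'q^'q) \<Rightarrow> ('q,'m) grp \<Rightarrow>
    (real^'q)^'k::{finite,linorder} \<Rightarrow> real^'m \<Rightarrow> real" where
  "phi U g s \<tau> = (let k = CARD('k); x = fst g; t = snd g in
      (norm x)^2
    + (\<Sum>j=1..k. 2 * (2 * real j + 1) * (norm (blk s j))^2)
    + 2 * ((mat_fun (Rfun k) (Umat U (\<i> *s cvec \<tau>)) *v cvec (blk s k)) \<bullet> cvec (blk s k))
    + 4 * ((t + (1 / sqrt 2) *\<^sub>R bracket U x (blk s 1)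
              + (\<Sum>j=2..k. bracket U (blk s (j - 1)) (blk s j))) \<bullet> \<tau>))"

end

theory Submission
  imports Defs "HOL-Complex_Analysis.Cauchy_Integral_Formula"
begin

text \<open>
  Put \<open>W = \<Sum>\<^sub>j \<theta>\<^sub>j U\<^sub>j\<close>, a real skew-symmetric matrix. The horizontal velocity of the geodesic with
  initial covector \<open>(\<zeta>, 2 \<theta>)\<close> is \<open>exp (2 r W) \<zeta> = exp ((2 r - 1) W) \<eta>\<close> with \<open>\<eta> = exp W \<zeta>\<close>. Its Legendre
  coefficients in the variable \<open>2 r - 1\<close> are, up to the factor \<open>2 j + 1\<close>, the vectors \<open>i\<^sub>j(W) \<eta>\<close>, where
  \<open>i\<^sub>j\<close> is the modified spherical Bessel function, and the correspondence is
  \<open>s\<^sub>j = (-1)\<^sup>j i\<^sub>j(W) \<eta> / sqrt 2\<close>. With \<open>s\<^sub>0 = x / sqrt 2\<close> the equations \<open>\<partial>\<phi>\<^sub>k / \<partial>s\<^sub>j = 0\<close> are the three-term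
  recurrence of the \<open>i\<^sub>j\<close>. It can be cut off at \<open>j = k\<close> because \<open>R\<^sub>k(z) = z i\<^sub>k\<^sub>+\<^sub>1(z) / i\<^sub>k(z)\<close>, which is \<open>z\<close>
  times the logarithmic derivative of the canonical product of \<open>z\<^sup>-\<^sup>k i\<^sub>k(z)\<close>. That product is obtained
  by induction on \<open>k\<close>: in the variable \<open>w = -z\<^sup>2\<close> the functions \<open>z\<^sup>-\<^sup>k i\<^sub>k(z)\<close> are, up to constants,
  successive derivatives of \<open>sin (sqrt w) / sqrt w\<close>, and differentiation preserves canonical products
  of genus zero with positive simple zeros.

  The equation \<open>\<partial>\<phi>\<^sub>k / \<partial>\<theta> = 0\<close> then says that \<open>t\<close> is the area swept by the geodesic: the left-hand side
  does not depend on \<open>k\<close> by the recurrence, and for \<open>k = 0\<close> it is computed from the flow.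
\<close>

section \<open>Spherical Bessel power series in a Banach algebra\<close>

text \<open>Three obstacles shape the proof. W(\<theta>) may be singular, so nothing is divided by
  W: the functions are used as \<open>bes j (W^2)\<close>, entire in W^2, the recurrences are kept
  multiplied by W, and a critical point is split along the range and the kernel of W. Next,
  W(\<theta>) need not commute with a perturbation W(\<delta>), so the \<theta>-derivatives of
  i_j(W) are never computed; their existence and the relation obtained by differentiating the
  recurrence suffice. Finally, R_k is given by a series over Bessel zeros and by an unspecified
  diagonalization. It enters only through the identity R_k(W) \<open>bes k (W^2)\<close> = W^2
  \<open>bes (Suc k) (W^2)\<close>, which determines R_k(W) once \<open>bes k (W^2)\<close> is
  injective; the reference set guarantees this injectivity. The coefficients \<open>besc j n\<close>
  are 1 / (2^n n! (2j+2n+1)!!), those of the standard series of z^(-j) i_j(z).\<close>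

definition besc :: "nat \<Rightarrow> nat \<Rightarrow> real" where
  "besc j n = 1 / (2 ^ n * fact n * (\<Prod>i\<le>j + n. 2 * real i + 1))"

text \<open>\<open>z\<^sup>j * bes j (z\<^sup>2)\<close> is the modified spherical Bessel function \<open>i\<^sub>j(z)\<close>, and \<open>x\<^sup>j * bes j (- x\<^sup>2)\<close> is the
  spherical Bessel function \<open>j\<^sub>j(x)\<close>.\<close>

definition bes :: "nat \<Rightarrow> 'a \<Rightarrow> 'a::{real_normed_algebra_1,banach}" where
  "bes j w = (\<Sum>n. besc j n *\<^sub>R w ^ n)"

lemma besc_pos: "0 < besc j n"
  unfolding besc_def by (intro divide_pos_pos mult_pos_pos prod_pos) auto

lemma besc_le: "besc j n \<le> 1 / fact n"
proof -
  have "1 * (1 * fact n) \<le> (\<Prod>i\<le>j + n. 2 * real i + 1) * (2 ^ n * fact n)"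
    by (intro mult_mono prod_ge_1 mult_nonneg_nonneg prod_nonneg) auto
  then show ?thesis
    unfolding besc_def by (intro divide_left_mono) (auto intro!: prod_pos prod_nonneg mult_pos_pos simp: mult_ac)
qed

text \<open>Coefficient form of i_j(z) - i_{j+2}(z) = (2j+3) i_{j+1}(z) / z. In the variable w = z^2
  the function i_{j+2} carries an extra factor w, so its coefficient index is one lower.\<close>

lemma besc_recurrence:
  "besc j (Suc n) = (2 * real j + 3) * besc (Suc j) (Suc n) + besc (Suc (Suc j)) n"
proof -
  define P where "P = (\<Prod>i\<le>j + n. 2 * real i + 1)"
  define F :: real where "F = 2 ^ n * fact n"
  have "P > 0" "F > 0" unfolding P_def F_def by (auto intro: prod_pos)
  have "besc j (Suc n) = 1 / (F * 2 * (n + 1) * (P * (2 * (j + n) + 3)))"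
       "besc (Suc j) (Suc n) = 1 / (F * 2 * (n + 1) * (P * (2 * (j + n) + 3) * (2 * (j + n) + 5)))"
       "besc (Suc (Suc j)) n = 1 / (F * (P * (2 * (j + n) + 3) * (2 * (j + n) + 5)))"
    unfolding besc_def P_def F_def by (simp_all add: algebra_simps)
  \<comment> \<open>Over the common denominator the claim is b = (2j+3) + 2(n+1), which holds for
    the last odd factor b = 2(j+n)+5.\<close>
  moreover have "1 / (F * 2 * (n + 1) * (P * a)) =
      (2 * real j + 3) * (1 / (F * 2 * (n + 1) * (P * a * b))) + 1 / (F * (P * a * b))"
    if "a > 0" "b > 0" "b = (2 * real j + 3) + 2 * (n + 1)" for a b :: real
  proof -
    have "1 / (F * c * (P * a)) = d * (1 / (F * c * (P * a * b))) + 1 / (F * (P * a * b))"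
      if "c > 0" "b = d + c" for c d :: real
      using that(1) \<open>a > 0\<close> \<open>b > 0\<close> \<open>P > 0\<close> \<open>F > 0\<close>
      by (simp add: divide_simps) (simp add: that(2) algebra_simps)
    from this[of "2 * (real n + 1)" "2 * real j + 3"] that(3) show ?thesis
      by (simp add: ac_simps)
  qed
  note this[of "2 * (j + n) + 3" "2 * (j + n) + 5"]
  ultimately show ?thesis by (simp add: add.commute)
qed

lemma besc_recurrence_0: "besc j 0 = (2 * real j + 3) * besc (Suc j) 0"
  by (simp add: besc_def prod_nonneg divide_simps add_nonneg_eq_0_iff)

text \<open>Coefficient form of (1/z) d/dz (z^(-j) i_j) = z^(-j-1) i_{j+1}; the factor 1/2 comes
  from d/dw = (1/(2z)) d/dz.\<close>

lemma besc_derivative: "besc j (Suc n) * real (Suc n) = besc (Suc j) n / 2"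
proof -
  have "(\<Prod>i\<le>j + n. 2 * real i + 1) > 0" by (auto intro: prod_pos)
  then show ?thesis
    by (simp add: besc_def divide_simps)
qed

lemma sums_case_Suc:
  fixes f :: "nat \<Rightarrow> 'a::real_normed_vector"
  assumes "f sums s"
  shows "(\<lambda>n. case n of 0 \<Rightarrow> 0 | Suc m \<Rightarrow> f m) sums s"
  using assms sums_Suc_iff[of "\<lambda>n. case n of 0 \<Rightarrow> 0 | Suc m \<Rightarrow> f m" s] by simp

context
  fixes w :: "'a::{real_normed_algebra_1,banach}"
begin

lemma norm_besc_term_le: "norm (besc j n *\<^sub>R w ^ n) \<le> norm w ^ n /\<^sub>R fact n"
proof -
  have "norm (besc j n *\<^sub>R w ^ n) \<le> (1 / fact n) * norm w ^ n"
    unfolding norm_scaleR using besc_le[of j n] besc_pos[of j n]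
    by (intro mult_mono norm_power_ineq) auto
  then show ?thesis by (simp add: divide_inverse mult.commute)
qed

lemma summable_bes: "summable (\<lambda>n. besc j n *\<^sub>R w ^ n)"
  by (rule summable_comparison_test[OF _ summable_exp_generic[of "norm w"]])
     (use norm_besc_term_le in auto)

lemma bes_sums: "(\<lambda>n. besc j n *\<^sub>R w ^ n) sums bes j w"
  unfolding bes_def using summable_bes by (rule summable_sums)

lemma bes_recurrence:
  "bes j w = (2 * real j + 3) *\<^sub>R bes (Suc j) w + w * bes (Suc (Suc j)) w"
proof -
  have "(\<lambda>n. besc (Suc (Suc j)) n *\<^sub>R w ^ Suc n) sums (w * bes (Suc (Suc j)) w)"
    using sums_mult[OF bes_sums[of "Suc (Suc j)"], of w] by simp
  then have "(\<lambda>n. (case n of 0 \<Rightarrow> 0 | Suc m \<Rightarrow> besc (Suc (Suc j)) m *\<^sub>R w ^ Suc m)) sums (w * bes (Suc (Suc j)) w)"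
    by (rule sums_case_Suc[where f = "\<lambda>m. besc (Suc (Suc j)) m *\<^sub>R w ^ Suc m"])
  note sums_add[OF sums_scaleR_right[OF bes_sums[of "Suc j"], of "2 * real j + 3"] this]
  moreover have "(2 * real j + 3) *\<^sub>R besc (Suc j) n *\<^sub>R w ^ n +
         (case n of 0 \<Rightarrow> 0 | Suc m \<Rightarrow> besc (Suc (Suc j)) m *\<^sub>R w ^ Suc m) = besc j n *\<^sub>R w ^ n" for n
    by (cases n) (simp_all add: besc_recurrence[of j] besc_recurrence_0[of j] scaleR_add_left)
  ultimately have "(\<lambda>n. besc j n *\<^sub>R w ^ n) sums ((2 * real j + 3) *\<^sub>R bes (Suc j) w + w * bes (Suc (Suc j)) w)"
    by simp
  with bes_sums show ?thesis by (metis sums_unique2)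
qed

end

lemma bes_0: "bes j 0 = besc j 0 *\<^sub>R 1"
proof -
  have "(\<lambda>n. besc j n *\<^sub>R (0::'a) ^ n) = (\<lambda>n. if n = 0 then besc j 0 *\<^sub>R 1 else 0)"
  proof
    show "besc j n *\<^sub>R (0::'a) ^ n = (if n = 0 then besc j 0 *\<^sub>R 1 else 0)" for n
      by (cases n) auto
  qed
  then have "(\<lambda>n. besc j n *\<^sub>R (0::'a) ^ n) sums (besc j 0 *\<^sub>R 1)"
    using sums_single[of 0 "\<lambda>_. besc j 0 *\<^sub>R (1::'a)"] by simp
  then show ?thesis using bes_sums sums_unique2 by blast
qed

lemma bes_of_real: "bes j (of_real x) = (of_real (bes j x) :: 'a::{real_normed_field,banach})"
proof -
  have "(\<lambda>n. of_real (besc j n *\<^sub>R x ^ n)) sums (of_real (bes j x) :: 'a)"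
    by (intro sums_of_real bes_sums)
  then show ?thesis
    using bes_sums[of j "of_real x :: 'a"] by (simp add: scaleR_conv_of_real sums_iff)
qed

text \<open>The noncommutative derivative of a power, the sum of x^i h x^(n-1-i), in a recursive
  form suited to induction.\<close>

fun pow_deriv :: "nat \<Rightarrow> 'a \<Rightarrow> 'a \<Rightarrow> 'a::real_normed_algebra_1" where
  "pow_deriv 0 x h = 0"
| "pow_deriv (Suc n) x h = h * x ^ n + x * pow_deriv n x h"

lemma pow_has_derivative: "((\<lambda>x. x ^ n) has_derivative pow_deriv n x) (at x within S)"
proof (induction n)
  case 0
  have "pow_deriv 0 x = (\<lambda>h. 0)" by auto
  then show ?case by simp
next
  case (Suc n)
  have "pow_deriv (Suc n) x = (\<lambda>h. x * pow_deriv n x h + h * x ^ n)" by auto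
  then show ?case using has_derivative_mult[OF has_derivative_ident Suc] by simp
qed

lemma norm_pow_deriv: "norm (pow_deriv (Suc n) x h) \<le> real (Suc n) * norm x ^ n * norm h"
proof (induction n)
  case 0
  then show ?case by simp
next
  case (Suc n)
  have "norm (pow_deriv (Suc (Suc n)) x h) \<le> norm (h * x ^ Suc n) + norm (x * pow_deriv (Suc n) x h)"
    by (simp only: pow_deriv.simps norm_triangle_ineq)
  also have "\<dots> \<le> norm h * norm x ^ Suc n + norm x * (real (Suc n) * norm x ^ n * norm h)"
    by (intro add_mono order_trans[OF norm_mult_ineq] mult_mono norm_power_ineq Suc order_refl) auto
  finally show ?case by (simp add: algebra_simps)
qed

lemma pow_deriv_commuting:
  assumes "h * x = x * h"
  shows "pow_deriv (Suc n) x h = real (Suc n) *\<^sub>R (x ^ n * h)"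
proof (induction n)
  case 0
  then show ?case by simp
next
  case (Suc n)
  have "h * x ^ Suc n = x ^ Suc n * h" using assms
    by (metis power_commuting_commutes)
  then show ?case
    using Suc by (subst pow_deriv.simps) (simp add: algebra_simps scaleR_2)
qed

text \<open>Termwise differentiation of the series. The derivative D is only asserted to exist, with
  its value given on directions that commute with w: in other directions there is no such formula,
  and none is used later.\<close>

lemma bes_has_derivative_ex:
  fixes w :: "'a::{real_normed_algebra_1,banach}"
  shows "\<exists>D. (bes j has_derivative D) (at w) \<and>
    (\<forall>h. h * w = w * h \<longrightarrow> D h = (1/2) *\<^sub>R (bes (Suc j) w * h))"
proof -
  define R where "R = norm w + 1"
  have R: "R > 0" unfolding R_def by (simp add: add_nonneg_pos)
  \<comment> \<open>The n-th derivative term is at most n R^(n-1) / n! on the ball, that is R^(n-1)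
    / (n-1)!; the constant term contributes 0.\<close>
  define M where "M n = (case n of 0 \<Rightarrow> 0 | Suc n' \<Rightarrow> R ^ n' /\<^sub>R fact n')" for n
  have M: "summable M"
    using summable_exp_generic[of R] by (subst summable_Suc_iff[symmetric]) (simp add: M_def mult.commute)
  have M0: "0 \<le> M n" for n unfolding M_def using R by (cases n) auto
  have bound: "norm (besc j n *\<^sub>R pow_deriv n x h) \<le> M n * norm h" if "x \<in> ball 0 R" for n x h
  proof (cases n)
    case (Suc m)
    have "norm (besc j n *\<^sub>R pow_deriv n x h) \<le> (1 / fact n) * (real n * norm x ^ m * norm h)"
      unfolding norm_scaleR using besc_le[of j n] besc_pos[of j n] norm_pow_deriv[of m x h] Suc
      by (intro mult_mono) auto
    also have "\<dots> = (1 / fact m) * (norm x ^ m * norm h)"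
      using Suc by (simp add: divide_simps)
    also have "\<dots> \<le> (1 / fact m) * (R ^ m * norm h)"
      using that by (intro mult_left_mono mult_right_mono power_mono) auto
    finally show ?thesis by (simp add: M_def Suc divide_inverse mult_ac)
  qed (simp add: M_def)
  define g' where "g' x h = (\<Sum>n. besc j n *\<^sub>R pow_deriv n x h)" for x h :: 'a
  have sm: "summable (\<lambda>n. besc j n *\<^sub>R pow_deriv n x h)" if "x \<in> ball 0 R" for x h :: 'a
    by (rule summable_comparison_test[OF _ summable_mult2[OF M, of "norm h"]])
       (use bound[OF that] in auto)
  have "\<exists>g. \<forall>x\<in>ball 0 R. (\<lambda>n. besc j n *\<^sub>R x ^ n) sums (g x) \<and>
      (g has_derivative g' x) (at x within ball 0 R)"
  proof (rule has_derivative_series)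
    show "convex (ball 0 R :: 'a set)" by simp
    show "((\<lambda>x. besc j n *\<^sub>R x ^ n) has_derivative (\<lambda>h. besc j n *\<^sub>R pow_deriv n x h)) (at x within ball 0 R)" for n x
      by (intro has_derivative_scaleR_right pow_has_derivative)
    show "w \<in> ball 0 R" by (simp add: R_def)
    show "(\<lambda>n. besc j n *\<^sub>R w ^ n) sums bes j w" by (rule bes_sums)
    fix e :: real assume "e > 0"
    have "(\<lambda>n. \<Sum>i. M (i + n)) \<longlonglongrightarrow> 0"
      by (rule suminf_exist_split2[OF M])
    then have "\<forall>\<^sub>F n in sequentially. (\<Sum>i. M (i + n)) < e"
      using \<open>e > 0\<close> by (rule order_tendstoD)
    then show "\<forall>\<^sub>F n in sequentially. \<forall>x\<in>ball 0 R. \<forall>h.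
       norm ((\<Sum>i<n. besc j i *\<^sub>R pow_deriv i x h) - g' x h) \<le> e * norm h"
    proof (eventually_elim, intro ballI allI)
      fix n :: nat and x h :: 'a assume n: "(\<Sum>i. M (i + n)) < e" and x: "x \<in> ball 0 R"
      have "g' x h - (\<Sum>i<n. besc j i *\<^sub>R pow_deriv i x h)
          = (\<Sum>i. besc j (i + n) *\<^sub>R pow_deriv (i + n) x h)"
        unfolding g'_def by (rule suminf_minus_initial_segment[symmetric, OF sm[OF x]])
      also have "norm \<dots> \<le> (\<Sum>i. M (i + n) * norm h)"
        by (rule norm_suminf_le) (intro bound[OF x] summable_mult2 summable_ignore_initial_segment M)+
      also have "\<dots> = (\<Sum>i. M (i + n)) * norm h"
        by (rule suminf_mult2[symmetric]) (intro summable_ignore_initial_segment M)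
      also have "\<dots> \<le> e * norm h" using n by (intro mult_right_mono) auto
      finally show "norm ((\<Sum>i<n. besc j i *\<^sub>R pow_deriv i x h) - g' x h) \<le> e * norm h"
        by (simp add: norm_minus_commute)
    qed
  qed
  then obtain g where g: "\<And>x. x \<in> ball 0 R \<Longrightarrow> (\<lambda>n. besc j n *\<^sub>R x ^ n) sums (g x)"
      "\<And>x. x \<in> ball 0 R \<Longrightarrow> (g has_derivative g' x) (at x within ball 0 R)" by blast
  have w: "w \<in> ball 0 R" by (simp add: R_def)
  have "(g has_derivative g' w) (at w)"
    using g(2)[OF w] unfolding at_within_open[OF w open_ball] .
  moreover have "g x = bes j x" if "x \<in> ball 0 R" for x
    using sums_unique2[OF g(1)[OF that] bes_sums] .
  ultimately have "(bes j has_derivative g' w) (at w)"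
    by (rule has_derivative_transform_within_open[OF _ open_ball w])
  moreover have "g' w h = (1/2) *\<^sub>R (bes (Suc j) w * h)" if "h * w = w * h" for h
  proof -
    have "(\<lambda>n. besc j (Suc n) *\<^sub>R pow_deriv (Suc n) w h) = (\<lambda>n. (1/2) *\<^sub>R (besc (Suc j) n *\<^sub>R w ^ n * h))"
      unfolding pow_deriv_commuting[OF that] using besc_derivative[of j] by (auto simp: fun_eq_iff)
    moreover have "\<dots> sums ((1/2) *\<^sub>R (bes (Suc j) w * h))"
      by (intro sums_scaleR_right sums_mult2 bes_sums)
    ultimately have "(\<lambda>n. besc j n *\<^sub>R pow_deriv n w h) sums ((1/2) *\<^sub>R (bes (Suc j) w * h))"
      using sums_Suc_iff[of "\<lambda>n. besc j n *\<^sub>R pow_deriv n w h"] by simp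
    then show ?thesis unfolding g'_def by (simp add: sums_iff)
  qed
  ultimately show ?thesis by blast
qed

lemma bes_has_field_derivative:
  fixes w :: "'a::{real_normed_field,banach}"
  shows "(bes j has_field_derivative bes (Suc j) w / 2) (at w)"
proof -
  obtain D where "(bes j has_derivative D) (at w)" and D: "\<And>h. h * w = w * h \<longrightarrow> D h = (1/2) *\<^sub>R (bes (Suc j) w * h)"
    using bes_has_derivative_ex by blast
  moreover have "D = (*) (bes (Suc j) w / 2)"
    using D by (auto simp: fun_eq_iff scaleR_conv_of_real)
  ultimately show ?thesis by (simp add: has_field_derivative_def)
qed

text \<open>These are exp = cosh + sinh with sinh z = z i_0(z) and cosh z = i_0(z) + z i_1(z). They
  tie the flow, and also the sine function, to the Bessel series.\<close>

lemma exp_bes: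
  fixes A :: "'a::{real_normed_algebra_1,banach}"
  shows "exp A = (bes 0 (A\<^sup>2) + A\<^sup>2 * bes 1 (A\<^sup>2)) + A * bes 0 (A\<^sup>2)"
    and "exp (- A) = (bes 0 (A\<^sup>2) + A\<^sup>2 * bes 1 (A\<^sup>2)) - A * bes 0 (A\<^sup>2)"
proof -
  have p: "2 ^ n * fact n * (\<Prod>i\<le>n. 2 * real i + 1) = fact (2 * n + 1)" for n
  proof (induction n)
    case (Suc n)
    have "2 ^ Suc n * fact (Suc n) * (\<Prod>i\<le>Suc n. 2 * real i + 1) =
        (2 ^ n * fact n * (\<Prod>i\<le>n. 2 * real i + 1)) * ((2 * real n + 2) * (2 * real n + 3))"
      by (simp add: field_simps)
    then show ?case unfolding Suc by (simp add: algebra_simps)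
  qed simp
  have c0: "besc 0 n = 1 / fact (2 * n + 1)" for n
    using p[of n] by (simp add: besc_def)
  have "(\<lambda>n. if even n then 0 else A ^ n /\<^sub>R fact n) sums sinh A" by (rule sinh_converges)
  then have "(\<lambda>n. A ^ (2 * n + 1) /\<^sub>R fact (2 * n + 1)) sums sinh A"
    by (subst (asm) sums_mono_reindex[symmetric, where g = "\<lambda>n. 2 * n + 1"])
       (auto simp: strict_mono_def elim!: oddE)
  moreover have "(\<lambda>n. A ^ (2 * n + 1) /\<^sub>R fact (2 * n + 1)) = (\<lambda>n. A * (besc 0 n *\<^sub>R (A\<^sup>2) ^ n))"
    by (simp add: c0 fun_eq_iff power_mult[symmetric] divide_inverse)
  ultimately have s: "sinh A = A * bes 0 (A\<^sup>2)"
    using sums_mult[OF bes_sums[of 0 "A\<^sup>2"], of A] by (metis sums_unique2)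
  \<comment> \<open>Since \<open>besc 1 n\<close> is 2(n+1) times \<open>besc 0 (Suc n)\<close>, the
    sum is (2n+3) / (2n+3)!.\<close>
  have c1: "besc 0 (Suc n) + besc 1 n = 1 / fact (2 * Suc n)" for n
  proof -
    have "besc 1 n = 2 * real (Suc n) * besc 0 (Suc n)" using besc_derivative[of 0 n] by (simp add: algebra_simps)
    then have "besc 0 (Suc n) + besc 1 n = real (2 * Suc n + 1) * besc 0 (Suc n)"
      by (simp add: algebra_simps)
    then show ?thesis by (simp add: c0 del: of_nat_Suc)
  qed
  have "(\<lambda>n. if even n then A ^ n /\<^sub>R fact n else 0) sums cosh A" by (rule cosh_converges)
  then have c: "(\<lambda>n. A ^ (2 * n) /\<^sub>R fact (2 * n)) sums cosh A"
    by (subst (asm) sums_mono_reindex[symmetric, where g = "\<lambda>n. 2 * n"])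
       (auto simp: strict_mono_def elim!: evenE)
  have "(\<lambda>n. besc 1 n *\<^sub>R (A\<^sup>2) ^ Suc n) sums (A\<^sup>2 * bes 1 (A\<^sup>2))"
    using sums_mult[OF bes_sums[of 1], of "A\<^sup>2"] by simp
  then have "(\<lambda>n. (case n of 0 \<Rightarrow> 0 | Suc m \<Rightarrow> besc 1 m *\<^sub>R (A\<^sup>2) ^ Suc m)) sums (A\<^sup>2 * bes 1 (A\<^sup>2))"
    by (rule sums_case_Suc[where f = "\<lambda>m. besc 1 m *\<^sub>R (A\<^sup>2) ^ Suc m"])
  note sums_add[OF bes_sums[of 0 "A\<^sup>2"] this]
  moreover have "besc 0 n *\<^sub>R (A\<^sup>2) ^ n + (case n of 0 \<Rightarrow> 0 | Suc m \<Rightarrow> besc 1 m *\<^sub>R (A\<^sup>2) ^ Suc m) = A ^ (2 * n) /\<^sub>R fact (2 * n)" for n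
  proof (cases n)
    case (Suc m)
    then show ?thesis
      by (simp only: nat.case scaleR_add_left[symmetric] c1 power_mult[symmetric]) (simp add: divide_inverse)
  qed (simp add: c0)
  ultimately have "(\<lambda>n. A ^ (2 * n) /\<^sub>R fact (2 * n)) sums (bes 0 (A\<^sup>2) + A\<^sup>2 * bes 1 (A\<^sup>2))"
    by simp
  then have c: "cosh A = bes 0 (A\<^sup>2) + A\<^sup>2 * bes 1 (A\<^sup>2)" using c by (metis sums_unique2)
  show "exp A = (bes 0 (A\<^sup>2) + A\<^sup>2 * bes 1 (A\<^sup>2)) + A * bes 0 (A\<^sup>2)"
    unfolding s[symmetric] c[symmetric] by (simp add: cosh_plus_sinh)
  show "exp (- A) = (bes 0 (A\<^sup>2) + A\<^sup>2 * bes 1 (A\<^sup>2)) - A * bes 0 (A\<^sup>2)"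
    unfolding s[symmetric] c[symmetric] by (simp add: cosh_minus_sinh)
qed

section \<open>Canonical products of genus zero\<close>

definition pprod :: "(nat \<Rightarrow> real) \<Rightarrow> nat \<Rightarrow> 'a \<Rightarrow> 'a::real_normed_field" where
  "pprod z N w = (\<Prod>n<N. 1 - w / of_real (z n))"

text \<open>The product rule is written out, instead of the logarithmic derivative, so that the
  expression is meaningful at the zeros and visibly a polynomial. The type is generic: Rolle's
  theorem is applied over the reals, the limit is taken over the complex numbers.\<close>

definition dpprod :: "(nat \<Rightarrow> real) \<Rightarrow> nat \<Rightarrow> 'a \<Rightarrow> 'a::real_normed_field" where
  "dpprod z N w = (\<Sum>m<N. (- 1 / of_real (z m)) * (\<Prod>n\<in>{..<N} - {m}. 1 - w / of_real (z n)))"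

lemma pprod_has_derivative:
  "(pprod z N has_field_derivative dpprod z N w) (at w)"
proof -
  have "((\<lambda>w. \<Prod>n<N. 1 - w / of_real (z n)) has_field_derivative dpprod z N w) (at w)"
    unfolding dpprod_def
    by (rule has_field_derivative_prod) (auto intro!: derivative_eq_intros simp: divide_inverse)
  then show ?thesis by (simp add: pprod_def[abs_def])
qed

lemma dpprod_of_real: "dpprod z N (of_real x) = of_real (dpprod z N x)"
  by (simp add: dpprod_def)

lemma dpprod_eq:
  fixes w :: "'a::real_normed_field"
  assumes "\<And>n. z n \<noteq> 0" "\<And>n. w \<noteq> of_real (z n)"
  shows "dpprod z N w = - pprod z N w * (\<Sum>n<N. 1 / (of_real (z n) - w))"
proof -
  have "(- 1 / of_real (z m)) * (\<Prod>n\<in>{..<N} - {m}. 1 - w / of_real (z n))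
      = - (pprod z N w * (1 / (of_real (z m) - w)))" if "m < N" for m
  proof -
    have "pprod z N w = (1 - w / of_real (z m)) * (\<Prod>n\<in>{..<N} - {m}. 1 - w / of_real (z n))"
      unfolding pprod_def using that by (intro prod.remove) auto
    moreover have "of_real (z m) \<noteq> (0 :: 'a)" "of_real (z m) - w \<noteq> 0" using assms by auto
    ultimately show ?thesis by (simp add: divide_simps)
  qed
  then show ?thesis
    by (simp add: dpprod_def sum_distrib_left sum_negf)
qed

text \<open>The zeros are positive and, by strict monotonicity, simple. The product formula forces
  f(0) = 1, whence the normalising quotients below.\<close>

definition genus_zero :: "(complex \<Rightarrow> complex) \<Rightarrow> (nat \<Rightarrow> real) \<Rightarrow> bool" where
  "genus_zero f z \<longleftrightarrow> strict_mono z \<and> 0 < z 0 \<and> summable (\<lambda>n. 1 / z n) \<and>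
     (\<forall>w. (\<lambda>N. pprod z N w) \<longlonglongrightarrow> f w)"

lemma genus_zero_pos: "genus_zero f z \<Longrightarrow> 0 < z n"
  unfolding genus_zero_def by (metis less_eq_nat.simps(1) order.strict_trans2 strict_mono_less_eq)

lemma pprod_uniformly_convergent:
  fixes z :: "nat \<Rightarrow> real"
  assumes "\<And>n. 0 < z n" "summable (\<lambda>n. 1 / z n)"
  shows "uniformly_convergent_on (cball (0::complex) R) (\<lambda>N w. pprod z N w)"
  unfolding pprod_def
proof (rule uniformly_convergent_on_prod')
  show "continuous_on (cball 0 R) (\<lambda>w::complex. 1 - w / of_real (z n))" for n
    using assms(1)[of n] by (auto intro!: continuous_intros)
  have "uniform_limit (cball 0 R) (\<lambda>N w. \<Sum>n<N. norm (1 - w / of_real (z n) - 1 :: complex))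
      (\<lambda>w. \<Sum>n. norm (1 - w / of_real (z n) - 1 :: complex)) sequentially"
  proof (rule Weierstrass_m_test)
    show "norm (norm (1 - w / of_real (z n) - 1 :: complex)) \<le> R * (1 / z n)" if "w \<in> cball 0 R" for n w
      using that assms(1)[of n] by (auto simp: norm_divide divide_simps)
    show "summable (\<lambda>n. R * (1 / z n))" by (intro summable_mult assms)
  qed
  then show "uniformly_convergent_on (cball 0 R) (\<lambda>N w. \<Sum>n<N. norm (1 - w / of_real (z n) - 1 :: complex))"
    by (auto simp: uniformly_convergent_on_def)
qed simp

text \<open>The products converge uniformly on every disc, and for holomorphic functions such
  convergence passes to derivatives.\<close>

lemma dpprod_tendsto:
  assumes "genus_zero f z" and f': "(f has_field_derivative f') (at w)"
  shows "(\<lambda>N. dpprod z N w) \<longlonglongrightarrow> f'"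
proof -
  have z: "\<And>n. 0 < z n" and sm: "summable (\<lambda>n. 1 / z n)" and lim: "\<And>w. (\<lambda>N. pprod z N w) \<longlonglongrightarrow> f w"
    using genus_zero_pos[OF assms(1)] assms(1) by (auto simp: genus_zero_def)
  have ul: "uniform_limit (cball 0 R) (\<lambda>N w. pprod z N w) f sequentially" for R
  proof -
    obtain g where g: "uniform_limit (cball 0 R) (\<lambda>N w::complex. pprod z N w) g sequentially"
      using pprod_uniformly_convergent[OF z sm, of R] by (auto simp: uniformly_convergent_on_def)
    have "g w = f w" if "w \<in> cball 0 R" for w
      by (rule LIMSEQ_unique[OF tendsto_uniform_limitI[OF g that] lim])
    then show ?thesis using g uniform_limit_cong'[OF refl, of "cball 0 R" g f] by blast
  qed
  have "\<exists>g'. \<forall>x\<in>UNIV. (f has_field_derivative g' x) (at x) \<and> (\<lambda>N. dpprod z N x) \<longlonglongrightarrow> g' x"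
  proof (rule has_complex_derivative_uniform_sequence[OF open_UNIV pprod_has_derivative])
    fix x :: complex
    have "uniform_limit (cball x 1) (\<lambda>N w. pprod z N w) f sequentially"
      by (rule uniform_limit_on_subset[OF ul[of "norm x + 1"]])
         (simp add: cball_subset_cball_iff dist_norm)
    then show "\<exists>d>0. cball x d \<subseteq> UNIV \<and> uniform_limit (cball x d) (\<lambda>N. pprod z N) f sequentially"
      by (intro exI[of _ 1]) auto
  qed
  then obtain g' where "(f has_field_derivative g') (at w)" "(\<lambda>N. dpprod z N w) \<longlonglongrightarrow> g'"
    by blast
  then show ?thesis using DERIV_unique[OF f'] by metis
qed

text \<open>An absolutely convergent product vanishes only if one of its factors does.\<close>

lemma genus_zero_zeros:
  assumes "genus_zero f z"
  shows "f w = 0 \<longleftrightarrow> w \<in> of_real ` range z"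
proof
  have z: "\<And>n. 0 < z n" and sm: "summable (\<lambda>n. 1 / z n)" and lim: "\<And>w. (\<lambda>N. pprod z N w) \<longlonglongrightarrow> f w"
    using genus_zero_pos[OF assms(1)] assms(1) by (auto simp: genus_zero_def)
  {
    assume "w \<in> of_real ` range z"
    then obtain n where n: "w = of_real (z n)" by auto
    have "eventually (\<lambda>N. pprod z N w = 0) sequentially"
      using eventually_gt_at_top[of n]
      by eventually_elim (use n z[of n] in \<open>auto simp: pprod_def intro!: prod_zero bexI[of _ n]\<close>)
    then have "(\<lambda>N. pprod z N w) \<longlonglongrightarrow> 0" by (rule tendsto_eventually)
    from LIMSEQ_unique[OF lim this] show "f w = 0" .
  }
  assume f: "f w = 0"
  show "w \<in> of_real ` range z"
  proof (rule ccontr)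
    assume n: "w \<notin> of_real ` range z"
    let ?a = "\<lambda>n. 1 - w / of_real (z n)"
    have "summable (\<lambda>n. norm w * (1 / z n))" by (intro summable_mult sm)
    moreover have "norm (?a n - 1) = norm w * (1 / z n)" for n
      using z[of n] by (simp add: norm_divide)
    ultimately have "summable (\<lambda>n. norm (?a n - 1))" by simp
    then have cp: "convergent_prod ?a"
      by (intro abs_convergent_prod_imp_convergent_prod summable_imp_abs_convergent_prod)
    have "?a n \<noteq> 0" for n using n z[of n] by (auto simp: divide_simps)
    then have "prodinf ?a \<noteq> 0" using cp by (intro prodinf_nonzero) auto
    have "(\<lambda>N. pprod z (Suc N) w) \<longlonglongrightarrow> prodinf ?a"
      using convergent_prod_LIMSEQ[OF cp] by (simp add: pprod_def lessThan_Suc_atMost)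
    moreover have "(\<lambda>N. pprod z (Suc N) w) \<longlonglongrightarrow> f w"
      using lim by (rule LIMSEQ_Suc)
    ultimately have "prodinf ?a = f w" by (rule LIMSEQ_unique)
    with \<open>prodinf ?a \<noteq> 0\<close> f show False by simp
  qed
qed

lemma genus_zero_log_derivative:
  assumes "genus_zero f z" and f': "(f has_field_derivative f') (at w)" and "f w \<noteq> 0"
  shows "(\<lambda>n. 1 / (of_real (z n) - w)) sums (- f' / f w)"
proof -
  have w: "w \<noteq> of_real (z n)" for n
    using genus_zero_zeros[OF assms(1)] assms(3) by auto
  have z: "\<And>n. 0 < z n" and lim: "(\<lambda>N. pprod z N w) \<longlonglongrightarrow> f w"
    using genus_zero_pos[OF assms(1)] assms(1) by (auto simp: genus_zero_def)
  have "(\<lambda>N. - dpprod z N w / pprod z N w) \<longlonglongrightarrow> - f' / f w"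
    by (intro tendsto_intros dpprod_tendsto[OF assms(1,2)] lim assms)
  moreover have "- dpprod z N w / pprod z N w = (\<Sum>n<N. 1 / (of_real (z n) - w))" for N
  proof -
    have "pprod z N w \<noteq> 0" using w z by (auto simp: pprod_def divide_simps)
    then show ?thesis using z w by (subst dpprod_eq) (auto simp: less_imp_neq[symmetric])
  qed
  ultimately show ?thesis by (simp add: sums_def)
qed

text \<open>The factors are exchanged one at a time; each exchange costs the difference of the two
  factors times the bounds of the others.\<close>

lemma norm_prod_diff_le:
  fixes a b :: "nat \<Rightarrow> 'a::real_normed_field"
  assumes "\<And>n. n < N \<Longrightarrow> norm (a n) \<le> B n" "\<And>n. n < N \<Longrightarrow> norm (b n) \<le> B n"
  shows "norm ((\<Prod>n<N. 1 + a n) - (\<Prod>n<N. 1 + b n)) \<le> (\<Prod>n<N. 1 + B n) * (\<Sum>n<N. norm (a n - b n))"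
  using assms
proof (induction N)
  case (Suc N)
  have B0: "0 \<le> B n" if "n < Suc N" for n using Suc.prems(1)[OF that] norm_ge_zero order_trans by blast
  define P Q C S where "P = (\<Prod>n<N. 1 + a n)" and "Q = (\<Prod>n<N. 1 + b n)"
    and "C = (\<Prod>n<N. 1 + B n)" and "S = (\<Sum>n<N. norm (a n - b n))"
  have IH: "norm (P - Q) \<le> C * S" unfolding P_def Q_def C_def S_def using Suc by auto
  have Q: "norm Q \<le> C"
    unfolding Q_def C_def prod_norm[symmetric]
    by (intro prod_mono) (use Suc.prems(2) in \<open>auto intro!: order_trans[OF norm_triangle_ineq]\<close>)
  have C0: "0 \<le> C" unfolding C_def using B0 by (intro prod_nonneg) (auto simp: add_nonneg_nonneg)
  have a: "norm (1 + a N) \<le> 1 + B N"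
    using Suc.prems(1)[of N] by (intro order_trans[OF norm_triangle_ineq]) auto
  have "norm (P * (1 + a N) - Q * (1 + b N)) = norm ((P - Q) * (1 + a N) + Q * (a N - b N))"
    by (simp add: algebra_simps)
  also have "\<dots> \<le> norm (P - Q) * norm (1 + a N) + norm Q * norm (a N - b N)"
    by (intro order_trans[OF norm_triangle_ineq]) (simp add: norm_mult)
  also have "\<dots> \<le> (C * S) * (1 + B N) + C * norm (a N - b N)"
    using IH Q a C0 by (intro add_mono mult_mono) (auto simp: S_def sum_nonneg)
  also have "\<dots> \<le> (C * S) * (1 + B N) + C * (1 + B N) * norm (a N - b N)"
  proof -
    have "C * 1 \<le> C * (1 + B N)" using B0[of N] C0 by (intro mult_left_mono) auto
    then show ?thesis by (intro add_left_mono mult_right_mono) auto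
  qed
  finally show ?case by (simp add: P_def Q_def C_def S_def algebra_simps)
qed simp

text \<open>Tannery's theorem for products: the number of factors and the factors themselves both
  change with N. This is the situation of critical points that move as the partial product
  grows.\<close>

lemma tendsto_prod_dominated:
  fixes a :: "nat \<Rightarrow> nat \<Rightarrow> complex"
  assumes a: "\<And>N n. n < N \<Longrightarrow> norm (a N n) \<le> B n" and b: "\<And>n. norm (b n) \<le> B n"
    and sm: "summable B" and lim: "\<And>n. (\<lambda>N. a N n) \<longlonglongrightarrow> b n"
    and l: "(\<lambda>N. \<Prod>n<N. 1 + b n) \<longlonglongrightarrow> l"
  shows "(\<lambda>N. \<Prod>n<N. 1 + a N n) \<longlonglongrightarrow> l"
proof -
  have B0: "0 \<le> B n" for n using b[of n] norm_ge_zero order_trans by blast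
  \<comment> \<open>Padding with 0 beyond N turns the finite sums into full series, to which
    Tannery's theorem for series applies.\<close>
  define c where "c n N = (if n < N then norm (a N n - b n) else 0)" for n N
  have "eventually (\<lambda>N. summable (\<lambda>n. norm (c n N))) sequentially \<and> summable (\<lambda>n. norm (0::real)) \<and>
      ((\<lambda>N. suminf (\<lambda>n. c n N)) \<longlongrightarrow> suminf (\<lambda>_. 0::real)) sequentially"
  proof (rule tannerys_theorem)
    show "(\<lambda>N. c n N) \<longlonglongrightarrow> 0" for n
    proof -
      have "(\<lambda>N. norm (a N n - b n)) \<longlonglongrightarrow> 0"
        using lim[of n] by (simp add: LIM_zero tendsto_norm_zero)
      moreover have "eventually (\<lambda>N. c n N = norm (a N n - b n)) sequentially"
        using eventually_gt_at_top[of n] by eventually_elim (simp add: c_def)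
      ultimately show ?thesis using tendsto_cong[of "c n" "\<lambda>N. norm (a N n - b n)"] by simp
    qed
    have "norm (c n N) \<le> 2 * B n" for n N
      unfolding c_def using a[of n N] b[of n] B0[of n]
      by (auto intro!: order_trans[OF norm_triangle_ineq4])
    then show "eventually (\<lambda>(n, N). norm (c n N) \<le> 2 * B n) (sequentially \<times>\<^sub>F sequentially)"
      by (intro always_eventually) auto
    show "summable (\<lambda>n. 2 * B n)" by (intro summable_mult sm)
  qed simp
  moreover have "suminf (\<lambda>n. c n N) = (\<Sum>n<N. norm (a N n - b n))" for N
    by (subst suminf_finite[of "{..<N}"]) (auto simp: c_def)
  ultimately have s: "(\<lambda>N. \<Sum>n<N. norm (a N n - b n)) \<longlonglongrightarrow> 0" by simp
  have bd: "norm ((\<Prod>n<N. 1 + a N n) - (\<Prod>n<N. 1 + b n)) \<le> exp (suminf B) * (\<Sum>n<N. norm (a N n - b n))" for N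
  proof -
    have "(\<Prod>n<N. 1 + B n) \<le> (\<Prod>n<N. exp (B n))"
      by (intro prod_mono) (use B0 in \<open>auto simp: add_nonneg_nonneg\<close>)
    also have "\<dots> = exp (\<Sum>n<N. B n)" by (simp add: exp_sum)
    also have "\<dots> \<le> exp (suminf B)" by (simp add: sum_le_suminf sm B0)
    finally have "(\<Prod>n<N. 1 + B n) * (\<Sum>n<N. norm (a N n - b n)) \<le> exp (suminf B) * (\<Sum>n<N. norm (a N n - b n))"
      by (intro mult_right_mono) (auto simp: sum_nonneg)
    then show ?thesis
      using norm_prod_diff_le[of N "a N" B b] a b by (meson order_trans)
  qed
  have lim0: "(\<lambda>N. exp (suminf B) * (\<Sum>n<N. norm (a N n - b n))) \<longlonglongrightarrow> 0"
    using tendsto_mult_left[OF s] by simp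
  have "(\<lambda>N. (\<Prod>n<N. 1 + a N n) - (\<Prod>n<N. 1 + b n)) \<longlonglongrightarrow> 0"
    by (rule Lim_null_comparison[OF _ lim0]) (intro always_eventually allI bd)
  from tendsto_add[OF this l] show ?thesis by simp
qed

lemma ex_critical_point:
  fixes z :: "nat \<Rightarrow> real"
  assumes "strict_mono z" "0 < z 0" "Suc n < N"
  shows "\<exists>x. z n < x \<and> x < z (Suc n) \<and> dpprod z N x = 0"
proof -
  have zn: "z n < z (Suc n)" using assms by (simp add: strict_mono_def)
  have pos: "0 < z m" for m
    using assms by (metis less_eq_nat.simps(1) order.strict_trans2 strict_mono_less_eq)
  have zero: "pprod z N (z m) = 0" if "m < N" for m
    using that pos[of m] by (auto simp: pprod_def intro!: prod_zero bexI[of _ m])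
  have "\<exists>x. z n < x \<and> x < z (Suc n) \<and> ((\<lambda>y. pprod z N y) has_real_derivative 0) (at x)"
  proof (rule Rolle[OF zn])
    show "pprod z N (z n) = pprod z N (z (Suc n))" using zero assms(3) by simp
    show "continuous_on {z n..z (Suc n)} (\<lambda>y. pprod z N y)"
      by (intro DERIV_continuous_on[OF DERIV_subset[OF pprod_has_derivative]]) auto
    show "(\<lambda>y. pprod z N y) differentiable (at x)" for x :: real
      unfolding real_differentiable_def using pprod_has_derivative[of z N x] by (rule exI)
  qed
  then show ?thesis using DERIV_unique[OF pprod_has_derivative] by metis
qed

text \<open>Between two consecutive zeros the logarithmic derivative of the partial product is decreasing,
  and a further factor lowers it. Hence each critical point moves to the left as the number of
  factors grows, and converges.\<close>

lemma critical_point_decreasing: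
  fixes z :: "nat \<Rightarrow> real"
  assumes z: "strict_mono z" "0 < z 0" "Suc n < N"
    and x: "z n < x" "x < z (Suc n)" "dpprod z N x = 0"
    and y: "z n < y" "y < z (Suc n)" "dpprod z (Suc N) y = 0"
  shows "y < x"
proof (rule ccontr)
  assume "\<not> y < x"
  then have xy: "x \<le> y" by simp
  have pos: "z m \<noteq> 0" for m
    using z by (metis less_eq_nat.simps(1) order.strict_trans2 strict_mono_less_eq less_irrefl)
  have cases: "z m \<le> z n \<or> z (Suc n) \<le> z m" for m
    using z(1) by (metis not_less_eq_eq strict_mono_less_eq)
  then have neq: "z m \<noteq> u" if "z n < u" "u < z (Suc n)" for m u
    using that by (metis not_le)
  have S: "(\<Sum>m<M. 1 / (z m - u)) = 0" if "z n < u" "u < z (Suc n)" "dpprod z M u = 0" for M u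
  proof -
    have "pprod z M u \<noteq> 0" using neq[OF that(1,2)] pos by (auto simp: pprod_def divide_simps)
    then show ?thesis
      using dpprod_eq[of z u M] that(3) pos neq[OF that(1,2)] by auto
  qed
  have mono: "1 / (z m - x) \<le> 1 / (z m - y)" for m
    using cases[of m]
  proof
    assume "z m \<le> z n"
    then show ?thesis using x y xy by (intro divide_left_mono) (auto intro!: mult_neg_neg)
  next
    assume "z (Suc n) \<le> z m"
    then show ?thesis using x y xy by (intro divide_left_mono) (auto intro!: mult_pos_pos)
  qed
  have "0 = (\<Sum>m<Suc N. 1 / (z m - y))" using S[OF y] by simp
  also have "\<dots> = (\<Sum>m<N. 1 / (z m - y)) + 1 / (z N - y)" by simp
  also have "\<dots> \<ge> (\<Sum>m<N. 1 / (z m - x)) + 1 / (z N - y)"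
    by (intro add_right_mono sum_mono mono)
  also have "(\<Sum>m<N. 1 / (z m - x)) = 0" by (rule S[OF x])
  finally have "1 / (z N - y) \<le> 0" by simp
  moreover have "z (Suc n) < z N" using z by (simp add: strict_mono_def)
  ultimately show False using y by (simp add: divide_le_0_iff)
qed

text \<open>Both sides are polynomials of degree at most M. They agree at 0 and at the M critical
  points, which lie in disjoint gaps and are therefore distinct: M + 1 points in all.\<close>

lemma dpprod_factorization:
  fixes z :: "nat \<Rightarrow> real"
  assumes z: "strict_mono z" "0 < z 0"
    and \<xi>: "\<And>n. n < M \<Longrightarrow> z n < \<xi> n" "\<And>n. n < M \<Longrightarrow> \<xi> n < z (Suc n)"
      "\<And>n. n < M \<Longrightarrow> dpprod z (Suc M) (\<xi> n) = 0"
  shows "dpprod z (Suc M) w = dpprod z (Suc M) 0 * (\<Prod>n<M. 1 - w / complex_of_real (\<xi> n))"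
proof -
  have pos: "0 < z m" for m
    using z by (metis less_eq_nat.simps(1) order.strict_trans2 strict_mono_less_eq)
  define L where "L = (\<lambda>n. [:1, - 1 / complex_of_real (z n):])"
  define p where "p = (\<Sum>m<Suc M. smult (- 1 / complex_of_real (z m)) (\<Prod>n\<in>{..<Suc M} - {m}. L n))"
  define q where "q = smult (dpprod z (Suc M) 0) (\<Prod>n<M. [:1, - 1 / complex_of_real (\<xi> n):])"
  have p: "poly p w = dpprod z (Suc M) w" for w
    by (simp add: p_def dpprod_def poly_sum poly_prod L_def del: sum.lessThan_Suc)
  have q: "poly q w = dpprod z (Suc M) 0 * (\<Prod>n<M. 1 - w / complex_of_real (\<xi> n))" for w
    by (simp add: q_def poly_prod)
  have inj: "\<xi> m < \<xi> n" if "m < n" "n < M" for m n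
  proof -
    have "\<xi> m < z (Suc m)" "z n < \<xi> n" using \<xi> that by auto
    moreover have "z (Suc m) \<le> z n" using that z by (simp add: strict_mono_less_eq)
    ultimately show ?thesis by simp
  qed
  define A where "A = insert 0 (complex_of_real ` \<xi> ` {..<M})"
  have \<xi>pos: "0 < \<xi> n" if "n < M" for n using \<xi>(1)[OF that] pos[of n] by simp
  have "inj_on \<xi> {..<M}" by (rule inj_onI) (metis inj lessThan_iff linorder_neqE_nat less_irrefl)
  then have "card (complex_of_real ` \<xi> ` {..<M}) = M"
    by (simp add: card_image image_image inj_on_def)
  moreover have "0 \<notin> complex_of_real ` \<xi> ` {..<M}" using \<xi>pos by force
  ultimately have card: "card A = Suc M" by (simp add: A_def)
  have dL: "degree (\<Prod>n\<in>B. [:1, g n:]) \<le> card B" if "finite B" for B and g :: "nat \<Rightarrow> complex"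
  proof -
    have "degree (\<Prod>n\<in>B. [:1, g n:]) \<le> sum (degree \<circ> (\<lambda>n. [:1, g n:])) B"
      by (rule degree_prod_sum_le[OF that])
    also have "\<dots> \<le> (\<Sum>n\<in>B. 1)" by (intro sum_mono) simp
    finally show ?thesis by simp
  qed
  have "degree p \<le> M"
    unfolding p_def
  proof (intro degree_sum_le)
    fix m assume "m \<in> {..<Suc M}"
    then have "card ({..<Suc M} - {m}) = M" by simp
    then have "degree (\<Prod>n\<in>{..<Suc M} - {m}. L n) \<le> M"
      unfolding L_def using dL[of "{..<Suc M} - {m}" "\<lambda>n. - 1 / complex_of_real (z n)"] by simp
    then show "degree (smult (- 1 / complex_of_real (z m)) (\<Prod>n\<in>{..<Suc M} - {m}. L n)) \<le> M"
      using degree_smult_le order_trans by blast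
  qed simp
  moreover have "degree q \<le> M"
    unfolding q_def using dL[of "{..<M}" "\<lambda>n. - 1 / complex_of_real (\<xi> n)"]
    by (intro order_trans[OF degree_smult_le]) simp
  moreover have "poly p x = poly q x" if "x \<in> A" for x
  proof (cases "x = 0")
    case True
    then show ?thesis by (simp add: p q)
  next
    case False
    then obtain n where n: "n < M" "x = complex_of_real (\<xi> n)" using \<open>x \<in> A\<close> by (auto simp: A_def)
    then have "(\<Prod>n<M. 1 - x / complex_of_real (\<xi> n)) = 0"
      using \<xi>pos[OF n(1)] n by (intro prod_zero bexI[of _ n]) auto
    then show ?thesis using \<xi>(3)[OF n(1)] by (simp add: p q n(2) dpprod_of_real)
  qed
  ultimately have "p = q"
    using card by (intro poly_eqI_degree[of A]) auto
  then show ?thesis using p q by metis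
qed

text \<open>The Rolle points of the partial products converge because they are monotone in the
  number of factors, and their limits are the zeros of f'. As they lie to the right of z n, the
  summable sequence 1 / z n dominates, and the factored derivatives converge to the product over the
  limits.\<close>

lemma genus_zero_derivative:
  assumes f: "genus_zero f z" and f': "\<And>w. (f has_field_derivative f' w) (at w)"
    and nz: "f' 0 \<noteq> 0" "\<And>n. f' (of_real (z n)) \<noteq> 0"
  shows "\<exists>y. genus_zero (\<lambda>w. f' w / f' 0) y"
proof -
  have z: "strict_mono z" "0 < z 0" "\<And>n. 0 < z n" and sm: "summable (\<lambda>n. 1 / z n)"
    using genus_zero_pos[OF f] f by (auto simp: genus_zero_def)
  have "\<forall>N n. \<exists>x. Suc n < N \<longrightarrow> z n < x \<and> x < z (Suc n) \<and> dpprod z N x = 0"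
    using ex_critical_point[OF z(1,2)] by blast
  then obtain \<xi> where \<xi>: "\<And>N n. Suc n < N \<Longrightarrow> z n < \<xi> N n" "\<And>N n. Suc n < N \<Longrightarrow> \<xi> N n < z (Suc n)"
    "\<And>N n. Suc n < N \<Longrightarrow> dpprod z N (\<xi> N n) = 0"
    by metis
  have "\<exists>l. (\<lambda>N. \<xi> N n) \<longlonglongrightarrow> l \<and> z n \<le> l \<and> l \<le> z (Suc n)" for n
  proof -
    \<comment> \<open>The n-th gap lies between zeros of the partial product only when N is at least
      n + 2, hence the offset.\<close>
    have "decseq (\<lambda>N. \<xi> (N + (n + 2)) n)"
    proof (rule decseq_SucI)
      show "\<xi> (Suc N + (n + 2)) n \<le> \<xi> (N + (n + 2)) n" for N
        using critical_point_decreasing[OF z(1,2), of n "N + (n + 2)" "\<xi> (N + (n + 2)) n" "\<xi> (Suc N + (n + 2)) n"]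
          \<xi>[of n "N + (n + 2)"] \<xi>[of n "Suc N + (n + 2)"] by simp
    qed
    moreover have "\<forall>N. z n \<le> \<xi> (N + (n + 2)) n" using \<xi>(1)[of n] by (simp add: less_imp_le)
    ultimately obtain l where l: "(\<lambda>N. \<xi> (N + (n + 2)) n) \<longlonglongrightarrow> l" by (rule decseq_convergent)
    have "z n \<le> l" using l by (rule LIMSEQ_le_const) (use \<xi>(1)[of n] in \<open>auto simp: less_imp_le\<close>)
    moreover have "l \<le> z (Suc n)" using l by (rule LIMSEQ_le_const2) (use \<xi>(2)[of n] in \<open>auto simp: less_imp_le\<close>)
    ultimately show ?thesis using LIMSEQ_offset[OF l] by blast
  qed
  then obtain y where y: "\<And>n. (\<lambda>N. \<xi> N n) \<longlonglongrightarrow> y n" "\<And>n. z n \<le> y n" "\<And>n. y n \<le> z (Suc n)"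
    by metis
  have ypos: "0 < y n" for n using y(2)[of n] z(3)[of n] by simp
  have smy: "summable (\<lambda>n. 1 / y n)"
    by (rule summable_comparison_test[OF _ sm])
       (use y(2) z(3) ypos in \<open>auto intro!: exI[of _ 0] divide_left_mono simp: less_imp_le abs_of_pos\<close>)
  have lim: "(\<lambda>N. pprod y N w) \<longlonglongrightarrow> f' w / f' 0" for w
  proof -
    have "uniformly_convergent_on (cball 0 (norm w)) (\<lambda>N w::complex. pprod y N w)"
      by (rule pprod_uniformly_convergent[OF ypos smy])
    then have "convergent (\<lambda>N. pprod y N w)"
      by (rule uniformly_convergent_imp_convergent) simp
    then obtain l where l: "(\<lambda>N. pprod y N w) \<longlonglongrightarrow> l" by (auto simp: convergent_def)
    \<comment> \<open>A product of M + 1 linear factors has M critical points, hence the index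
      \<open>Suc M\<close>.\<close>
    have "(\<lambda>M. \<Prod>n<M. 1 + (- w / complex_of_real (\<xi> (Suc M) n))) \<longlonglongrightarrow> l"
    proof (rule tendsto_prod_dominated)
      show "norm (- w / complex_of_real (\<xi> (Suc M) n)) \<le> norm w * (1 / z n)" if "n < M" for M n
        using \<xi>(1)[of n "Suc M"] that z(3)[of n]
        by (auto simp: norm_divide intro!: divide_left_mono)
      show "norm (- w / complex_of_real (y n)) \<le> norm w * (1 / z n)" for n
        using y(2)[of n] ypos[of n] z(3)[of n]
        by (auto simp: norm_divide intro!: divide_left_mono)
      show "summable (\<lambda>n. norm w * (1 / z n))" by (intro summable_mult sm)
      show "(\<lambda>M. - w / complex_of_real (\<xi> (Suc M) n)) \<longlonglongrightarrow> - w / complex_of_real (y n)" for n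
        using ypos[of n] by (intro tendsto_intros LIMSEQ_Suc[OF y(1)]) auto
      show "(\<lambda>N. \<Prod>n<N. 1 + - w / complex_of_real (y n)) \<longlonglongrightarrow> l"
        using l by (simp add: pprod_def)
    qed
    then have "(\<lambda>M. dpprod z (Suc M) 0 * (\<Prod>n<M. 1 - w / complex_of_real (\<xi> (Suc M) n))) \<longlonglongrightarrow> f' 0 * l"
      by (intro tendsto_mult LIMSEQ_Suc[OF dpprod_tendsto[OF f f']]) simp
    moreover have "dpprod z (Suc M) 0 * (\<Prod>n<M. 1 - w / complex_of_real (\<xi> (Suc M) n)) = dpprod z (Suc M) w" for M
      by (rule dpprod_factorization[symmetric, OF z(1,2)]) (use \<xi> in auto)
    ultimately have "(\<lambda>M. dpprod z (Suc M) w) \<longlonglongrightarrow> f' 0 * l" by simp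
    then have "f' w = f' 0 * l"
      by (rule LIMSEQ_unique[OF LIMSEQ_Suc[OF dpprod_tendsto[OF f f']]])
    then show ?thesis using l nz(1) by simp
  qed
  \<comment> \<open>In the limit a critical point might reach a zero of f. As y m is a zero of f',
    this is excluded by the hypothesis on f' (z n), and the interlacing becomes strict.\<close>
  have neq: "y m \<noteq> z n" for m n
  proof
    assume "y m = z n"
    have "eventually (\<lambda>N. pprod y N (complex_of_real (y m)) = 0) sequentially"
      using eventually_gt_at_top[of m]
      by eventually_elim (use ypos[of m] in \<open>auto simp: pprod_def intro!: prod_zero bexI[of _ m]\<close>)
    then have "(\<lambda>N. pprod y N (complex_of_real (y m))) \<longlonglongrightarrow> 0"
      by (rule tendsto_eventually)
    from LIMSEQ_unique[OF lim this] have "f' (of_real (y m)) / f' 0 = 0" .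
    then show False using nz \<open>y m = z n\<close> by simp
  qed
  have "strict_mono y"
    unfolding strict_mono_Suc_iff
  proof
    fix n
    have "y n < z (Suc n)" using y(3)[of n] neq[of n "Suc n"] by simp
    then show "y n < y (Suc n)" using y(2)[of "Suc n"] by simp
  qed
  then show ?thesis
    using ypos smy lim by (auto simp: genus_zero_def)
qed

text \<open>The recurrence carries a common zero of neighbouring functions down to
  \<open>bes 0\<close> and \<open>bes 1\<close>; there \<open>exp_bes\<close> would make the
  exponential vanish.\<close>

lemma bes_no_common_zero:
  fixes v :: complex
  assumes "bes k v = 0" "bes (Suc k) v = 0"
  shows False
proof -
  have "bes 0 v = 0 \<and> bes 1 v = 0"
    using assms
  proof (induction k)
    case (Suc k)
    have "bes k v = 0" using bes_recurrence[of k v] Suc.prems by simp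
    then show ?case using Suc by simp
  qed simp
  then have "exp (csqrt v) = 0" using exp_bes(1)[of "csqrt v"] by simp
  then show False by simp
qed

lemma genus_zero_bes: "\<exists>z. genus_zero (\<lambda>w. bes k (- w) / of_real (besc k 0)) z"
proof (induction k)
  case 0
  \<comment> \<open>The zeros of sin (sqrt w) / sqrt w; its product is Euler's sine product,
    evaluated at s = sqrt w / pi.\<close>
  define z where "z n = (pi * real (Suc n))\<^sup>2" for n
  have "genus_zero (\<lambda>w. bes 0 (- w) / of_real (besc 0 0)) z"
    unfolding genus_zero_def
  proof (intro conjI allI)
    show "strict_mono z"
      unfolding strict_mono_Suc_iff z_def by (auto intro!: power_strict_mono)
    show "0 < z 0" by (simp add: z_def)
    have "summable (\<lambda>n. 1 / real n ^ 2)"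
      using inverse_power_summable[of 2, where 'a = real] by (simp add: inverse_eq_divide)
    then have "summable (\<lambda>n. 1 / real (Suc n) ^ 2)"
      using summable_Suc_iff[of "\<lambda>n. 1 / real n ^ 2"] by blast
    then have "summable (\<lambda>n. 1 / pi\<^sup>2 * (1 / real (Suc n) ^ 2))"
      by (rule summable_mult)
    then show "summable (\<lambda>n. 1 / z n)" by (simp add: z_def power_mult_distrib)
    fix w :: complex
    show "(\<lambda>N. pprod z N w) \<longlonglongrightarrow> bes 0 (- w) / of_real (besc 0 0)"
    proof (cases "w = 0")
      case True
      then show ?thesis by (simp add: pprod_def bes_0 besc_def)
    next
      case False
      define s where "s = csqrt w / of_real pi"
      have s: "w = (of_real pi * s)\<^sup>2" "of_real pi * s \<noteq> 0"
        using False by (auto simp: s_def)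
      define u where "u = of_real pi * s"
      have u: "(\<i> * u)\<^sup>2 = - w" by (simp add: s(1) u_def power_mult_distrib)
      have "sin u = (exp (\<i> * u) - exp (- (\<i> * u))) / (2 * \<i>)"
        by (rule sin_exp_eq)
      also have "exp (\<i> * u) - exp (- (\<i> * u)) = 2 * (\<i> * u * bes 0 (- w))"
        using exp_bes[of "\<i> * u", unfolded u] by simp
      finally have "sin (of_real pi * s) = (of_real pi * s) * bes 0 (- w)"
        by (simp add: u_def)
      then have "(\<lambda>n. of_real pi * s * (\<Prod>k=1..n. 1 - s\<^sup>2 / of_nat k^2)) \<longlonglongrightarrow> (of_real pi * s) * bes 0 (- w)"
        using sin_product_formula_complex[of s] by simp
      then have "(\<lambda>n. (\<Prod>k=1..n. 1 - s\<^sup>2 / of_nat k^2)) \<longlonglongrightarrow> bes 0 (- w)"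
        by (subst (asm) tendsto_mult_left_iff) (use s(2) in auto)
      moreover have "(\<Prod>k=1..n. 1 - s\<^sup>2 / of_nat k^2) = pprod z n w" for n
        unfolding pprod_def z_def
        by (rule prod.reindex_bij_witness[of _ Suc "\<lambda>k. k - 1"]) (auto simp: s(1) power_mult_distrib)
      ultimately show ?thesis by (simp add: besc_def)
    qed
  qed
  then show ?case by (rule exI[of _ z])
next
  case (Suc k)
  then obtain z where z: "genus_zero (\<lambda>w. bes k (- w) / of_real (besc k 0)) z" ..
  let ?f' = "\<lambda>w. - bes (Suc k) (- w) / (2 * complex_of_real (besc k 0))"
  have c: "besc k 0 \<noteq> 0" for k using besc_pos[of k 0] by simp
  have b0: "bes (Suc k) 0 \<noteq> (0 :: complex)" using c by (simp add: bes_0)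
  have "\<exists>y. genus_zero (\<lambda>w. ?f' w / ?f' 0) y"
  proof (rule genus_zero_derivative[OF z])
    show "((\<lambda>w. bes k (- w) / of_real (besc k 0)) has_field_derivative ?f' w) (at w)" for w
      using c[of k] by (auto intro!: derivative_eq_intros bes_has_field_derivative[THEN DERIV_chain2] simp: field_simps)
    show "?f' 0 \<noteq> 0" using b0 c[of k] by simp
    \<comment> \<open>The zeros are simple, because \<open>bes (Suc k)\<close> is proportional to
      the derivative and shares no zero with \<open>bes k\<close>.\<close>
    show "?f' (of_real (z n)) \<noteq> 0" for n
    proof
      assume "?f' (of_real (z n)) = 0"
      then have "bes (Suc k) (- complex_of_real (z n)) = 0" using c[of k] by simp
      moreover have "bes k (- complex_of_real (z n)) / of_real (besc k 0) = 0"
        using genus_zero_zeros[OF z] by auto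
      ultimately show False using c[of k] bes_no_common_zero by auto
    qed
  qed
  moreover have "?f' w / ?f' 0 = bes (Suc k) (- w) / of_real (besc (Suc k) 0)" for w
    using c[of k] c[of "Suc k"] by (simp add: bes_0 scaleR_conv_of_real)
  ultimately show ?case by simp
qed

section \<open>Zeros of the Bessel functions of half-odd order\<close>

lemma Gamma_half_odd: "Gamma (real m + 3 / 2) = sqrt pi / 2 * (\<Prod>i\<le>m. 2 * real i + 1) / 2 ^ m"
proof (induction m)
  case 0
  have "Gamma (1 / 2 + 1 :: real) = 1 / 2 * Gamma (1 / 2)"
    by (rule Gamma_plus1) (auto elim!: nonpos_Ints_cases)
  then show ?case by (simp add: Gamma_one_half_real)
next
  case (Suc m)
  have "Gamma (real m + 3 / 2 + 1) = (real m + 3 / 2) * Gamma (real m + 3 / 2)"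
    by (rule Gamma_plus1) (auto elim!: nonpos_Ints_cases)
  moreover have "real (Suc m) + 3 / 2 = real m + 3 / 2 + 1" by simp
  ultimately have "Gamma (real (Suc m) + 3 / 2) = (real m + 3 / 2) * Gamma (real m + 3 / 2)" by metis
  then show ?case unfolding Suc by (simp add: field_simps)
qed

text \<open>At half-odd order the Gamma values are double factorials times sqrt pi, so the series is
  that of \<open>bes k\<close> up to a prefactor. The prefactor is positive and leaves the positive
  zeros unchanged.\<close>

lemma bessel_J_half_odd:
  assumes "0 < x"
  shows "bessel_J (real k + 1 / 2) x =
    (x / 2) powr (real k + 1 / 2) * 2 ^ (k + 1) / sqrt pi * bes k (- (x\<^sup>2))"
proof -
  let ?C = "(x / 2) powr (real k + 1 / 2) * 2 ^ (k + 1) / sqrt pi"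
  have "(-1) ^ n / (fact n * Gamma (real k + 1 / 2 + real n + 1)) * (x / 2) powr (2 * real n + (real k + 1 / 2))
      = ?C * (besc k n *\<^sub>R (- (x\<^sup>2)) ^ n)" for n
  proof -
    have "real k + 1 / 2 + real n + 1 = real (k + n) + 3 / 2" by simp
    then have G: "Gamma (real k + 1 / 2 + real n + 1) = sqrt pi / 2 * (\<Prod>i\<le>k + n. 2 * real i + 1) / 2 ^ (k + n)"
      by (simp only: Gamma_half_odd)
    have "(x / 2) powr (2 * real n + (real k + 1 / 2)) = (x / 2) ^ (2 * n) * (x / 2) powr (real k + 1 / 2)"
      using assms by (simp add: powr_add powr_realpow[symmetric])
    then have p: "(x / 2) powr (2 * real n + (real k + 1 / 2)) = (x\<^sup>2) ^ n / 4 ^ n * (x / 2) powr (real k + 1 / 2)"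
      by (simp add: power_mult power_divide)
    define D where "D = (\<Prod>i\<le>k + n. 2 * real i + 1)"
    have "D > 0" unfolding D_def by (auto intro: prod_pos)
    have "(4::real) ^ n = 2 ^ n * 2 ^ n" by (simp add: power_mult_distrib[symmetric])
    then show ?thesis
      unfolding G p besc_def D_def[symmetric] power_minus[of "x\<^sup>2"] using \<open>D > 0\<close>
      by (simp add: field_simps power_add)
  qed
  moreover have "(\<lambda>n. ?C * (besc k n *\<^sub>R (- (x\<^sup>2)) ^ n)) sums (?C * bes k (- (x\<^sup>2)))"
    by (intro sums_mult bes_sums)
  ultimately show ?thesis
    unfolding bessel_J_def by (simp only: sums_iff)
qed

text \<open>This is the uniqueness behind the definite description in
  \<open>bessel_zero\<close>.\<close>

lemma strict_mono_range_eq: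
  fixes f g :: "nat \<Rightarrow> 'a::linorder"
  assumes "strict_mono f" "strict_mono g" "range f = range g"
  shows "f = g"
proof -
  have le: "g n \<le> f n" if "strict_mono f" "strict_mono g" "range f = range g" for f g :: "nat \<Rightarrow> 'a" and n
  proof -
    have "\<forall>n. \<exists>m. f n = g m" using that(3) by (metis rangeE rangeI)
    then obtain h where h: "\<And>n. f n = g (h n)" by metis
    have "strict_mono h"
      by (rule strict_monoI) (metis h strict_mono_less that(1,2))
    then have "n \<le> h n" by (rule strict_mono_imp_increasing)
    then show ?thesis using that(2) by (simp add: h strict_mono_less_eq)
  qed
  show ?thesis using le[OF assms] le[OF assms(2,1) assms(3)[symmetric]] by (auto intro!: ext antisym)
qed

text \<open>The zeros in the w-plane are the squares of the positive zeros of J_{k+1/2}. The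
  sequence known only from the existence of the product is thus traded for the one in
  \<open>Rfun\<close>.\<close>

lemma bessel_zero_eq:
  assumes z: "genus_zero (\<lambda>w. bes k (- w) / of_real (besc k 0)) z"
  shows "bessel_zero k = (\<lambda>n. sqrt (z n))"
proof -
  have pos: "0 < z n" for n by (rule genus_zero_pos[OF z])
  have c: "besc k 0 \<noteq> 0" using besc_pos[of k 0] by simp
  have zero: "bes k (- x) = 0 \<longleftrightarrow> x \<in> range z" for x :: real
  proof -
    have "bes k (- x) = 0 \<longleftrightarrow> bes k (- complex_of_real x) = 0"
      by (simp flip: of_real_minus add: bes_of_real)
    also have "\<dots> \<longleftrightarrow> complex_of_real x \<in> of_real ` range z"
      using genus_zero_zeros[OF z, of "complex_of_real x"] c by simp
    finally show ?thesis by (simp add: image_iff)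
  qed
  have "strict_mono (\<lambda>n. sqrt (z n))"
    using z by (auto simp: genus_zero_def strict_mono_def)
  moreover have "range (\<lambda>n. sqrt (z n)) = {x. 0 < x \<and> bessel_J (real k + 1 / 2) x = 0}"
  proof (intro equalityI subsetI)
    fix x assume "x \<in> range (\<lambda>n. sqrt (z n))"
    then obtain n where n: "x = sqrt (z n)" by auto
    then have "0 < x" "x\<^sup>2 = z n" using pos[of n] by auto
    moreover from this have "bes k (- (x\<^sup>2)) = 0" using zero by auto
    ultimately show "x \<in> {x. 0 < x \<and> bessel_J (real k + 1 / 2) x = 0}"
      using bessel_J_half_odd[of x k] by simp
  next
    fix x assume "x \<in> {x. 0 < x \<and> bessel_J (real k + 1 / 2) x = 0}"
    then have x: "0 < x" "bessel_J (real k + 1 / 2) x = 0" by auto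
    have "(x / 2) powr (real k + 1 / 2) * 2 ^ (k + 1) / sqrt pi \<noteq> 0" using x(1) by simp
    then have "bes k (- (x\<^sup>2)) = 0"
      using x(2) unfolding bessel_J_half_odd[OF x(1)] by (metis mult_eq_0_iff)
    then obtain n where "x\<^sup>2 = z n" using zero by auto
    then have "x = sqrt (z n)" using x(1) by (metis less_imp_le real_sqrt_unique)
    then show "x \<in> range (\<lambda>n. sqrt (z n))" by simp
  qed
  ultimately show ?thesis
    unfolding bessel_zero_def by (intro the_equality) (blast, metis strict_mono_range_eq)
qed

text \<open>The logarithmic derivative of the canonical product at w = - \<zeta>^2; the factor 2 in
  \<open>Rfun\<close> cancels the 1/2 that comes from differentiating in w.\<close>

lemma Rfun_eq:
  assumes "bes k (\<zeta>\<^sup>2) \<noteq> (0 :: complex)"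
  shows "Rfun k \<zeta> = \<zeta>\<^sup>2 * bes (Suc k) (\<zeta>\<^sup>2) / bes k (\<zeta>\<^sup>2)"
proof -
  obtain z where z: "genus_zero (\<lambda>w. bes k (- w) / of_real (besc k 0)) z"
    using genus_zero_bes by blast
  have c: "besc k 0 \<noteq> 0" using besc_pos[of k 0] by simp
  have d: "((\<lambda>w. bes k (- w) / complex_of_real (besc k 0)) has_field_derivative
      - bes (Suc k) (\<zeta>\<^sup>2) / (2 * of_real (besc k 0))) (at (- \<zeta>\<^sup>2))"
    using c by (auto intro!: derivative_eq_intros bes_has_field_derivative[THEN DERIV_chain2] simp: field_simps)
  have "(\<lambda>n. 1 / (of_real (z n) - (- \<zeta>\<^sup>2))) sums
      (- (- bes (Suc k) (\<zeta>\<^sup>2) / (2 * of_real (besc k 0))) / (bes k (- (- \<zeta>\<^sup>2)) / of_real (besc k 0)))"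
    by (rule genus_zero_log_derivative[OF z d]) (use assms c in simp)
  then have "(\<lambda>n. \<zeta>\<^sup>2 * (1 / (of_real (z n) + \<zeta>\<^sup>2))) sums (\<zeta>\<^sup>2 * (bes (Suc k) (\<zeta>\<^sup>2) / (2 * bes k (\<zeta>\<^sup>2))))"
    using c by (intro sums_mult) simp
  moreover have "complex_of_real (bessel_zero k n)^2 = of_real (z n)" for n
    using genus_zero_pos[OF z, of n] by (simp add: bessel_zero_eq[OF z] flip: of_real_power)
  ultimately show ?thesis
    unfolding Rfun_def by (simp add: sums_iff)
qed

text \<open>The zeros in \<zeta> lie on the imaginary axis at distance at least the first Bessel
  zero from the origin.\<close>

lemma bes_nonzero:
  assumes "norm \<zeta> < bessel_zero k 0"
  shows "bes k (\<zeta>\<^sup>2) \<noteq> (0 :: complex)"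
proof
  obtain z where z: "genus_zero (\<lambda>w. bes k (- w) / of_real (besc k 0)) z"
    using genus_zero_bes by blast
  assume "bes k (\<zeta>\<^sup>2) = 0"
  then have "(\<lambda>w. bes k (- w) / complex_of_real (besc k 0)) (- \<zeta>\<^sup>2) = 0" by simp
  then obtain n where n: "- \<zeta>\<^sup>2 = of_real (z n)" using genus_zero_zeros[OF z] by blast
  have "norm (\<zeta>\<^sup>2) = z n"
    using n genus_zero_pos[OF z, of n] by (metis abs_of_pos norm_minus_cancel norm_of_real)
  then have "(norm \<zeta>)\<^sup>2 = z n" by (simp add: norm_power)
  moreover have "z 0 \<le> z n" using z by (simp add: genus_zero_def strict_mono_less_eq)
  ultimately have "sqrt (z 0) \<le> norm \<zeta>" by (simp add: real_le_rsqrt real_sqrt_le_iff real_le_lsqrt)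
  then show False using assms by (simp add: bessel_zero_eq[OF z])
qed

section \<open>Unitary diagonalization\<close>

lemma matrix_vector_mult_scale: "A *v (c *s x) = c *s (A *v (x :: 'a::comm_ring_1^'n))"
  by (simp add: vec_eq_iff matrix_vector_mult_def sum_distrib_left ac_simps)

lemma matrix_vector_mult_scaleR_complex: "A *v (r *\<^sub>R x) = r *\<^sub>R (A *v (x :: complex^'n))"
  by (simp add: vec_eq_iff matrix_vector_mult_def scaleR_sum_right)

lemma linear_matrix_vector_mult_complex: "linear (\<lambda>x :: complex^'n. A *v x)"
  by (rule linearI) (simp_all add: matrix_vector_right_distrib matrix_vector_mult_scaleR_complex)

lemma inner_complex_vec: "x \<bullet> y = Re (\<Sum>i\<in>UNIV. x $ i * cnj (y $ i))" for x y :: "complex^'n"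
  by (simp add: inner_vec_def inner_complex_def)

text \<open>The Hermitian product of x and y has real part x \<bullet> y and imaginary part x
  \<bullet> (i y). Hermitian orthogonality is therefore expressed below by two real
  conditions.\<close>

lemma inner_i_scale_left: "(\<i> *s x) \<bullet> y = - (x \<bullet> (\<i> *s y))" for x y :: "complex^'n"
  by (simp add: inner_vec_def inner_complex_def sum_negf[symmetric])

lemma inner_i_scale_both: "(\<i> *s x) \<bullet> (\<i> *s y) = x \<bullet> y" for x y :: "complex^'n"
  by (simp add: inner_vec_def inner_complex_def add.commute)

lemma inner_i_scale_self: "x \<bullet> (\<i> *s x) = 0" for x :: "complex^'n"
  using inner_i_scale_left[of x x] by (simp add: inner_commute)

lemma hermitian_inner:
  fixes A :: "complex^'n^'n"
  assumes "ctransp A = A"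
  shows "(A *v x) \<bullet> y = x \<bullet> (A *v y)"
proof -
  have A: "A $ i $ j = cnj (A $ j $ i)" for i j
    using assms by (metis (no_types, lifting) ctransp_def vec_lambda_beta)
  have "(\<Sum>i\<in>UNIV. (A *v x) $ i * cnj (y $ i)) = (\<Sum>i\<in>UNIV. \<Sum>j\<in>UNIV. A $ i $ j * x $ j * cnj (y $ i))"
    by (simp add: matrix_vector_mult_def sum_distrib_right)
  also have "\<dots> = (\<Sum>j\<in>UNIV. \<Sum>i\<in>UNIV. A $ i $ j * x $ j * cnj (y $ i))"
    by (rule sum.swap)
  also have "\<dots> = (\<Sum>j\<in>UNIV. x $ j * cnj ((A *v y) $ j))"
    by (subst A) (simp add: matrix_vector_mult_def sum_distrib_left ac_simps)
  finally show ?thesis by (simp add: inner_complex_vec)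
qed

text \<open>Maximise x \<bullet> A x over the unit sphere of S. The residual e = A x - l x lies in S
  by invariance, and moving from x along e would raise the Rayleigh quotient to first order unless e
  = 0.\<close>

lemma hermitian_eigenvector_subspace:
  fixes A :: "complex^'n^'n"
  assumes A: "ctransp A = A" and S: "subspace S" "S \<noteq> {0}" and inv: "\<And>x. x \<in> S \<Longrightarrow> A *v x \<in> S"
  shows "\<exists>x\<in>S. norm x = 1 \<and> (\<exists>\<mu>::real. A *v x = \<mu> *\<^sub>R x)"
proof -
  let ?K = "S \<inter> sphere 0 1"
  have "compact ?K" using S(1) by (intro closed_Int_compact closed_subspace) auto
  moreover have "?K \<noteq> {}"
  proof -
    obtain y where y: "y \<in> S" "y \<noteq> 0" using S(2) subspace_0[OF S(1)] by blast
    then have "(1 / norm y) *\<^sub>R y \<in> ?K" using S(1) by (simp add: subspace_scale)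
    then show ?thesis by blast
  qed
  moreover have "continuous_on ?K (\<lambda>x. x \<bullet> (A *v x))"
    by (intro continuous_intros linear_continuous_on linear_conv_bounded_linear[THEN iffD1] linear_matrix_vector_mult_complex)
  ultimately obtain x where x: "x \<in> ?K" and max: "\<And>y. y \<in> ?K \<Longrightarrow> y \<bullet> (A *v y) \<le> x \<bullet> (A *v x)"
    using continuous_attains_sup[of ?K] by blast
  define l where "l = x \<bullet> (A *v x)"
  have xS: "x \<in> S" "norm x = 1" using x by auto
  have le: "u \<bullet> (A *v u) \<le> l * (norm u)\<^sup>2" if "u \<in> S" for u
  proof (cases "u = 0")
    case False
    then have "(1 / norm u) *\<^sub>R u \<in> ?K" using that S(1) by (simp add: subspace_scale)
    from max[OF this] have "(u \<bullet> (A *v u)) / (norm u)\<^sup>2 \<le> l"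
      by (simp add: matrix_vector_mult_scaleR_complex l_def power2_eq_square)
    then show ?thesis using False by (simp add: divide_simps)
  qed simp
  define e where "e = A *v x - l *\<^sub>R x"
  have eS: "e \<in> S" unfolding e_def using inv xS S(1) by (intro subspace_diff subspace_scale) auto
  define C where "C = l * (norm e)\<^sup>2 - e \<bullet> (A *v e)"
  have ineq: "2 * t * (norm e)\<^sup>2 \<le> t\<^sup>2 * C" for t
  proof -
    have "x + t *\<^sub>R e \<in> S" using xS eS S(1) by (intro subspace_add subspace_scale) auto
    from le[OF this]
    have "(x + t *\<^sub>R e) \<bullet> (A *v x + t *\<^sub>R (A *v e)) \<le> l * ((x + t *\<^sub>R e) \<bullet> (x + t *\<^sub>R e))"
      by (simp add: matrix_vector_right_distrib matrix_vector_mult_scaleR_complex power2_norm_eq_inner)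
    moreover have "x \<bullet> (A *v e) = e \<bullet> (A *v x)" using hermitian_inner[OF A, of x e] by (simp add: inner_commute)
    moreover have "x \<bullet> x = 1" using xS by (simp flip: power2_norm_eq_inner)
    ultimately have "l + 2 * t * (e \<bullet> (A *v x)) + t\<^sup>2 * (e \<bullet> (A *v e)) \<le> l * (1 + 2 * t * (e \<bullet> x) + t\<^sup>2 * (norm e)\<^sup>2)"
      unfolding power2_norm_eq_inner[of e]
      by (simp add: inner_add inner_commute[of x e] l_def[symmetric] power2_eq_square algebra_simps)
    moreover have N: "(norm e)\<^sup>2 = e \<bullet> (A *v x) - l * (e \<bullet> x)"
      by (metis e_def inner_diff_right inner_scaleR_right power2_norm_eq_inner)
    have "2 * t * (norm e)\<^sup>2 = 2 * t * (e \<bullet> (A *v x)) - l * (2 * t * (e \<bullet> x))"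
      unfolding N by (simp add: algebra_simps)
    ultimately show ?thesis by (simp add: C_def algebra_simps)
  qed
  have "e = 0"
  proof (rule ccontr)
    assume "e \<noteq> 0"
    \<comment> \<open>This step size makes the second-order term t C at most |e|^2, half of the
      first-order gain.\<close>
    define t where "t = (norm e)\<^sup>2 / (\<bar>C\<bar> + 1)"
    have "t > 0" using \<open>e \<noteq> 0\<close> by (simp add: t_def)
    have "t * (2 * (norm e)\<^sup>2) \<le> t * (t * C)" using ineq[of t] by (simp add: power2_eq_square ac_simps)
    then have "2 * (norm e)\<^sup>2 \<le> t * C" using \<open>t > 0\<close> by simp
    also have "\<dots> \<le> t * (\<bar>C\<bar> + 1)" using \<open>t > 0\<close> by (intro mult_left_mono) auto
    also have "\<dots> = (norm e)\<^sup>2" by (simp add: t_def)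
    finally show False using \<open>e \<noteq> 0\<close> by simp
  qed
  then show ?thesis using xS by (intro bexI[of _ x]) (auto simp: e_def)
qed

lemma matrix_diag_component:
  "(P ** diag_mat d ** Q) $ a $ b = (\<Sum>c\<in>UNIV. P $ a $ c * d $ c * Q $ c $ b)"
proof -
  have "(P ** diag_mat d) $ a $ c = P $ a $ c * d $ c" for c
    by (simp add: matrix_matrix_mult_def diag_mat_def if_distrib cong: if_cong)
  then show ?thesis by (simp add: matrix_matrix_mult_def[of "P ** diag_mat d"])
qed

text \<open>Take a Hermitian-orthonormal system E of eigenvectors of maximal size. Its complement is
  invariant, so if it were nonzero it would contain a further eigenvector. Dimensions are counted
  over the reals, where E together with i E consists of 2 |E| orthogonal vectors.\<close>

theorem hermitian_diagonalization:
  fixes A :: "complex^'n^'n"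
  assumes A: "ctransp A = A"
  shows "\<exists>P d. P ** ctransp P = mat 1 \<and> ctransp P ** P = mat 1 \<and> A = P ** diag_mat d ** ctransp P"
proof -
  define good where "good E \<longleftrightarrow> (\<forall>e\<in>E. norm e = 1 \<and> (\<exists>\<mu>::real. A *v e = \<mu> *\<^sub>R e)) \<and>
      (\<forall>e\<in>E. \<forall>e'\<in>E. e \<noteq> e' \<longrightarrow> e \<bullet> e' = 0 \<and> e \<bullet> (\<i> *s e') = 0)" for E :: "(complex^'n) set"
  let ?J = "\<lambda>E :: (complex^'n) set. E \<union> (\<lambda>e. \<i> *s e) ` E"
  have ind: "independent (?J E)" if "good E" for E
  proof (rule pairwise_orthogonal_independent)
    have "e \<bullet> (\<i> *s e') = 0" if "e \<in> E" "e' \<in> E" for e e'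
      using \<open>good E\<close> that inner_i_scale_self[of e] unfolding good_def by metis
    then show "pairwise orthogonal (?J E)"
      using \<open>good E\<close> unfolding pairwise_def orthogonal_def good_def
      by (auto simp: inner_i_scale_left inner_i_scale_both)
    show "0 \<notin> ?J E"
    proof
      assume "0 \<in> ?J E"
      then obtain e where e: "e \<in> E" "e = 0 \<or> \<i> *s e = 0" by (metis UnE imageE)
      then have "e = 0" by (auto simp: vec_eq_iff)
      then show False using e \<open>good E\<close> by (auto simp: good_def)
    qed
  qed
  have card2: "card (?J E) = 2 * card E" if "good E" for E
  proof -
    have fin: "finite E" using independent_bound[OF ind[OF that]] by simp
    have inj: "inj_on (\<lambda>e. \<i> *s e) E" by (auto simp: inj_on_def vec_eq_iff)
    have "E \<inter> (\<lambda>e. \<i> *s e) ` E = {}"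
    proof (rule ccontr)
      assume "E \<inter> (\<lambda>e. \<i> *s e) ` E \<noteq> {}"
      then obtain e e' where e: "e \<in> E" "e' \<in> E" "e = \<i> *s e'" by auto
      have "e \<bullet> (\<i> *s e') = 0"
        using that e(1,2) inner_i_scale_self[of e] unfolding good_def by metis
      then have "e \<bullet> e = 0" using e(3) by simp
      then show False using that e(1) by (auto simp: good_def)
    qed
    then show ?thesis using fin inj by (simp add: card_Un_disjoint card_image)
  qed
  have dim: "DIM(complex^'n) = 2 * CARD('n)" by simp
  have "card E < CARD('n) + 1" if "good E" for E
    using independent_bound[OF ind[OF that]] card2[OF that] dim by simp
  moreover have "good {}" by (simp add: good_def)
  ultimately obtain E where E: "good E" and max: "\<And>E'. good E' \<Longrightarrow> card E' \<le> card E"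
    using ex_has_greatest_nat[of good "{}" card "CARD('n) + 1"] by (metis less_imp_le)
  have finE: "finite E" using independent_bound[OF ind[OF E]] by simp
  define S where "S = {x. \<forall>e\<in>E. x \<bullet> e = 0 \<and> x \<bullet> (\<i> *s e) = 0}"
  have subS: "subspace S" unfolding S_def subspace_def by (auto simp: inner_add_left)
  have invS: "A *v x \<in> S" if "x \<in> S" for x
    unfolding S_def
  proof (intro CollectI ballI)
    fix e assume "e \<in> E"
    then obtain \<mu> :: real where \<mu>: "A *v e = \<mu> *\<^sub>R e" using E unfolding good_def by blast
    have "A *v (\<i> *s e) = \<mu> *\<^sub>R (\<i> *s e)"
      by (simp add: matrix_vector_mult_scale \<mu> vec_eq_iff)
    then show "(A *v x) \<bullet> e = 0 \<and> (A *v x) \<bullet> (\<i> *s e) = 0"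
      using that \<open>e \<in> E\<close> \<mu> by (simp add: S_def hermitian_inner[OF A])
  qed
  have "S = {0}"
  proof (rule ccontr)
    assume "S \<noteq> {0}"
    then obtain x where x: "x \<in> S" "norm x = 1" "\<exists>\<mu>::real. A *v x = \<mu> *\<^sub>R x"
      using hermitian_eigenvector_subspace[OF A subS _ invS] by blast
    have "x \<notin> E" using x(1,2) by (auto simp: S_def)
    have "good (insert x E)"
      unfolding good_def
    proof (intro conjI ballI impI)
      fix e assume "e \<in> insert x E"
      then show "norm e = 1" "\<exists>\<mu>::real. A *v e = \<mu> *\<^sub>R e" using x E by (auto simp: good_def)
      fix e' assume "e' \<in> insert x E" "e \<noteq> e'"
      moreover have "u \<bullet> x = 0 \<and> u \<bullet> (\<i> *s x) = 0 \<and> x \<bullet> u = 0 \<and> x \<bullet> (\<i> *s u) = 0" if "u \<in> E" for u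
        using x(1) that inner_i_scale_left[of u x] by (auto simp: S_def inner_commute)
      ultimately show "e \<bullet> e' = 0" "e \<bullet> (\<i> *s e') = 0"
        using \<open>e \<in> insert x E\<close> E by (auto simp: good_def)
    qed
    from max[OF this] show False using \<open>x \<notin> E\<close> finE by simp
  qed
  have "dim (?J E) = DIM(complex^'n)"
  proof (rule ccontr)
    assume "dim (?J E) \<noteq> DIM(complex^'n)"
    then have "dim (?J E) < DIM(complex^'n)" using dim_subset_UNIV[of "?J E"] by simp
    then obtain x where "x \<noteq> 0" and x: "\<And>y. y \<in> span (?J E) \<Longrightarrow> orthogonal x y"
      by (rule orthogonal_to_subspace_exists) blast
    have "x \<in> S" unfolding S_def using x by (auto simp: orthogonal_def intro: span_base)
    then show False using \<open>S = {0}\<close> \<open>x \<noteq> 0\<close> by simp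
  qed
  then have "card E = CARD('n)"
    using dim_eq_card_independent[OF ind[OF E]] card2[OF E] dim by simp
  then obtain f where f: "bij_betw f (UNIV :: 'n set) E"
    using finite_same_card_bij[of "UNIV :: 'n set" E] finE by auto
  have fE: "f i \<in> E" for i using f by (auto simp: bij_betw_def)
  have finj: "f i = f j \<longleftrightarrow> i = j" for i j using f by (auto simp: bij_betw_def inj_on_def)
  have "\<forall>i. \<exists>l::real. A *v f i = l *\<^sub>R f i" using E fE by (auto simp: good_def)
  then obtain l :: "'n \<Rightarrow> real" where l: "\<And>i. A *v f i = l i *\<^sub>R f i" by metis
  define P :: "complex^'n^'n" where "P = (\<chi> a b. f b $ a)"
  define d :: "complex^'n" where "d = (\<chi> i. of_real (l i))"
  have PP: "ctransp P ** P = mat 1"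
  proof -
    have "(\<Sum>a\<in>UNIV. cnj (f i $ a) * f j $ a) = (if i = j then 1 else 0)" for i j
    proof -
      have "(\<Sum>a\<in>UNIV. cnj (f i $ a) * f j $ a) = Complex (f i \<bullet> f j) (- (f i \<bullet> (\<i> *s f j)))"
        by (simp add: complex_eq_iff inner_vec_def inner_complex_def sum_negf[symmetric] algebra_simps)
      also have "\<dots> = (if i = j then 1 else 0)"
      proof (cases "i = j")
        case True
        have "f j \<bullet> f j = 1" using E fE[of j] by (simp add: good_def flip: power2_norm_eq_inner)
        then show ?thesis using True by (simp add: inner_i_scale_self complex_eq_iff)
      next
        case False
        then have "f i \<bullet> f j = 0 \<and> f i \<bullet> (\<i> *s f j) = 0"
          using E fE[of i] fE[of j] finj[of i j] unfolding good_def by blast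
        then show ?thesis using False by (simp add: complex_eq_iff)
      qed
      finally show ?thesis .
    qed
    then show ?thesis by (simp add: vec_eq_iff matrix_matrix_mult_def ctransp_def P_def mat_def)
  qed
  then have PP': "P ** ctransp P = mat 1" by (simp add: matrix_left_right_inverse)
  have "(A ** P) $ a $ j = (P ** diag_mat d) $ a $ j" for a j
  proof -
    have "(A ** P) $ a $ j = (A *v f j) $ a"
      by (simp add: matrix_matrix_mult_def matrix_vector_mult_def P_def)
    also have "\<dots> = f j $ a * d $ j" unfolding l d_def vector_scaleR_component by (simp add: scaleR_conv_of_real)
    also have "\<dots> = (P ** diag_mat d) $ a $ j"
      by (simp add: matrix_matrix_mult_def diag_mat_def P_def if_distrib cong: if_cong)
    finally show ?thesis .
  qed
  then have "A ** P = P ** diag_mat d" by (simp add: vec_eq_iff)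
  then have "A = P ** diag_mat d ** ctransp P"
    by (metis PP' matrix_mul_assoc matrix_mul_rid)
  then show ?thesis using PP PP' by blast
qed

lemma skew_hermitian_diagonalization:
  fixes B :: "complex^'n^'n"
  assumes B: "ctransp B = - B"
  shows "\<exists>P d. P ** ctransp P = mat 1 \<and> ctransp P ** P = mat 1 \<and> B = P ** diag_mat d ** ctransp P"
proof -
  define A where "A = (\<chi> a b. \<i> * B $ a $ b)"
  have "cnj (B $ b $ a) = - B $ a $ b" for a b
    using B by (simp add: vec_eq_iff ctransp_def)
  then have "ctransp A = A" by (simp add: A_def ctransp_def vec_eq_iff)
  then obtain P d where P: "P ** ctransp P = mat 1" "ctransp P ** P = mat 1" "A = P ** diag_mat d ** ctransp P"
    using hermitian_diagonalization by blast
  have "B $ a $ b = (P ** diag_mat (\<chi> c. - \<i> * d $ c) ** ctransp P) $ a $ b" for a b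
  proof -
    have "B $ a $ b = - \<i> * A $ a $ b" by (simp add: A_def)
    also have "\<dots> = - \<i> * (\<Sum>c\<in>UNIV. P $ a $ c * d $ c * ctransp P $ c $ b)"
      by (simp only: P(3) matrix_diag_component)
    also have "\<dots> = (P ** diag_mat (\<chi> c. - \<i> * d $ c) ** ctransp P) $ a $ b"
      by (simp only: matrix_diag_component sum_distrib_left) (simp add: ac_simps)
    finally show ?thesis .
  qed
  then have "B = P ** diag_mat (\<chi> c. - \<i> * d $ c) ** ctransp P" by (simp add: vec_eq_iff)
  then show ?thesis using P by blast
qed

section \<open>The Banach algebra of endomorphisms\<close>

text \<open>A type of its own carries the class instances \<open>real_normed_algebra_1\<close> and
  \<open>banach\<close>, so that powers, \<open>exp\<close> and \<open>bes\<close> apply to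
  matrices, with composition as product.\<close>

typedef 'n endo = "UNIV :: ((real^'n::finite) \<Rightarrow>\<^sub>L (real^'n)) set"
  morphisms blin endo ..

setup_lifting type_definition_endo

instantiation endo :: (finite) real_normed_algebra_1
begin

lift_definition zero_endo :: "'a endo" is 0 .
lift_definition one_endo :: "'a endo" is id_blinfun .
lift_definition plus_endo :: "'a endo \<Rightarrow> 'a endo \<Rightarrow> 'a endo" is "(+)" .
lift_definition minus_endo :: "'a endo \<Rightarrow> 'a endo \<Rightarrow> 'a endo" is "(-)" .
lift_definition uminus_endo :: "'a endo \<Rightarrow> 'a endo" is "uminus" .
lift_definition times_endo :: "'a endo \<Rightarrow> 'a endo \<Rightarrow> 'a endo" is "(o\<^sub>L)" .
lift_definition scaleR_endo :: "real \<Rightarrow> 'a endo \<Rightarrow> 'a endo" is "(*\<^sub>R)" .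
lift_definition norm_endo :: "'a endo \<Rightarrow> real" is norm .
definition dist_endo :: "'a endo \<Rightarrow> 'a endo \<Rightarrow> real" where "dist_endo a b = norm (a - b)"
definition sgn_endo :: "'a endo \<Rightarrow> 'a endo" where "sgn_endo a = scaleR (inverse (norm a)) a"
definition uniformity_endo :: "('a endo \<times> 'a endo) filter" where
  "uniformity_endo = (INF e\<in>{0 <..}. principal {(x, y). dist x y < e})"
definition open_endo :: "'a endo set \<Rightarrow> bool" where
  "open_endo U \<longleftrightarrow> (\<forall>x\<in>U. eventually (\<lambda>(x', y). x' = x \<longrightarrow> y \<in> U) uniformity)"

instance
proof
  fix a b c :: "'a endo" and r s :: real
  show "a + b + c = a + (b + c)" by transfer simp
  show "a + b = b + a" by transfer simp
  show "0 + a = a" by transfer simp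
  show "- a + a = 0" by transfer simp
  show "a - b = a + - b" by transfer simp
  show "r *\<^sub>R (a + b) = r *\<^sub>R a + r *\<^sub>R b" by transfer (simp add: scaleR_add_right)
  show "(r + s) *\<^sub>R a = r *\<^sub>R a + s *\<^sub>R a" by transfer (simp add: scaleR_add_left)
  show "r *\<^sub>R s *\<^sub>R a = (r * s) *\<^sub>R a" by transfer simp
  show "1 *\<^sub>R a = a" by transfer simp
  show "a * b * c = a * (b * c)" by transfer (auto intro: blinfun_eqI)
  show "(a + b) * c = a * c + b * c" by transfer (auto intro: blinfun_eqI simp: blinfun.bilinear_simps)
  show "a * (b + c) = a * b + a * c" by transfer (auto intro: blinfun_eqI simp: blinfun.bilinear_simps)
  show "r *\<^sub>R a * b = r *\<^sub>R (a * b)" by transfer (auto intro: blinfun_eqI simp: blinfun.bilinear_simps)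
  show "a * r *\<^sub>R b = r *\<^sub>R (a * b)" by transfer (auto intro: blinfun_eqI simp: blinfun.bilinear_simps)
  show "1 * a = a" by transfer (auto intro: blinfun_eqI)
  show "a * 1 = a" by transfer (auto intro: blinfun_eqI)
  have "norm (id_blinfun :: (real^'a) \<Rightarrow>\<^sub>L (real^'a)) = 1" by simp
  then show n1: "norm (1 :: 'a endo) = 1" by transfer
  then show "(0 :: 'a endo) \<noteq> 1" by transfer (metis norm_zero zero_neq_one)
  show "dist a b = norm (a - b)" by (rule dist_endo_def)
  show "sgn a = scaleR (inverse (norm a)) a" by (rule sgn_endo_def)
  show "(uniformity :: ('a endo \<times> 'a endo) filter) = (INF e\<in>{0 <..}. principal {(x, y). dist x y < e})"
    by (rule uniformity_endo_def)
  show "open U \<longleftrightarrow> (\<forall>x\<in>U. eventually (\<lambda>(x', y). x' = x \<longrightarrow> y \<in> U) uniformity)" for U :: "'a endo set"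
    by (rule open_endo_def)
  show "norm a = 0 \<longleftrightarrow> a = 0" by transfer simp
  show "norm (a + b) \<le> norm a + norm b" by transfer (rule norm_triangle_ineq)
  show "norm (r *\<^sub>R a) = \<bar>r\<bar> * norm a" by transfer simp
  show "norm (a * b) \<le> norm a * norm b" by transfer (rule norm_blinfun_compose)
qed

end

instance endo :: (finite) banach
proof
  fix X :: "nat \<Rightarrow> 'a endo" assume X: "Cauchy X"
  have d: "dist (blin a) (blin b) = dist a b" for a b :: "'a endo"
    unfolding dist_endo_def dist_norm by transfer simp
  have "Cauchy (\<lambda>n. blin (X n))"
    using X unfolding Cauchy_def d .
  then obtain L where "(\<lambda>n. blin (X n)) \<longlonglongrightarrow> L" using Cauchy_convergent convergent_def by blast
  then have "(\<lambda>n. blin (X n)) \<longlonglongrightarrow> blin (endo L)" by (simp add: endo_inverse)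
  then have "X \<longlonglongrightarrow> endo L" unfolding tendsto_iff d .
  then show "convergent X" by (auto simp: convergent_def)
qed

lift_definition eap :: "'n::finite endo \<Rightarrow> real^'n \<Rightarrow> real^'n" is blinfun_apply .

lemma bounded_bilinear_eap: "bounded_bilinear eap"
proof
  show "eap (a + a') b = eap a b + eap a' b" for a a' :: "'n::finite endo" and b
    by transfer (simp add: blinfun.bilinear_simps)
  show "eap a (b + b') = eap a b + eap a b'" for a :: "'n::finite endo" and b b'
    by transfer (simp add: blinfun.bilinear_simps)
  show "eap (r *\<^sub>R a) b = r *\<^sub>R eap a b" for r and a :: "'n::finite endo" and b
    by transfer (simp add: blinfun.bilinear_simps)
  show "eap a (r *\<^sub>R b) = r *\<^sub>R eap a b" for r and a :: "'n::finite endo" and b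
    by transfer (simp add: blinfun.bilinear_simps)
  have "norm (eap a b) \<le> norm a * norm b * 1" for a :: "'n::finite endo" and b
    by transfer (simp add: norm_blinfun)
  then show "\<exists>K. \<forall>(a :: 'n::finite endo) b. norm (eap a b) \<le> norm a * norm b * K" by blast
qed

interpretation eap: bounded_bilinear eap by (rule bounded_bilinear_eap)

lemma eap_mult [simp]: "eap (A * B) v = eap A (eap B v)"
  by transfer simp

lemma eap_one [simp]: "eap 1 v = v"
  by transfer simp

lemma norm_eap: "norm (eap A v) \<le> norm A * norm v"
  by transfer (rule norm_blinfun)

lift_definition endo_of_matrix :: "real^'n^'n \<Rightarrow> 'n::finite endo" is "\<lambda>M. Blinfun (\<lambda>v. M *v v)" .

lemma eap_endo_of_matrix [simp]: "eap (endo_of_matrix M) v = M *v v"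
  by transfer (simp add: bounded_linear_Blinfun_apply)

lemma endo_eqI: "(\<And>v. eap A v = eap B v) \<Longrightarrow> A = B"
  by transfer (rule blinfun_eqI)

lemma linear_endo_of_matrix: "linear endo_of_matrix"
  by (rule linearI; rule endo_eqI)
     (simp_all add: eap.add_left eap.scaleR_left matrix_vector_mult_add_rdistrib scaleR_matrix_vector_assoc)

lemma endo_inner_power:
  assumes "\<And>x y. eap A x \<bullet> y = x \<bullet> eap A y"
  shows "eap (A ^ n) x \<bullet> y = x \<bullet> eap (A ^ n) y"
proof (induction n arbitrary: x y)
  case (Suc n)
  have "eap (A ^ Suc n) x \<bullet> y = x \<bullet> eap (A ^ n * A) y" by (simp add: assms Suc)
  then show ?case by (simp only: power_Suc2)
qed simp

lemma eap_bes_sums: "(\<lambda>n. besc j n *\<^sub>R eap (w ^ n) v) sums eap (bes j w) v"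
  using bounded_linear.sums[OF eap.bounded_linear_left bes_sums] by (simp add: eap.scaleR_left)

lemma bes_self_adjoint:
  assumes "\<And>x y. eap w x \<bullet> y = x \<bullet> eap w y"
  shows "eap (bes j w) x \<bullet> y = x \<bullet> eap (bes j w) y"
proof -
  have "(\<lambda>n. (besc j n *\<^sub>R eap (w ^ n) x) \<bullet> y) sums (eap (bes j w) x \<bullet> y)"
    by (rule bounded_linear.sums[OF bounded_linear_inner_left eap_bes_sums])
  moreover have "(\<lambda>n. x \<bullet> (besc j n *\<^sub>R eap (w ^ n) y)) sums (x \<bullet> eap (bes j w) y)"
    by (rule bounded_linear.sums[OF bounded_linear_inner_right eap_bes_sums])
  ultimately show ?thesis by (simp add: endo_inner_power[OF assms] sums_iff)
qed

lemma bes_commute: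
  fixes w :: "'a::{real_normed_algebra_1,banach}"
  assumes "w * h = h * w"
  shows "bes j w * h = h * bes j w"
proof -
  have "besc j n *\<^sub>R w ^ n * h = h * (besc j n *\<^sub>R w ^ n)" for n
    using power_commuting_commutes[OF assms, of n] by simp
  moreover have "(\<lambda>n. besc j n *\<^sub>R w ^ n * h) sums (bes j w * h)" by (intro sums_mult2 bes_sums)
  ultimately have "(\<lambda>n. h * (besc j n *\<^sub>R w ^ n)) sums (bes j w * h)" by (simp only:)
  moreover have "(\<lambda>n. h * (besc j n *\<^sub>R w ^ n)) sums (h * bes j w)" by (intro sums_mult bes_sums)
  ultimately show ?thesis by (rule sums_unique2)
qed

section \<open>Functional calculus of the structure matrices\<close>

definition Wop :: "('m::finite \<Rightarrow> real^'q^'q) \<Rightarrow> real^'m \<Rightarrow> 'q::finite endo" where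
  "Wop U \<theta> = endo_of_matrix (\<Sum>j\<in>UNIV. \<theta> $ j *\<^sub>R U j)"

text \<open>This is W^(-j) i_j(W), meaningful for singular W as a power series in W^2. When W is
  skew, W^2 is symmetric and these operators are self-adjoint.\<close>

abbreviation bop :: "('m::finite \<Rightarrow> real^'q^'q) \<Rightarrow> nat \<Rightarrow> real^'m \<Rightarrow> 'q::finite endo" where
  "bop U j \<theta> \<equiv> bes j ((Wop U \<theta>)\<^sup>2)"

lemma bounded_linear_Wop: "bounded_linear (Wop U)"
proof -
  have "linear (\<lambda>\<theta>. \<Sum>j\<in>UNIV. \<theta> $ j *\<^sub>R U j)"
    by (rule linearI) (simp_all add: scaleR_add_left sum.distrib scaleR_sum_right)
  then have "linear (\<lambda>\<theta>. endo_of_matrix (\<Sum>j\<in>UNIV. \<theta> $ j *\<^sub>R U j))"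
    using linear_compose[OF _ linear_endo_of_matrix] by (simp add: o_def)
  then show ?thesis unfolding Wop_def linear_conv_bounded_linear .
qed

lemma eap_Wop_nth:
  "eap (Wop U \<theta>) v $ a = (\<Sum>b\<in>UNIV. (\<Sum>j\<in>UNIV. \<theta> $ j * U j $ a $ b) * v $ b)"
  by (simp add: Wop_def matrix_vector_mult_def)

lemma sum_matrix_vector_mult: "(\<Sum>j\<in>A. M j) *v x = (\<Sum>j\<in>A. M j *v x)"
  by (induction A rule: infinite_finite_induct) (simp_all add: matrix_vector_mult_add_rdistrib)

lemma bracket_inner: "bracket U x y \<bullet> \<theta> = eap (Wop U \<theta>) x \<bullet> y"
  by (simp add: bracket_def Wop_def inner_vec_def[of _ \<theta>] sum_matrix_vector_mult inner_sum_left
        scaleR_matrix_vector_assoc[symmetric] mult.commute)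

lemma Wop_skew:
  assumes "step_two U"
  shows "eap (Wop U \<theta>) x \<bullet> y = - (x \<bullet> eap (Wop U \<theta>) y)"
proof -
  have "(U j *v x) \<bullet> y = - (x \<bullet> (U j *v y))" for j
  proof -
    have "x \<bullet> (U j *v y) = (transpose (U j) *v x) \<bullet> y"
      by (simp add: dot_lmul_matrix transpose_matrix_vector)
    also have "transpose (U j) *v x = - (U j *v x)"
      using assms by (simp add: step_two_def vec_eq_iff matrix_vector_mult_def sum_negf)
    finally show ?thesis by simp
  qed
  then show ?thesis
    by (simp add: Wop_def sum_matrix_vector_mult inner_sum_left inner_sum_right
        scaleR_matrix_vector_assoc[symmetric] sum_negf[symmetric])
qed

section \<open>Complexification of real endomorphisms\<close>

definition Rev :: "complex^'n \<Rightarrow> real^'n" where "Rev v = (\<chi> i. Re (v $ i))"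
definition Imv :: "complex^'n \<Rightarrow> real^'n" where "Imv v = (\<chi> i. Im (v $ i))"
definition cext :: "'n::finite endo \<Rightarrow> complex^'n \<Rightarrow> complex^'n" where
  "cext X v = (\<chi> i. Complex (eap X (Rev v) $ i) (eap X (Imv v) $ i))"

lemma cext_nth: "cext X v $ i = Complex (eap X (Rev v) $ i) (eap X (Imv v) $ i)"
  by (simp add: cext_def)

lemma Rev_Imv_cext [simp]: "Rev (cext X v) = eap X (Rev v)" "Imv (cext X v) = eap X (Imv v)"
  by (simp_all add: cext_def Rev_def Imv_def vec_eq_iff)

lemma complex_vec_eqI: "Rev u = Rev v \<Longrightarrow> Imv u = Imv v \<Longrightarrow> u = v"
  by (simp add: Rev_def Imv_def vec_eq_iff complex_eq_iff)

lemma Rev_Imv_zero: "Rev 0 = 0" "Imv 0 = 0"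
  by (simp_all add: Rev_def Imv_def vec_eq_iff)

lemma cext_mult: "cext (X * Y) v = cext X (cext Y v)"
  by (rule complex_vec_eqI) simp_all

lemma cext_one: "cext 1 v = v"
  by (rule complex_vec_eqI) simp_all

lemma cext_add: "cext X (u + v) = cext X u + cext X v"
proof -
  have "Rev (u + v) = Rev u + Rev v" "Imv (u + v) = Imv u + Imv v" for u v :: "complex^'a"
    by (simp_all add: Rev_def Imv_def vec_eq_iff)
  then show ?thesis by (intro complex_vec_eqI) (simp_all add: eap.add_right)
qed

lemma cext_scale: "cext X (c *s v) = c *s cext X v"
proof -
  have "Rev (c *s v) = Re c *\<^sub>R Rev v - Im c *\<^sub>R Imv v"
    "Imv (c *s v) = Re c *\<^sub>R Imv v + Im c *\<^sub>R Rev v" for v :: "complex^'a"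
    by (simp_all add: Rev_def Imv_def vec_eq_iff)
  then show ?thesis
    by (intro complex_vec_eqI) (simp_all add: eap.add_right eap.diff_right eap.scaleR_right)
qed

lemma cext_sum: "cext X (\<Sum>c\<in>A. f c) = (\<Sum>c\<in>A. cext X (f c))"
proof (induction A rule: infinite_finite_induct)
  have "cext X 0 = 0" using cext_scale[of X 0 0] by simp
  case (infinite A)
  then show ?case by (simp add: \<open>cext X 0 = 0\<close>)
next
  have "cext X 0 = 0" using cext_scale[of X 0 0] by simp
  case empty
  then show ?case by (simp add: \<open>cext X 0 = 0\<close>)
qed (simp_all add: cext_add)

lemma cext_cvec: "cext X (cvec v) = cvec (eap X v)"
proof -
  have "Rev (cvec x) = x" "Imv (cvec x) = 0" for x :: "real^'a"
    by (simp_all add: Rev_def Imv_def cvec_def vec_eq_iff)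
  then show ?thesis by (intro complex_vec_eqI) (simp_all add: eap.zero_right)
qed

text \<open>The algebra is real while eigenvalues are complex, so the operator series is compared
  with the scalar one componentwise, on real and imaginary parts.\<close>

lemma cext_bes_eigenvector:
  assumes "cext w v = \<mu> *s v"
  shows "cext (bes j w) v = bes j \<mu> *s v"
proof -
  have pow: "cext (w ^ n) v = (\<mu> ^ n) *s v" for n
  proof (induction n)
    case (Suc n)
    have "cext (w ^ Suc n) v = cext w (cext (w ^ n) v)" by (simp add: cext_mult)
    then show ?case by (simp add: Suc cext_scale assms vector_smult_assoc mult.commute)
  qed (simp add: cext_one)
  have "cext (bes j w) v $ i = bes j \<mu> * v $ i" for i
  proof -
    have "(\<lambda>n. (besc j n *\<^sub>R eap (w ^ n) x) $ i) sums (eap (bes j w) x $ i)" for x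
      by (rule bounded_linear.sums[OF bounded_linear_vec_nth eap_bes_sums])
    then have "(\<lambda>n. Complex ((besc j n *\<^sub>R eap (w ^ n) (Rev v)) $ i) ((besc j n *\<^sub>R eap (w ^ n) (Imv v)) $ i))
        sums (cext (bes j w) v $ i)"
      unfolding sums_complex_iff by (simp add: cext_nth)
    moreover have "Complex ((besc j n *\<^sub>R eap (w ^ n) (Rev v)) $ i) ((besc j n *\<^sub>R eap (w ^ n) (Imv v)) $ i)
        = (besc j n *\<^sub>R \<mu> ^ n) * v $ i" for n
    proof -
      have "Complex ((besc j n *\<^sub>R eap (w ^ n) (Rev v)) $ i) ((besc j n *\<^sub>R eap (w ^ n) (Imv v)) $ i)
          = besc j n *\<^sub>R (cext (w ^ n) v $ i)"
        by (simp add: cext_nth complex_eq_iff)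
      then show ?thesis by (simp add: pow)
    qed
    ultimately have "(\<lambda>n. (besc j n *\<^sub>R \<mu> ^ n) * v $ i) sums (cext (bes j w) v $ i)" by (simp only:)
    moreover have "(\<lambda>n. (besc j n *\<^sub>R \<mu> ^ n) * v $ i) sums (bes j \<mu> * v $ i)"
      by (intro sums_mult2 bes_sums)
    ultimately show ?thesis by (rule sums_unique2)
  qed
  then show ?thesis by (simp add: vec_eq_iff)
qed

text \<open>U(i \<theta>) = -W is a real matrix. The sign does not affect R_k, a function of
  z^2.\<close>

abbreviation Bmat :: "('m::finite \<Rightarrow> real^'q^'q) \<Rightarrow> real^'m \<Rightarrow> complex^'q^'q" where
  "Bmat U \<theta> \<equiv> Umat U (\<i> *s cvec \<theta>)"

lemma Bmat_nth: "Bmat U \<theta> $ a $ b = - of_real (\<Sum>j\<in>UNIV. \<theta> $ j * U j $ a $ b)"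
  by (simp add: Umat_def Utilde_def cvec_def sum_distrib_left sum_negf[symmetric] mult.assoc[symmetric])

lemma Bmat_mult: "Bmat U \<theta> *v v = - cext (Wop U \<theta>) v"
proof -
  have "(Bmat U \<theta> *v v) $ i = (- cext (Wop U \<theta>) v) $ i" for i
    by (simp add: matrix_vector_mult_def Bmat_nth cext_nth eap_Wop_nth Rev_def Imv_def complex_eq_iff
        sum_negf)
  then show ?thesis by (simp add: vec_eq_iff)
qed

lemma Bmat_diagonalization:
  assumes "step_two U"
  shows "\<exists>P d. P ** ctransp P = mat 1 \<and> ctransp P ** P = mat 1 \<and> Bmat U \<theta> = P ** diag_mat d ** ctransp P"
proof (rule skew_hermitian_diagonalization)
  have sk: "U j $ b $ a = - U j $ a $ b" for j a b
  proof -
    have "transpose (U j) $ a $ b = (- U j) $ a $ b" using assms by (simp add: step_two_def)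
    then show ?thesis by (simp add: transpose_def)
  qed
  have sk': "(\<Sum>j\<in>UNIV. \<theta> $ j * U j $ b $ a) = - (\<Sum>j\<in>UNIV. \<theta> $ j * U j $ a $ b)" for a b
    unfolding sum_negf[symmetric] mult_minus_right[symmetric] by (intro sum.cong refl) (simp only: sk[of _ b a])
  have "ctransp (Bmat U \<theta>) $ a $ b = (- Bmat U \<theta>) $ a $ b" for a b
  proof -
    have "ctransp (Bmat U \<theta>) $ a $ b = - complex_of_real (\<Sum>j\<in>UNIV. \<theta> $ j * U j $ b $ a)"
      unfolding ctransp_def vec_lambda_beta Bmat_nth by (simp del: of_real_sum)
    also have "\<dots> = (- Bmat U \<theta>) $ a $ b"
      unfolding sk'[of b a] vector_uminus_component Bmat_nth by (simp del: of_real_sum)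
    finally show ?thesis .
  qed
  then show "ctransp (Bmat U \<theta>) = - Bmat U \<theta>"
    by (simp only: vec_eq_iff) simp
qed

lemma diag_mat_mult_nth: "(diag_mat d *v w) $ c = d $ c * w $ c"
  by (simp add: diag_mat_def matrix_vector_mult_def if_distrib[of "\<lambda>x. x * _"] cong: if_cong)

lemma matrix_vector_mult_axis: "(A :: complex^'n^'m) *v axis c 1 = column c A"
proof -
  have "(\<Sum>b\<in>UNIV. A $ i $ b * axis c 1 $ b) = (\<Sum>b\<in>UNIV. if b = c then A $ i $ b else 0)" for i
    by (intro sum.cong) (auto simp: axis_def)
  then show ?thesis by (simp add: vec_eq_iff matrix_vector_mult_def column_def)
qed

context
  fixes U :: "'m::finite \<Rightarrow> real^'q^'q" and \<theta> :: "real^'m" and P :: "complex^'q^'q" and d :: "complex^'q"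
  assumes P: "P ** ctransp P = mat 1" "ctransp P ** P = mat 1" "Bmat U \<theta> = P ** diag_mat d ** ctransp P"
begin

lemma Bmat_column: "cext (Wop U \<theta>) (column c P) = (- d $ c) *s column c P"
proof -
  have "Bmat U \<theta> *v (P *v axis c 1) = P *v (diag_mat d *v axis c 1)"
    unfolding P(3) matrix_vector_mul_assoc by (metis P(2) matrix_mul_assoc matrix_mul_rid)
  also have "diag_mat d *v axis c 1 = d $ c *s axis c 1"
    by (simp add: vec_eq_iff diag_mat_mult_nth axis_def)
  also have "P *v (d $ c *s axis c 1) = d $ c *s (P *v axis c 1)"
    by (rule matrix_vector_mult_scale)
  finally have "Bmat U \<theta> *v column c P = d $ c *s column c P"
    unfolding matrix_vector_mult_axis .
  then show ?thesis by (simp add: Bmat_mult vec_eq_iff) (metis minus_equation_iff)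
qed

lemma cext_bes_diag:
  "cext (bop U j \<theta>) (P *v w) = P *v (\<chi> c. bes j ((d $ c)\<^sup>2) * w $ c)"
proof -
  have "cext ((Wop U \<theta>)\<^sup>2) (column c P) = (d $ c)\<^sup>2 *s column c P" for c
    by (simp only: power2_eq_square cext_mult Bmat_column cext_scale vector_smult_assoc minus_mult_minus)
  then have e: "cext (bop U j \<theta>) (column c P) = bes j ((d $ c)\<^sup>2) *s column c P" for c
    by (rule cext_bes_eigenvector)
  show ?thesis
    by (simp add: matrix_mult_sum cext_sum cext_scale e vector_smult_assoc mult.commute)
qed

lemma cext_sq_bes_diag:
  "cext ((Wop U \<theta>)\<^sup>2 * bop U j \<theta>) (P *v w) = P *v (\<chi> c. (d $ c)\<^sup>2 * bes j ((d $ c)\<^sup>2) * w $ c)"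
proof -
  have e: "cext ((Wop U \<theta>)\<^sup>2) (column c P) = (d $ c)\<^sup>2 *s column c P" for c
    by (simp only: power2_eq_square cext_mult Bmat_column cext_scale vector_smult_assoc minus_mult_minus)
  show ?thesis
    by (simp add: cext_mult cext_bes_diag) 
      (simp add: matrix_mult_sum cext_sum cext_scale e vector_smult_assoc ac_simps)
qed

lemma P_surj: "\<exists>w. v = P *v w"
  by (intro exI[of _ "ctransp P *v v"]) (simp add: matrix_vector_mul_assoc P)

lemma P_inj: "P *v w = P *v w' \<longleftrightarrow> w = w'"
  by (metis P(2) matrix_vector_mul_assoc matrix_vector_mul_lid)

text \<open>If the value vanished, the c-th column of P would be a nonzero complex vector whose real
  and imaginary parts are both annihilated by \<open>bop\<close>.\<close>

lemma bes_nonzero_of_inj: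
  assumes inj: "\<And>v. eap (bop U k \<theta>) v = 0 \<Longrightarrow> v = 0"
  shows "bes k ((d $ c)\<^sup>2) \<noteq> 0"
proof
  assume z: "bes k ((d $ c)\<^sup>2) = 0"
  have "(\<chi> i. bes k ((d $ i)\<^sup>2) * axis c 1 $ i) = (0 :: complex^'q)"
    using z by (auto simp: vec_eq_iff axis_def)
  then have "cext (bop U k \<theta>) (P *v axis c 1) = 0"
    unfolding cext_bes_diag by simp
  then have "eap (bop U k \<theta>) (Rev (P *v axis c 1)) = 0"
      "eap (bop U k \<theta>) (Imv (P *v axis c 1)) = 0"
    unfolding Rev_Imv_cext[symmetric] by (simp_all only: Rev_Imv_zero)
  then have "Rev (P *v axis c 1) = 0" "Imv (P *v axis c 1) = 0" using inj by auto
  then have "P *v axis c 1 = P *v 0" by (intro complex_vec_eqI) (simp_all add: Rev_Imv_zero)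
  then show False unfolding P_inj by simp
qed

text \<open>\<open>Rfun_eq\<close> at each eigenvalue, with the denominator multiplied out. No
  inverse operator appears, and the right-hand side does not involve the chosen
  diagonalization.\<close>

lemma fun_calculus_Rfun:
  assumes inj: "\<And>v. eap (bop U k \<theta>) v = 0 \<Longrightarrow> v = 0"
  shows "(P ** diag_mat (\<chi> c. Rfun k (d $ c)) ** ctransp P) *v cext (bop U k \<theta>) v
    = cext ((Wop U \<theta>)\<^sup>2 * bop U (Suc k) \<theta>) v"
proof -
  obtain w where w: "v = P *v w" using P_surj by blast
  have "(P ** diag_mat (\<chi> c. Rfun k (d $ c)) ** ctransp P) *v (P *v u) = P *v (\<chi> c. Rfun k (d $ c) * u $ c)" for u
  proof -
    have "(P ** diag_mat (\<chi> c. Rfun k (d $ c)) ** ctransp P) *v (P *v u)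
        = P *v (diag_mat (\<chi> c. Rfun k (d $ c)) *v ((ctransp P ** P) *v u))"
      by (simp only: matrix_vector_mul_assoc matrix_mul_assoc)
    also have "diag_mat (\<chi> c. Rfun k (d $ c)) *v ((ctransp P ** P) *v u) = (\<chi> c. Rfun k (d $ c) * u $ c)"
      by (simp add: P(2) vec_eq_iff diag_mat_mult_nth)
    finally show ?thesis .
  qed
  then show ?thesis
    unfolding w cext_bes_diag cext_sq_bes_diag
    using bes_nonzero_of_inj[OF inj] by (simp add: Rfun_eq mult.assoc)
qed

end

text \<open>The identity of \<open>fun_calculus_Rfun\<close> prescribes the matrix on the range of
  the complexified \<open>bop\<close>, which is the whole space. Hence all diagonalizations give the
  same matrix, and the definite description in \<open>mat_fun\<close> is resolved.\<close>

lemma mat_fun_Rfun: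
  assumes U: "step_two U" and inj: "\<And>v. eap (bop U k \<theta>) v = 0 \<Longrightarrow> v = 0"
  shows "mat_fun (Rfun k) (Bmat U \<theta>) *v cvec (eap (bop U k \<theta>) y)
    = cvec (eap ((Wop U \<theta>)\<^sup>2 * bop U (Suc k) \<theta>) y)"
proof -
  define Q where "Q B \<longleftrightarrow> (\<exists>P d. P ** ctransp P = mat 1 \<and> ctransp P ** P = mat 1 \<and>
      Bmat U \<theta> = P ** diag_mat d ** ctransp P \<and>
      B = P ** diag_mat (\<chi> a. Rfun k (d $ a)) ** ctransp P)" for B
  have calc: "B *v cext (bop U k \<theta>) v = cext ((Wop U \<theta>)\<^sup>2 * bop U (Suc k) \<theta>) v"
    if "Q B" for B v
  proof -
    from that obtain P d where P: "P ** ctransp P = mat 1" "ctransp P ** P = mat 1"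
      "Bmat U \<theta> = P ** diag_mat d ** ctransp P" "B = P ** diag_mat (\<chi> a. Rfun k (d $ a)) ** ctransp P"
      unfolding Q_def by blast
    show ?thesis unfolding P(4) by (rule fun_calculus_Rfun[OF P(1-3) inj])
  qed
  have surj: "\<exists>v. u = cext (bop U k \<theta>) v" for u
  proof -
    have "linear (eap (bop U k \<theta>))"
      using eap.bounded_linear_right bounded_linear.linear by blast
    then have "surj (eap (bop U k \<theta>))"
      using inj by (intro linear_injective_imp_surjective) (auto simp: linear_injective_0)
    then obtain a b where "Rev u = eap (bop U k \<theta>) a" "Imv u = eap (bop U k \<theta>) b"
      by (meson surjE)
    then show ?thesis
      by (intro exI[of _ "\<chi> i. Complex (a $ i) (b $ i)"] complex_vec_eqI)
        (simp_all, simp_all add: Rev_def Imv_def)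
  qed
  have "\<exists>B. Q B" unfolding Q_def using Bmat_diagonalization[OF U, of \<theta>] by blast
  moreover have "B = B'" if "Q B" "Q B'" for B B'
    unfolding matrix_eq using calc[OF that(1)] calc[OF that(2)] surj by metis
  ultimately have "Q (THE B. Q B)" by (metis theI)
  then have "Q (mat_fun (Rfun k) (Bmat U \<theta>))" by (simp add: mat_fun_def Q_def)
  from calc[OF this, of "cvec y"] show ?thesis by (simp only: cext_cvec)
qed

lemma norm_scale_complex_vec: "norm (c *s v) = norm c * norm (v :: complex^'n)"
  by (simp add: norm_vec_def L2_set_def norm_mult power_mult_distrib sum_distrib_left[symmetric] real_sqrt_mult)

text \<open>The eigenvalues of U(i \<theta>) are bounded by the norm of U(\<theta>), hence smaller
  than the first Bessel zero, where \<open>bes_nonzero\<close> applies. Later arguments use the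
  reference set through this injectivity.\<close>

lemma Omega_imp_inj:
  assumes U: "step_two U" and \<theta>: "\<theta> \<in> Omega U k" and v: "eap (bop U k \<theta>) v = 0"
  shows "v = 0"
proof -
  obtain P d where P: "P ** ctransp P = mat 1" "ctransp P ** P = mat 1" "Bmat U \<theta> = P ** diag_mat d ** ctransp P"
    using Bmat_diagonalization[OF U] by blast
  have nz: "bes k ((d $ c)\<^sup>2) \<noteq> 0" for c
  proof (rule bes_nonzero)
    let ?p = "column c P" let ?A = "Umat U (cvec \<theta>)"
    \<comment> \<open>U(\<theta>) = -i U(i \<theta>), so the eigenvectors are shared and the
      eigenvalues have equal modulus.\<close>
    have "?A *v ?p = (- \<i> * d $ c) *s ?p"
    proof -
      have ev: "Bmat U \<theta> *v ?p = d $ c *s ?p"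
        using Bmat_column[OF P, of c] by (simp add: Bmat_mult vec_eq_iff)
      have "?A $ a $ b = - \<i> * Bmat U \<theta> $ a $ b" for a b
        by (simp add: Umat_def Utilde_def sum_distrib_left mult.assoc[symmetric] sum_negf[symmetric])
      then have "(?A *v ?p) $ a = - \<i> * (Bmat U \<theta> *v ?p) $ a" for a
        by (simp add: matrix_vector_mult_def sum_distrib_left mult.assoc sum_negf)
      then show ?thesis unfolding ev by (simp add: vec_eq_iff mult.assoc)
    qed
    then have "norm (d $ c) * norm ?p = norm (?A *v ?p)"
      by (simp add: norm_scale_complex_vec norm_mult)
    also have "\<dots> \<le> onorm (\<lambda>v. ?A *v v) * norm ?p"
      by (rule onorm) (simp add: linear_matrix_vector_mult_complex linear_conv_bounded_linear[symmetric])
    finally have "norm (d $ c) * norm ?p \<le> onorm (\<lambda>v. ?A *v v) * norm ?p" .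
    moreover have "?p \<noteq> 0"
      using P_inj[OF P, of "axis c 1" 0] unfolding matrix_vector_mult_axis by auto
    ultimately have "norm (d $ c) \<le> onorm (\<lambda>v. ?A *v v)" by simp
    then show "norm (d $ c) < bessel_zero k 0" using \<theta> by (simp add: Omega_def)
  qed
  obtain w where w: "cvec v = P *v w" using P_surj[OF P] by blast
  have "cext (bop U k \<theta>) (cvec v) = 0"
    unfolding cext_cvec v by (simp add: cvec_def vec_eq_iff)
  then have "P *v (\<chi> c. bes k ((d $ c)\<^sup>2) * w $ c) = P *v 0"
    unfolding w cext_bes_diag[OF P] by simp
  then have "w = 0" unfolding P_inj[OF P] using nz by (simp add: vec_eq_iff)
  then have "cvec v = 0" using w by simp
  then show ?thesis by (simp add: cvec_def vec_eq_iff)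
qed

section \<open>The derivative of the reference function\<close>

text \<open>The operator i_j(W).\<close>

definition sbes :: "('m::finite \<Rightarrow> real^'q^'q) \<Rightarrow> nat \<Rightarrow> real^'m \<Rightarrow> 'q::finite endo" where
  "sbes U j \<theta> = Wop U \<theta> ^ j * bop U j \<theta>"

lemma Wop_has_derivative: "(Wop U has_derivative Wop U) (at \<theta>)"
  by (rule bounded_linear_imp_has_derivative[OF bounded_linear_Wop])

lemma Wop_power_has_derivative_ex: "\<exists>D. ((\<lambda>\<theta>. Wop U \<theta> ^ n) has_derivative D) (at \<theta>)"
  using has_derivative_compose[OF Wop_has_derivative pow_has_derivative[of n _ UNIV]] by blast

lemma bop_has_derivative_ex: "\<exists>D. (bop U j has_derivative D) (at \<theta>)"
proof -
  obtain D where D: "((\<lambda>\<theta>. (Wop U \<theta>)\<^sup>2) has_derivative D) (at \<theta>)"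
    using Wop_power_has_derivative_ex by blast
  obtain E where E: "(bes j has_derivative E) (at ((Wop U \<theta>)\<^sup>2))"
    using bes_has_derivative_ex by blast
  show ?thesis using has_derivative_compose[OF D E] by blast
qed

lemma sbes_has_derivative_ex: "\<exists>D. (sbes U j has_derivative D) (at \<theta>)"
proof -
  obtain D where D: "((\<lambda>\<theta>. Wop U \<theta> ^ j) has_derivative D) (at \<theta>)"
    using Wop_power_has_derivative_ex by blast
  obtain E where E: "(bop U j has_derivative E) (at \<theta>)"
    using bop_has_derivative_ex by blast
  show ?thesis using has_derivative_mult[OF D E] unfolding sbes_def[abs_def] by blast
qed

lemma bop_commute_Wop: "bop U j \<theta> * Wop U \<theta> = Wop U \<theta> * bop U j \<theta>"
  by (rule bes_commute) (simp add: power2_eq_square mult.assoc)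

lemma bop_commute_Wop_power: "bop U j \<theta> * Wop U \<theta> ^ n = Wop U \<theta> ^ n * bop U j \<theta>"
  by (rule power_commuting_commutes[OF bop_commute_Wop[symmetric], symmetric])

lemma bop_commute: "bop U i \<theta> * bop U j \<theta> = bop U j \<theta> * bop U i \<theta>"
  by (rule bes_commute[OF bes_commute[OF refl, symmetric]])

lemma sbes_commute_Wop: "sbes U j \<theta> * Wop U \<theta> = Wop U \<theta> * sbes U j \<theta>"
  by (simp add: sbes_def mult.assoc bop_commute_Wop) (metis mult.assoc power_commutes)

text \<open>The scalar recurrence contains 1/z; it is multiplied by W because W may be
  singular.\<close>

lemma sbes_recurrence:
  "Wop U \<theta> * sbes U j \<theta> = (2 * real j + 3) *\<^sub>R sbes U (Suc j) \<theta> + Wop U \<theta> * sbes U (Suc (Suc j)) \<theta>"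
proof -
  have "Wop U \<theta> * sbes U j \<theta> = Wop U \<theta> ^ Suc j * bop U j \<theta>" by (simp add: sbes_def mult.assoc)
  also have "\<dots> = Wop U \<theta> ^ Suc j * ((2 * real j + 3) *\<^sub>R bop U (Suc j) \<theta> + (Wop U \<theta>)\<^sup>2 * bop U (Suc (Suc j)) \<theta>)"
    by (subst bes_recurrence[of j "(Wop U \<theta>)\<^sup>2"]) rule
  also have "\<dots> = (2 * real j + 3) *\<^sub>R sbes U (Suc j) \<theta> + (Wop U \<theta> ^ Suc j * (Wop U \<theta>)\<^sup>2) * bop U (Suc (Suc j)) \<theta>"
    by (simp only: distrib_left mult_scaleR_right sbes_def mult.assoc)
  also have "Wop U \<theta> ^ Suc j * (Wop U \<theta>)\<^sup>2 = Wop U \<theta> * Wop U \<theta> ^ Suc (Suc j)"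
    by (simp only: power_add[symmetric] power_Suc[symmetric]) simp
  finally show ?thesis by (simp only: sbes_def mult.assoc)
qed

lemma Wop_power_adjoint:
  assumes "step_two U"
  shows "eap (Wop U \<theta> ^ n) x \<bullet> y = (-1) ^ n * (x \<bullet> eap (Wop U \<theta> ^ n) y)"
proof (induction n arbitrary: x y)
  case (Suc n)
  have "eap (Wop U \<theta> ^ Suc n) x \<bullet> y = (-1) ^ Suc n * (x \<bullet> eap (Wop U \<theta> ^ n * Wop U \<theta>) y)"
    by (simp add: Wop_skew[OF assms] Suc)
  then show ?case by (simp only: power_Suc2)
qed simp

lemma bop_self_adjoint:
  assumes "step_two U"
  shows "eap (bop U j \<theta>) x \<bullet> y = x \<bullet> eap (bop U j \<theta>) y"
  by (rule bes_self_adjoint) (use Wop_power_adjoint[OF assms, of \<theta> 2] in simp)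

lemma sbes_adjoint:
  assumes "step_two U"
  shows "eap (sbes U j \<theta>) x \<bullet> y = (-1) ^ j * (x \<bullet> eap (sbes U j \<theta>) y)"
proof -
  have "eap (sbes U j \<theta>) x \<bullet> y = (-1) ^ j * (x \<bullet> eap (bop U j \<theta> * Wop U \<theta> ^ j) y)"
    by (simp add: sbes_def Wop_power_adjoint[OF assms] bop_self_adjoint[OF assms])
  then show ?thesis by (simp add: sbes_def bop_commute_Wop_power)
qed

text \<open>The numerator of R_k: by \<open>mat_fun_Rfun\<close>, applying R_k after
  \<open>bop U k \<theta>\<close> gives \<open>hop U k \<theta>\<close>.\<close>

definition hop :: "('m::finite \<Rightarrow> real^'q^'q) \<Rightarrow> nat \<Rightarrow> real^'m \<Rightarrow> 'q::finite endo" where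
  "hop U k \<theta> = (Wop U \<theta>)\<^sup>2 * bop U (Suc k) \<theta>"

text \<open>Both operators are self-adjoint functions of W^2 and commute. Written with s =
  \<open>bop\<close> y, the quadratic form of R_k becomes \<open>hop\<close> y \<bullet>
  \<open>bop\<close> y, the diagonal of a symmetric form.\<close>

lemma hop_bop_adjoint:
  assumes "step_two U"
  shows "eap (hop U k \<theta>) x \<bullet> eap (bop U k \<theta>) y = eap (hop U k \<theta>) y \<bullet> eap (bop U k \<theta>) x"
proof -
  have "eap (hop U k \<theta>) x \<bullet> eap (bop U k \<theta>) y = x \<bullet> eap (bop U (Suc k) \<theta> * (Wop U \<theta>)\<^sup>2 * bop U k \<theta>) y"
    using Wop_power_adjoint[OF assms, of \<theta> 2]
    by (simp add: hop_def bop_self_adjoint[OF assms])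
  also have "bop U (Suc k) \<theta> * (Wop U \<theta>)\<^sup>2 * bop U k \<theta> = bop U k \<theta> * hop U k \<theta>"
  proof -
    have "bop U (Suc k) \<theta> * (Wop U \<theta>)\<^sup>2 * bop U k \<theta> = (Wop U \<theta>)\<^sup>2 * (bop U (Suc k) \<theta> * bop U k \<theta>)"
      by (simp only: bop_commute_Wop_power mult.assoc[of "(Wop U \<theta>)\<^sup>2"])
    also have "\<dots> = (Wop U \<theta>)\<^sup>2 * bop U k \<theta> * bop U (Suc k) \<theta>"
      by (simp only: bop_commute[where i = "Suc k" and j = k] mult.assoc)
    also have "\<dots> = bop U k \<theta> * hop U k \<theta>"
      by (simp only: bop_commute_Wop_power[symmetric] hop_def mult.assoc)
    finally show ?thesis .
  qed
  also have "x \<bullet> eap (bop U k \<theta> * hop U k \<theta>) y = eap (bop U k \<theta>) x \<bullet> eap (hop U k \<theta>) y"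
    by (simp add: bop_self_adjoint[OF assms])
  finally show ?thesis by (simp add: inner_commute)
qed

lemma hop_has_derivative_ex: "\<exists>D. (hop U k has_derivative D) (at \<theta>)"
proof -
  obtain D where D: "((\<lambda>\<theta>. (Wop U \<theta>)\<^sup>2) has_derivative D) (at \<theta>)"
    using Wop_power_has_derivative_ex by blast
  obtain E where E: "(bop U (Suc k) has_derivative E) (at \<theta>)"
    using bop_has_derivative_ex by blast
  show ?thesis using has_derivative_mult[OF D E] unfolding hop_def[abs_def] by blast
qed

lemma cvec_inner [simp]: "cvec x \<bullet> cvec y = x \<bullet> y"
  by (simp add: inner_vec_def cvec_def inner_complex_def)

definition Qform :: "('m::finite \<Rightarrow> real^'q^'q) \<Rightarrow> nat \<Rightarrow> real^'m \<Rightarrow> real^'q \<Rightarrow> real" where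
  "Qform U k \<theta> s = (mat_fun (Rfun k) (Bmat U \<theta>) *v cvec s) \<bullet> cvec s"

text \<open>Completing the square at an arbitrary \<open>n\<close> leaves a quadratic remainder. The form can therefore be
  differentiated along a curve \<open>n\<close> without differentiating the inverse of \<open>bop U k \<theta>\<close>.\<close>

lemma Qform_expand:
  assumes U: "step_two U" and c: "c > 0" "\<And>f. c * norm f \<le> norm (eap (bop U k \<theta>) f)"
  shows "\<bar>Qform U k \<theta> s - (eap (hop U k \<theta>) n \<bullet> eap (bop U k \<theta>) n
      + 2 * (eap (hop U k \<theta>) n \<bullet> (s - eap (bop U k \<theta>) n)))\<bar>
    \<le> norm (hop U k \<theta>) / c * (norm (s - eap (bop U k \<theta>) n))\<^sup>2"
proof -
  let ?a = "eap (bop U k \<theta>)" let ?h = "eap (hop U k \<theta>)"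
  have inj: "v = 0" if "?a v = 0" for v using c(2)[of v] c(1) that by (simp add: mult_le_0_iff)
  have "linear ?a" using eap.bounded_linear_right bounded_linear.linear by blast
  then have "surj ?a"
    using inj by (intro linear_injective_imp_surjective) (auto simp: linear_injective_0)
  then obtain y where y: "s = ?a y" by (meson surjE)
  define f where "f = y - n"
  have Q: "Qform U k \<theta> s = ?h y \<bullet> ?a y"
  proof -
    have "mat_fun (Rfun k) (Bmat U \<theta>) *v cvec (?a y) = cvec (?h y)"
      unfolding hop_def by (rule mat_fun_Rfun[OF U]) (rule inj)
    then show ?thesis unfolding Qform_def y by (simp only: cvec_inner)
  qed
  have yf: "y = n + f" by (simp add: f_def)
  have e: "s - ?a n = ?a f" by (simp add: y f_def eap.diff_right)
  \<comment> \<open>Symmetry merges the two cross terms, so that exactly the part quadratic in f is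
    left.\<close>
  have "Qform U k \<theta> s - (?h n \<bullet> ?a n + 2 * (?h n \<bullet> (s - ?a n))) = ?h f \<bullet> ?a f"
    unfolding e Q using hop_bop_adjoint[OF U, of k \<theta> f n]
    by (simp add: yf eap.add_right inner_add)
  also have "\<bar>?h f \<bullet> ?a f\<bar> \<le> norm (?h f) * norm (?a f)" by (rule Cauchy_Schwarz_ineq2)
  also have "\<dots> \<le> (norm (hop U k \<theta>) * (norm (?a f) / c)) * norm (?a f)"
  proof (intro mult_right_mono order_trans[OF norm_eap] mult_left_mono)
    show "norm f \<le> norm (?a f) / c" using c by (simp add: field_simps)
  qed auto
  finally show ?thesis unfolding e by (simp add: power2_eq_square)
qed

lemma has_derivative_zero_of_quadratic_bound:
  fixes e :: "'a::real_normed_vector \<Rightarrow> 'b::real_inner" and r :: "'a \<Rightarrow> real"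
  assumes e: "(e has_derivative e') (at x)" "e x = 0" and r: "r x = 0"
    and bd: "eventually (\<lambda>y. \<bar>r y\<bar> \<le> K * (norm (e y))\<^sup>2) (at x)"
  shows "(r has_derivative (\<lambda>_. 0)) (at x)"
proof -
  have "((\<lambda>y. e y \<bullet> e y) has_derivative (\<lambda>h. 0)) (at x)"
    using has_derivative_inner[OF e(1) e(1)] e(2) by simp
  then have "((\<lambda>y. norm (e y \<bullet> e y - e x \<bullet> e x - 0) / norm (y - x)) \<longlongrightarrow> 0) (at x)"
    unfolding has_derivative_iff_norm by blast
  then have "((\<lambda>y. K * ((norm (e y))\<^sup>2 / norm (y - x))) \<longlongrightarrow> 0) (at x)"
    using e(2) by (intro tendsto_mult_right_zero) (simp add: power2_norm_eq_inner)
  moreover have "eventually (\<lambda>y. norm (norm (r y - r x - 0) / norm (y - x)) \<le> K * ((norm (e y))\<^sup>2 / norm (y - x))) (at x)"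
    using bd by eventually_elim (use r in \<open>simp add: divide_right_mono\<close>)
  ultimately have "((\<lambda>y. norm (r y - r x - 0) / norm (y - x)) \<longlongrightarrow> 0) (at x)"
    by (rule Lim_null_comparison[rotated])
  then show ?thesis by (simp add: has_derivative_iff_norm)
qed

text \<open>Injectivity is stable under small perturbations: half of the lower bound survives
  nearby. This gives \<open>Qform_expand\<close> constants that are uniform in \<theta>'.\<close>

lemma bop_bounded_below:
  assumes "\<And>v. eap (bop U k \<theta>) v = 0 \<Longrightarrow> v = 0"
  shows "\<exists>c>0. \<exists>K. eventually (\<lambda>\<theta>'. (\<forall>f. c * norm f \<le> norm (eap (bop U k \<theta>') f)) \<and> norm (hop U k \<theta>') \<le> K) (at \<theta>)"
proof -
  have "linear (eap (bop U k \<theta>))" using eap.bounded_linear_right bounded_linear.linear by blast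
  then obtain c where c: "c > 0" "\<And>f. c * norm f \<le> norm (eap (bop U k \<theta>) f)"
    using linear_inj_bounded_below_pos[of "eap (bop U k \<theta>)"] assms by (auto simp: linear_injective_0)
  have "isCont (bop U k) \<theta>" using bop_has_derivative_ex has_derivative_continuous by blast
  then have "eventually (\<lambda>\<theta>'. dist (bop U k \<theta>') (bop U k \<theta>) < c / 2) (at \<theta>)"
    using c(1) unfolding isCont_def by (intro tendstoD) auto
  moreover have "isCont (hop U k) \<theta>" using hop_has_derivative_ex has_derivative_continuous by blast
  then have "eventually (\<lambda>\<theta>'. dist (hop U k \<theta>') (hop U k \<theta>) < 1) (at \<theta>)"
    unfolding isCont_def by (intro tendstoD) auto
  ultimately have "eventually (\<lambda>\<theta>'. (\<forall>f. c / 2 * norm f \<le> norm (eap (bop U k \<theta>') f)) \<and> norm (hop U k \<theta>') \<le> norm (hop U k \<theta>) + 1) (at \<theta>)"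
  proof eventually_elim
    case (elim \<theta>')
    have "c / 2 * norm f \<le> norm (eap (bop U k \<theta>') f)" for f
    proof -
      have "norm (eap (bop U k \<theta>') f - eap (bop U k \<theta>) f) \<le> norm (bop U k \<theta>' - bop U k \<theta>) * norm f"
        by (simp add: norm_eap flip: eap.diff_left)
      also have "\<dots> \<le> c / 2 * norm f" using elim(1) by (intro mult_right_mono) (auto simp: dist_norm)
      finally have "norm (eap (bop U k \<theta>) f) \<le> norm (eap (bop U k \<theta>') f) + c / 2 * norm f"
        using norm_triangle_sub[of "eap (bop U k \<theta>) f" "eap (bop U k \<theta>') f"] by (simp add: norm_minus_commute)
      then show ?thesis using c(2)[of f] by simp
    qed
    moreover have "norm (hop U k \<theta>') \<le> norm (hop U k \<theta>) + 1"
      using elim(2) norm_triangle_sub[of "hop U k \<theta>'" "hop U k \<theta>"] by (simp add: dist_norm)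
    ultimately show ?case by blast
  qed
  then show ?thesis using c(1) by (intro exI[of _ "c / 2"]) auto
qed

text \<open>The model m differs from the form by O(|L s - \<open>bop\<close> n|^2), which has zero
  derivative at the base point. The freedom in n matters: it is a constant at an arbitrary critical
  point, and a multiple of W^k \<eta> where \<eta> is known.\<close>

lemma Qform_has_derivative:
  fixes U :: "'m::finite \<Rightarrow> real^'q^'q" and L :: "'a::real_normed_vector \<Rightarrow> real^'q"
  assumes U: "step_two U" and inj: "\<And>v. eap (bop U k \<theta>) v = 0 \<Longrightarrow> v = 0"
    and N: "((\<lambda>\<theta>'. eap (bop U k \<theta>') (n \<theta>')) has_derivative N') (at \<theta>)"
    and M: "((\<lambda>\<theta>'. eap (hop U k \<theta>') (n \<theta>')) has_derivative M') (at \<theta>)"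
    and L: "bounded_linear L" and s: "L s = eap (bop U k \<theta>) (n \<theta>)"
  shows "((\<lambda>p. Qform U k (snd p) (L (fst p))) has_derivative
    (\<lambda>q. 2 * (eap (hop U k \<theta>) (n \<theta>) \<bullet> L (fst q)) + M' (snd q) \<bullet> L s - eap (hop U k \<theta>) (n \<theta>) \<bullet> N' (snd q))) (at (s, \<theta>))"
proof -
  let ?N = "\<lambda>\<theta>. eap (bop U k \<theta>) (n \<theta>)" let ?M = "\<lambda>\<theta>. eap (hop U k \<theta>) (n \<theta>)"
  define m where "m p = ?M (snd p) \<bullet> ?N (snd p) + 2 * (?M (snd p) \<bullet> (L (fst p) - ?N (snd p)))" for p
  have sndd: "(snd has_derivative snd) (at p)" for p :: "'a \<times> (real^'m)"
    by (rule bounded_linear_imp_has_derivative[OF bounded_linear_snd])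
  have dN: "((\<lambda>p. ?N (snd p)) has_derivative (\<lambda>q. N' (snd q))) (at (s, \<theta>))"
    by (rule has_derivative_compose[OF sndd]) (simp add: N)
  have dM: "((\<lambda>p. ?M (snd p)) has_derivative (\<lambda>q. M' (snd q))) (at (s, \<theta>))"
    by (rule has_derivative_compose[OF sndd]) (simp add: M)
  have dL: "((\<lambda>p. L (fst p)) has_derivative (\<lambda>q. L (fst q))) (at (s, \<theta>))"
    by (rule bounded_linear_imp_has_derivative[OF bounded_linear_compose[OF L bounded_linear_fst]])
  have de: "((\<lambda>p. L (fst p) - ?N (snd p)) has_derivative (\<lambda>q. L (fst q) - N' (snd q))) (at (s, \<theta>))"
    by (rule has_derivative_diff[OF dL dN])
  have dm: "(m has_derivative (\<lambda>q. (?M \<theta> \<bullet> N' (snd q) + M' (snd q) \<bullet> ?N \<theta>)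
      + 2 * (?M \<theta> \<bullet> (L (fst q) - N' (snd q)) + M' (snd q) \<bullet> (L s - ?N \<theta>)))) (at (s, \<theta>))"
    unfolding m_def[abs_def]
    using has_derivative_add[OF has_derivative_inner[OF dM dN]
        has_derivative_mult_right[OF has_derivative_inner[OF dM de], of 2]] by simp
  obtain c K where c: "c > 0" and ev: "eventually (\<lambda>\<theta>'. (\<forall>f. c * norm f \<le> norm (eap (bop U k \<theta>') f)) \<and> norm (hop U k \<theta>') \<le> K) (at \<theta>)"
    using bop_bounded_below[OF inj] by blast
  have bnd: "\<bar>Qform U k (snd p) (L (fst p)) - m p\<bar> \<le> K / c * (norm (L (fst p) - ?N (snd p)))\<^sup>2"
    if "(\<forall>f. c * norm f \<le> norm (eap (bop U k (snd p)) f)) \<and> norm (hop U k (snd p)) \<le> K" for p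
    unfolding m_def
    by (rule order_trans[OF Qform_expand[OF U c(1)]])
       (use that c in \<open>auto intro!: mult_right_mono divide_right_mono\<close>)
  \<comment> \<open>The bounds above hold on a punctured neighbourhood of \<theta>, but p may
    approach (s, \<theta>) with \<open>snd p = \<theta>\<close>. That slice gets constants of its
    own.\<close>
  have "linear (eap (bop U k \<theta>))" using eap.bounded_linear_right bounded_linear.linear by blast
  then obtain c' where c': "c' > 0" "\<And>f. c' * norm f \<le> norm (eap (bop U k \<theta>) f)"
    using linear_inj_bounded_below_pos[of "eap (bop U k \<theta>)"] inj by (auto simp: linear_injective_0)
  have dr: "((\<lambda>p. Qform U k (snd p) (L (fst p)) - m p) has_derivative (\<lambda>_. 0)) (at (s, \<theta>))"
  proof (rule has_derivative_zero_of_quadratic_bound[OF de])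
    show "L (fst (s, \<theta>)) - ?N (snd (s, \<theta>)) = 0" by (simp add: s)
    show "Qform U k (snd (s, \<theta>)) (L (fst (s, \<theta>))) - m (s, \<theta>) = 0"
      using Qform_expand[OF U c', of "L s" "n \<theta>"] by (simp add: m_def s)
    let ?K = "max (K / c) (norm (hop U k \<theta>) / c')"
    have bd: "\<bar>Qform U k (snd p) (L (fst p)) - m p\<bar> \<le> ?K * (norm (L (fst p) - ?N (snd p)))\<^sup>2"
      if "snd p = \<theta> \<or> (\<forall>f. c * norm f \<le> norm (eap (bop U k (snd p)) f)) \<and> norm (hop U k (snd p)) \<le> K" for p
      using that
    proof
      assume p: "snd p = \<theta>"
      have "\<bar>Qform U k (snd p) (L (fst p)) - m p\<bar> \<le> norm (hop U k \<theta>) / c' * (norm (L (fst p) - ?N (snd p)))\<^sup>2"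
        unfolding m_def p by (rule Qform_expand[OF U c'])
      also have "\<dots> \<le> ?K * (norm (L (fst p) - ?N (snd p)))\<^sup>2"
        by (intro mult_right_mono) auto
      finally show ?thesis .
    next
      assume "(\<forall>f. c * norm f \<le> norm (eap (bop U k (snd p)) f)) \<and> norm (hop U k (snd p)) \<le> K"
      note bnd[OF this]
      also have "K / c * (norm (L (fst p) - ?N (snd p)))\<^sup>2 \<le> ?K * (norm (L (fst p) - ?N (snd p)))\<^sup>2"
        by (intro mult_right_mono) auto
      finally show ?thesis .
    qed
    have "eventually (\<lambda>\<theta>'. \<theta>' = \<theta> \<or> (\<forall>f. c * norm f \<le> norm (eap (bop U k \<theta>') f)) \<and> norm (hop U k \<theta>') \<le> K) (nhds \<theta>)"
      using ev unfolding eventually_at_filter by eventually_elim blast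
    moreover have "filterlim snd (nhds \<theta>) (at (s, \<theta>))"
      using isCont_snd[OF continuous_ident, of "(s, \<theta>)"] by (simp add: isCont_def)
    ultimately have "eventually (\<lambda>p. snd p = \<theta> \<or> (\<forall>f. c * norm f \<le> norm (eap (bop U k (snd p)) f)) \<and> norm (hop U k (snd p)) \<le> K) (at (s, \<theta>))"
      by (rule eventually_compose_filterlim)
    then show "eventually (\<lambda>p. \<bar>Qform U k (snd p) (L (fst p)) - m p\<bar>
        \<le> ?K * (norm (L (fst p) - ?N (snd p)))\<^sup>2) (at (s, \<theta>))"
      by (rule eventually_mono) (rule bd)
  qed
  show ?thesis
    using has_derivative_add[OF dr dm] s by (simp add: inner_diff_right algebra_simps)
qed


section \<open>Block coordinates and the reference function\<close>

lemma bounded_linear_blk: "bounded_linear (\<lambda>s :: (real^'q)^'k::{finite,linorder}. blk s j)"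
  unfolding blk_def by (rule bounded_linear_vec_nth)

lemma ex_blk:
  fixes f :: "nat \<Rightarrow> 'a"
  shows "\<exists>s :: 'a^'k::{finite,linorder}. \<forall>j\<in>{1..CARD('k)}. blk s j = f j"
proof -
  let ?l = "sorted_list_of_set (UNIV :: 'k set)"
  have l: "length ?l = CARD('k)" "distinct ?l" by simp_all
  \<comment> \<open>The description inverts the sorted enumeration of the index type;
    \<open>Suc\<close> accounts for blocks being numbered from 1.\<close>
  define s :: "'a^'k::{finite,linorder}" where "s = (\<chi> i. f (Suc (THE n. n < CARD('k) \<and> ?l ! n = i)))"
  have "blk s j = f j" if "j \<in> {1..CARD('k)}" for j
  proof -
    have "(THE n. n < CARD('k) \<and> ?l ! n = ?l ! (j - 1)) = j - 1"
      using that l by (intro the_equality) (auto simp: nth_eq_iff_index_eq)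
    then show ?thesis using that by (simp add: blk_def s_def)
  qed
  then show ?thesis by blast
qed

lemma blk_eqI:
  fixes s s' :: "'a^'k::{finite,linorder}"
  assumes "\<And>j. j \<in> {1..CARD('k)} \<Longrightarrow> blk s j = blk s' j"
  shows "s = s'"
proof -
  have "s $ i = s' $ i" for i
  proof -
    have "i \<in> set (sorted_list_of_set (UNIV :: 'k set))" by simp
    then obtain n where n: "n < CARD('k)" "sorted_list_of_set (UNIV :: 'k set) ! n = i"
      by (auto simp: in_set_conv_nth simp del: set_sorted_list_of_set)
    then show ?thesis using assms[of "Suc n"] by (simp add: blk_def)
  qed
  then show ?thesis by (simp add: vec_eq_iff)
qed

definition seqS :: "real^'q \<Rightarrow> (real^'q)^'k::{finite,linorder} \<Rightarrow> nat \<Rightarrow> real^'q" where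
  "seqS x s j = (if j = 0 then (1 / sqrt 2) *\<^sub>R x else blk s j)"

lemma phi_seqS:
  fixes s :: "(real^'q)^'k::{finite,linorder}"
  shows "phi U g s \<theta> = (norm (fst g))\<^sup>2 + (\<Sum>j=1..CARD('k). 2 * (2 * real j + 1) * (seqS (fst g) s j \<bullet> seqS (fst g) s j))
    + 2 * Qform U CARD('k) \<theta> (blk s CARD('k))
    + 4 * (snd g \<bullet> \<theta> + (\<Sum>j=1..CARD('k). eap (Wop U \<theta>) (seqS (fst g) s (j - 1)) \<bullet> seqS (fst g) s j))"
proof -
  let ?S = "seqS (fst g) s"
  have "(\<Sum>j=1..CARD('k). eap (Wop U \<theta>) (?S (j - 1)) \<bullet> ?S j)
      = eap (Wop U \<theta>) (?S 0) \<bullet> ?S 1 + (\<Sum>j=2..CARD('k). eap (Wop U \<theta>) (?S (j - 1)) \<bullet> ?S j)"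
    by (subst sum.atLeast_Suc_atMost) (auto simp: numeral_2_eq_2 Suc_le_eq)
  also have "(\<Sum>j=2..CARD('k). eap (Wop U \<theta>) (?S (j - 1)) \<bullet> ?S j)
      = (\<Sum>j=2..CARD('k). bracket U (blk s (j - 1)) (blk s j)) \<bullet> \<theta>"
    unfolding inner_sum_left by (intro sum.cong) (auto simp: bracket_inner seqS_def)
  also have "eap (Wop U \<theta>) (?S 0) \<bullet> ?S 1 = ((1 / sqrt 2) *\<^sub>R bracket U (fst g) (blk s 1)) \<bullet> \<theta>"
    by (simp add: bracket_inner seqS_def eap.scaleR_right)
  finally have "(snd g + (1 / sqrt 2) *\<^sub>R bracket U (fst g) (blk s 1)
      + (\<Sum>j=2..CARD('k). bracket U (blk s (j - 1)) (blk s j))) \<bullet> \<theta>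
    = snd g \<bullet> \<theta> + (\<Sum>j=1..CARD('k). eap (Wop U \<theta>) (?S (j - 1)) \<bullet> ?S j)"
    by (simp only: inner_add_left)
  moreover have "(\<Sum>j=1..CARD('k). 2 * (2 * real j + 1) * (?S j \<bullet> ?S j))
      = (\<Sum>j=1..CARD('k). 2 * (2 * real j + 1) * (norm (blk s j))\<^sup>2)"
    by (intro sum.cong) (auto simp: seqS_def power2_norm_eq_inner)
  ultimately show ?thesis
    unfolding phi_def Let_def Qform_def by (simp only:)
qed

text \<open>For \<open>j = k\<close> the vector \<open>- M\<close> takes the place of \<open>W S\<^sub>k\<^sub>+\<^sub>1\<close>.\<close>

definition crit_term :: "('m::finite \<Rightarrow> real^'q^'q) \<Rightarrow> nat \<Rightarrow> real^'m \<Rightarrow> real^'q \<Rightarrow> (nat \<Rightarrow> real^'q) \<Rightarrow> nat \<Rightarrow> real^'q" where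
  "crit_term U k \<theta> M S j = (2 * real j + 1) *\<^sub>R S j + eap (Wop U \<theta>) (S (j - 1))
      - (if j < k then eap (Wop U \<theta>) (S (Suc j)) else - M)"

text \<open>The s-part is sorted by blocks, so that \<open>crit_term\<close> is a quarter of the
  partial gradient. The \<theta>-part still involves the derivatives N' and M' along the chosen
  curve n.\<close>

lemma phi_has_derivative:
  fixes U :: "'m::finite \<Rightarrow> real^'q^'q" and s :: "(real^'q)^'k::{finite,linorder}"
  assumes U: "step_two U" and k: "k = CARD('k)" and inj: "\<And>v. eap (bop U k \<theta>) v = 0 \<Longrightarrow> v = 0"
    and N: "((\<lambda>\<theta>'. eap (bop U k \<theta>') (n \<theta>')) has_derivative N') (at \<theta>)"
    and M: "((\<lambda>\<theta>'. eap (hop U k \<theta>') (n \<theta>')) has_derivative M') (at \<theta>)"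
    and s: "blk s k = eap (bop U k \<theta>) (n \<theta>)"
  shows "((\<lambda>(s', \<theta>'). phi U g s' \<theta>') has_derivative (\<lambda>(ds, d\<theta>).
      4 * (\<Sum>j=1..k. blk ds j \<bullet> crit_term U k \<theta> (eap (hop U k \<theta>) (n \<theta>)) (seqS (fst g) s) j)
    + 4 * (snd g \<bullet> d\<theta> + (\<Sum>j=1..k. eap (Wop U d\<theta>) (seqS (fst g) s (j - 1)) \<bullet> seqS (fst g) s j))
    + 2 * (M' d\<theta> \<bullet> blk s k - eap (hop U k \<theta>) (n \<theta>) \<bullet> N' d\<theta>))) (at (s, \<theta>))"
proof -
  let ?S = "seqS (fst g) s" and ?M = "eap (hop U k \<theta>) (n \<theta>)" and ?W = "Wop U \<theta>"
  \<comment> \<open>The block of index 0 stands for x, which is held fixed, so its variation is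
    0.\<close>
  define dS :: "(real^'q)^'k::{finite,linorder} \<Rightarrow> nat \<Rightarrow> real^'q" where "dS ds j = (if j = 0 then 0 else blk ds j)" for ds j
  have k1: "1 \<le> k" using k by (simp add: Suc_le_eq)
  have sS: "((\<lambda>p. seqS (fst g) (fst p) j) has_derivative (\<lambda>q. dS (fst q) j)) (at (s, \<theta>))" for j
    using bounded_linear_imp_has_derivative[OF bounded_linear_compose[OF bounded_linear_blk bounded_linear_fst]]
    by (cases "j = 0") (simp_all add: seqS_def dS_def)
  have sW: "((\<lambda>p. Wop U (snd p)) has_derivative (\<lambda>q. Wop U (snd q))) (at (s, \<theta>))"
    by (rule bounded_linear_imp_has_derivative[OF bounded_linear_compose[OF bounded_linear_Wop bounded_linear_snd]])
  have sQ: "((\<lambda>p. Qform U k (snd p) (blk (fst p) k)) has_derivative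
    (\<lambda>q. 2 * (?M \<bullet> blk (fst q) k) + M' (snd q) \<bullet> blk s k - ?M \<bullet> N' (snd q))) (at (s, \<theta>))"
    by (rule Qform_has_derivative[OF U inj N M bounded_linear_blk s])
  have st: "((\<lambda>p. snd g \<bullet> snd p) has_derivative (\<lambda>q. snd g \<bullet> snd q)) (at (s, \<theta>))"
    by (rule bounded_linear_imp_has_derivative[OF bounded_linear_compose[OF bounded_linear_inner_right bounded_linear_snd]])
  define T where "T q = (\<Sum>j=1..k. 2 * (2 * real j + 1) * (?S j \<bullet> dS (fst q) j + dS (fst q) j \<bullet> ?S j))
      + 2 * (2 * (?M \<bullet> blk (fst q) k) + M' (snd q) \<bullet> blk s k - ?M \<bullet> N' (snd q))
      + 4 * (snd g \<bullet> snd q + (\<Sum>j=1..k. eap ?W (?S (j - 1)) \<bullet> dS (fst q) j +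
          (eap ?W (dS (fst q) (j - 1)) + eap (Wop U (snd q)) (?S (j - 1))) \<bullet> ?S j))" for q
  have sSS: "((\<lambda>p. 2 * (2 * real j + 1) * (seqS (fst g) (fst p) j \<bullet> seqS (fst g) (fst p) j)) has_derivative
      (\<lambda>q. 2 * (2 * real j + 1) * (?S j \<bullet> dS (fst q) j + dS (fst q) j \<bullet> ?S j))) (at (s, \<theta>))" for j
    using has_derivative_mult_right[OF has_derivative_inner[OF sS sS], of "2 * (2 * real j + 1)"] by simp
  have sB: "((\<lambda>p. eap (Wop U (snd p)) (seqS (fst g) (fst p) (j - 1)) \<bullet> seqS (fst g) (fst p) j) has_derivative
      (\<lambda>q. eap ?W (?S (j - 1)) \<bullet> dS (fst q) j +
          (eap ?W (dS (fst q) (j - 1)) + eap (Wop U (snd q)) (?S (j - 1))) \<bullet> ?S j)) (at (s, \<theta>))" for j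
    using has_derivative_inner[OF eap.FDERIV[OF sW sS] sS] by simp
  have D: "((\<lambda>p. phi U g (fst p) (snd p)) has_derivative T) (at (s, \<theta>))"
  proof -
    have "((\<lambda>p. (norm (fst g))\<^sup>2 + (\<Sum>j=1..k. 2 * (2 * real j + 1) * (seqS (fst g) (fst p) j \<bullet> seqS (fst g) (fst p) j))
      + 2 * Qform U k (snd p) (blk (fst p) k)
      + 4 * (snd g \<bullet> snd p + (\<Sum>j=1..k. eap (Wop U (snd p)) (seqS (fst g) (fst p) (j - 1)) \<bullet> seqS (fst g) (fst p) j)))
      has_derivative (\<lambda>q. 0 + (\<Sum>j=1..k. 2 * (2 * real j + 1) * (?S j \<bullet> dS (fst q) j + dS (fst q) j \<bullet> ?S j))
      + 2 * (2 * (?M \<bullet> blk (fst q) k) + M' (snd q) \<bullet> blk s k - ?M \<bullet> N' (snd q))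
      + 4 * (snd g \<bullet> snd q + (\<Sum>j=1..k. eap ?W (?S (j - 1)) \<bullet> dS (fst q) j +
          (eap ?W (dS (fst q) (j - 1)) + eap (Wop U (snd q)) (?S (j - 1))) \<bullet> ?S j)))) (at (s, \<theta>))"
      by (intro has_derivative_add has_derivative_const has_derivative_sum has_derivative_mult_right sSS sQ st sB)
    then show ?thesis by (simp add: phi_seqS k T_def[abs_def])
  qed
  \<comment> \<open>Skewness moves W to the other factor and a shift of the index collects the
    coefficient of the j-th variation. Nothing appears at j = 0, where the variation is 0, and
    nothing at j = k, where the sum ends.\<close>
  have shift: "(\<Sum>j=1..k. eap ?W (dS ds (j - 1)) \<bullet> ?S j)
      = - (\<Sum>j=1..k. dS ds j \<bullet> (if j < k then eap ?W (?S (Suc j)) else 0))" for ds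
  proof -
    define c where "c i = dS ds i \<bullet> eap ?W (?S (Suc i))" for i
    have "(\<Sum>j=1..k. eap ?W (dS ds (j - 1)) \<bullet> ?S j) = - (\<Sum>j=1..k. c (j - 1))"
      unfolding sum_negf[symmetric]
      by (intro sum.cong refl) (auto simp: c_def Wop_skew[OF U])
    also have "(\<Sum>j=1..k. c (j - 1)) = (\<Sum>i<k. c i)"
      by (rule sum.reindex_bij_witness[of _ Suc "\<lambda>j. j - 1"]) auto
    also have "\<dots> = (\<Sum>i\<in>{1..<k}. c i)"
      using k1 by (intro sum.mono_neutral_right) (auto simp: c_def dS_def Suc_le_eq)
    also have "\<dots> = (\<Sum>j=1..k. if j < k then c j else 0)"
      by (intro sum.mono_neutral_cong_left) auto
    also have "\<dots> = (\<Sum>j=1..k. dS ds j \<bullet> (if j < k then eap ?W (?S (Suc j)) else 0))"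
      by (intro sum.cong) (auto simp: c_def)
    finally show ?thesis .
  qed
  have "T (ds, d\<theta>) = 4 * (\<Sum>j=1..k. blk ds j \<bullet> crit_term U k \<theta> ?M ?S j)
    + 4 * (snd g \<bullet> d\<theta> + (\<Sum>j=1..k. eap (Wop U d\<theta>) (?S (j - 1)) \<bullet> ?S j))
    + 2 * (M' d\<theta> \<bullet> blk s k - ?M \<bullet> N' d\<theta>)" for ds d\<theta>
  proof -
    have crit: "(\<Sum>j=1..k. blk ds j \<bullet> crit_term U k \<theta> ?M ?S j)
        = (\<Sum>j=1..k. (2 * real j + 1) * (?S j \<bullet> dS ds j)) + (\<Sum>j=1..k. eap ?W (?S (j - 1)) \<bullet> dS ds j)
          - (\<Sum>j=1..k. dS ds j \<bullet> (if j < k then eap ?W (?S (Suc j)) else 0)) + ?M \<bullet> blk ds k"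
    proof -
      have "(\<Sum>j=1..k. if j = k then ?M \<bullet> blk ds j else 0) = ?M \<bullet> blk ds k"
        using k1 by simp
      note e = this
      have "(\<Sum>j=1..k. blk ds j \<bullet> crit_term U k \<theta> ?M ?S j)
        = (\<Sum>j=1..k. (2 * real j + 1) * (?S j \<bullet> dS ds j) + eap ?W (?S (j - 1)) \<bullet> dS ds j
          - dS ds j \<bullet> (if j < k then eap ?W (?S (Suc j)) else 0) + (if j = k then ?M \<bullet> blk ds j else 0))"
        by (intro sum.cong refl)
           (auto simp: crit_term_def dS_def inner_add_right inner_diff_right inner_commute)
      then show ?thesis by (simp only: sum.distrib sum_subtractf e)
    qed
    show ?thesis
      unfolding crit T_def fst_conv snd_conv inner_add_left sum.distrib shift
      by (simp add: sum_distrib_left inner_commute algebra_simps)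
  qed
  then have "T = (\<lambda>(ds, d\<theta>). 4 * (\<Sum>j=1..k. blk ds j \<bullet> crit_term U k \<theta> ?M ?S j)
    + 4 * (snd g \<bullet> d\<theta> + (\<Sum>j=1..k. eap (Wop U d\<theta>) (?S (j - 1)) \<bullet> ?S j))
    + 2 * (M' d\<theta> \<bullet> blk s k - ?M \<bullet> N' d\<theta>))"
    by (auto simp: fun_eq_iff)
  then show ?thesis using D by (simp add: case_prod_unfold)
qed

section \<open>Normal geodesics\<close>

lemma GDERIV_has_derivative_unique:
  assumes "GDERIV f x :> D" "(f has_derivative (\<lambda>h. h \<bullet> D')) (at x)"
  shows "D = D'"
proof -
  have "(\<lambda>h. h \<bullet> D) = (\<lambda>h. h \<bullet> D')"
    using has_derivative_unique assms by (metis gderiv_def)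
  then show ?thesis by (metis vector_eq_ldot)
qed

text \<open>The vector of the momenta of p along X_1, ..., X_q at g; along a Hamiltonian curve it is
  the horizontal velocity.\<close>

definition velocity :: "('m::finite \<Rightarrow> real^'q^'q) \<Rightarrow> ('q,'m) grp \<Rightarrow> ('q,'m) grp \<Rightarrow> real^'q" where
  "velocity U g p = fst p + (1/2) *\<^sub>R eap (Wop U (snd p)) (fst g)"

lemma sr_ham_velocity: "sr_ham U g p = (1/2) * (velocity U g p \<bullet> velocity U g p)"
proof -
  have "p \<bullet> Xfield U l g = velocity U g p $ l" for l
  proof -
    have "p \<bullet> Xfield U l g = fst p $ l + (\<Sum>j\<in>UNIV. snd p $ j * ((1/2) * (\<Sum>i\<in>UNIV. U j $ l $ i * fst g $ i)))"
      by (simp add: inner_prod_def Xfield_def inner_axis inner_vec_def[of "snd p"])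
    also have "(\<Sum>j\<in>UNIV. snd p $ j * ((1/2) * (\<Sum>i\<in>UNIV. U j $ l $ i * fst g $ i)))
        = (\<Sum>j\<in>UNIV. \<Sum>i\<in>UNIV. (1/2) * (snd p $ j * U j $ l $ i * fst g $ i))"
      by (simp add: sum_distrib_left ac_simps)
    also have "\<dots> = (\<Sum>i\<in>UNIV. \<Sum>j\<in>UNIV. (1/2) * (snd p $ j * U j $ l $ i * fst g $ i))"
      by (rule sum.swap)
    also have "\<dots> = (1/2) * eap (Wop U (snd p)) (fst g) $ l"
      by (simp add: eap_Wop_nth sum_distrib_left sum_distrib_right)
    finally show ?thesis by (simp add: velocity_def)
  qed
  then show ?thesis by (simp add: sr_ham_def inner_vec_def power2_eq_square)
qed

lemma sr_ham_gderiv_g: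
  assumes U: "step_two U"
  shows "GDERIV (\<lambda>y. sr_ham U y p) g :> (- (1/2) *\<^sub>R eap (Wop U (snd p)) (velocity U g p), 0)"
proof -
  have "((\<lambda>y. velocity U y p) has_derivative (\<lambda>h. (1/2) *\<^sub>R eap (Wop U (snd p)) (fst h))) (at g)"
    unfolding velocity_def
    by (auto intro!: derivative_eq_intros bounded_linear_imp_has_derivative
        bounded_linear_compose[OF eap.bounded_linear_right bounded_linear_fst])
  note D = has_derivative_mult_right[OF has_derivative_inner[OF this this], of "1/2"]
  have "velocity U g p \<bullet> eap (Wop U (snd p)) a = - (a \<bullet> eap (Wop U (snd p)) (velocity U g p))"
    "eap (Wop U (snd p)) a \<bullet> velocity U g p = - (a \<bullet> eap (Wop U (snd p)) (velocity U g p))" for a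
    using Wop_skew[OF U, of "snd p" a "velocity U g p"] by (simp_all add: inner_commute)
  then show ?thesis
    unfolding gderiv_def sr_ham_velocity
    by (intro has_derivative_eq_rhs[OF D]) (simp add: fun_eq_iff inner_prod_def)
qed

lemma sr_ham_gderiv_p:
  fixes U :: "'m::finite \<Rightarrow> real^'q^'q"
  shows "GDERIV (\<lambda>y. sr_ham U g y) p :> (velocity U g p, (1/2) *\<^sub>R bracket U (fst g) (velocity U g p))"
proof -
  have "((\<lambda>y. velocity U g y) has_derivative (\<lambda>h. fst h + (1/2) *\<^sub>R eap (Wop U (snd h)) (fst g))) (at p)"
    unfolding velocity_def
    by (intro has_derivative_add has_derivative_scaleR_right bounded_linear_imp_has_derivative bounded_linear_fst
        bounded_linear_compose[OF eap.bounded_linear_left bounded_linear_compose[OF bounded_linear_Wop bounded_linear_snd]])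
  note D = has_derivative_mult_right[OF has_derivative_inner[OF this this], of "1/2"]
  have b: "snd h \<bullet> bracket U (fst g) (velocity U g p) = eap (Wop U (snd h)) (fst g) \<bullet> velocity U g p" for h :: "('q, 'm) grp"
    by (simp only: inner_commute[of "snd h"] bracket_inner)
  have c: "velocity U g p \<bullet> z = z \<bullet> velocity U g p" for z
    by (rule inner_commute)
  show ?thesis
    unfolding gderiv_def sr_ham_velocity
  proof (intro has_derivative_eq_rhs[OF D] ext)
    fix h :: "('q, 'm) grp"
    let ?z = "fst h + (1/2) *\<^sub>R eap (Wop U (snd h)) (fst g)"
    have "(1/2) * (velocity U g p \<bullet> ?z + ?z \<bullet> velocity U g p) = ?z \<bullet> velocity U g p"
      unfolding c[of ?z] by simp
    also have "\<dots> = h \<bullet> (velocity U g p, (1/2) *\<^sub>R bracket U (fst g) (velocity U g p))"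
      by (simp add: inner_prod_def b inner_add_left)
    finally show "(1/2) * (velocity U g p \<bullet> ?z + ?z \<bullet> velocity U g p) =
      h \<bullet> (velocity U g p, (1/2) *\<^sub>R bracket U (fst g) (velocity U g p))" .
  qed
qed

lemma ham_curve_iff:
  assumes U: "step_two U"
  shows "ham_curve (sr_ham U) g p \<longleftrightarrow> (\<forall>r\<in>{0..1}.
    (g has_vector_derivative (velocity U (g r) (p r), (1/2) *\<^sub>R bracket U (fst (g r)) (velocity U (g r) (p r)))) (at r within {0..1}) \<and>
    (p has_vector_derivative ((1/2) *\<^sub>R eap (Wop U (snd (p r))) (velocity U (g r) (p r)), 0)) (at r within {0..1}))"
    (is "_ \<longleftrightarrow> (\<forall>r\<in>_. ?R r)")
proof -
  have "(\<exists>Hg Hp. GDERIV (\<lambda>y. sr_ham U y (p r)) (g r) :> Hg \<and> GDERIV (\<lambda>y. sr_ham U (g r) y) (p r) :> Hp \<and>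
      (g has_vector_derivative Hp) (at r within {0..1}) \<and> (p has_vector_derivative - Hg) (at r within {0..1})) \<longleftrightarrow> ?R r" (is "?L \<longleftrightarrow> _") for r
  proof
    assume ?L
    then obtain Hg Hp where H: "GDERIV (\<lambda>y. sr_ham U y (p r)) (g r) :> Hg" "GDERIV (\<lambda>y. sr_ham U (g r) y) (p r) :> Hp"
      "(g has_vector_derivative Hp) (at r within {0..1})" "(p has_vector_derivative - Hg) (at r within {0..1})"
      by blast
    have "Hg = (- (1/2) *\<^sub>R eap (Wop U (snd (p r))) (velocity U (g r) (p r)), 0)"
      using GDERIV_has_derivative_unique[OF H(1)] sr_ham_gderiv_g[OF U, of "p r" "g r"] by (simp add: gderiv_def)
    moreover have "Hp = (velocity U (g r) (p r), (1/2) *\<^sub>R bracket U (fst (g r)) (velocity U (g r) (p r)))"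
      using GDERIV_has_derivative_unique[OF H(2)] sr_ham_gderiv_p[of U "g r" "p r"] by (simp add: gderiv_def)
    ultimately show "?R r" using H(3,4) by simp
  next
    assume R: "?R r"
    show ?L
      using R sr_ham_gderiv_g[OF U, of "p r" "g r"] sr_ham_gderiv_p[of U "g r" "p r"]
      by (intro exI[of _ "(- (1/2) *\<^sub>R eap (Wop U (snd (p r))) (velocity U (g r) (p r)), 0)"]
          exI[of _ "(velocity U (g r) (p r), (1/2) *\<^sub>R bracket U (fst (g r)) (velocity U (g r) (p r)))"]) simp
  qed
  then show ?thesis unfolding ham_curve_def by blast
qed

text \<open>Read off from \<open>exp_bes\<close>; it provides the continuity of the flow in its
  parameter.\<close>

lemma continuous_on_exp_algebra:
  "continuous_on S (\<lambda>A. exp (A :: 'a::{real_normed_algebra_1,banach}))"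
proof -
  have b: "continuous_on UNIV (bes j :: 'a \<Rightarrow> 'a)" for j
    by (intro continuous_at_imp_continuous_on ballI) (metis bes_has_derivative_ex has_derivative_continuous)
  have "continuous_on S (\<lambda>A :: 'a. bes j (A\<^sup>2))" for j
    by (rule continuous_on_compose2[OF b]) (auto intro!: continuous_intros)
  then show ?thesis unfolding exp_bes(1) by (intro continuous_intros)
qed

lemma exp_minus_cancel:
  "exp (- A) * exp A = (1 :: 'a::{real_normed_algebra_1,banach})" "exp A * exp (- A) = (1 :: 'a)"
  using exp_add_commuting[of "- A" A] exp_add_commuting[of A "- A"] by simp_all

section \<open>The explicit flow and the exponential map\<close>

definition flow_u :: "('m::finite \<Rightarrow> real^'q^'q) \<Rightarrow> real^'m \<Rightarrow> real^'q \<Rightarrow> real \<Rightarrow> real^'q" where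
  "flow_u U \<tau> \<zeta> r = eap (exp (r *\<^sub>R Wop U \<tau>)) \<zeta>"

text \<open>An integral rather than W^(-1) (exp (r W) - 1) \<zeta>, because W may be
  singular.\<close>

definition flow_x :: "('m::finite \<Rightarrow> real^'q^'q) \<Rightarrow> real^'m \<Rightarrow> real^'q \<Rightarrow> real \<Rightarrow> real^'q" where
  "flow_x U \<tau> \<zeta> r = integral {0..r} (flow_u U \<tau> \<zeta>)"

lemma flow_u_has_derivative:
  "(flow_u U \<tau> \<zeta> has_vector_derivative eap (Wop U \<tau>) (flow_u U \<tau> \<zeta> r)) (at r within S)"
proof -
  have "((\<lambda>r. exp (r *\<^sub>R Wop U \<tau>)) has_vector_derivative (Wop U \<tau> * exp (r *\<^sub>R Wop U \<tau>))) (at r within S)"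
    using exp_scaleR_has_vector_derivative_left has_vector_derivative_at_within by blast
  from bounded_linear.has_vector_derivative[OF eap.bounded_linear_left this, of \<zeta>]
  show ?thesis by (simp add: flow_u_def[abs_def])
qed

lemma continuous_on_flow_u: "continuous_on S (flow_u U \<tau> \<zeta>)"
  by (rule continuous_on_vector_derivative[OF flow_u_has_derivative])

lemma flow_x_has_derivative:
  assumes "r \<in> {0..1}"
  shows "(flow_x U \<tau> \<zeta> has_vector_derivative flow_u U \<tau> \<zeta> r) (at r within {0..1})"
  unfolding flow_x_def[abs_def]
  by (rule integral_has_vector_derivative[OF continuous_on_flow_u assms])

lemma continuous_on_flow_x: "continuous_on {0..1} (flow_x U \<tau> \<zeta>)"
  by (rule continuous_on_vector_derivative[OF flow_x_has_derivative])

lemma flow_0 [simp]: "flow_u U \<tau> \<zeta> 0 = \<zeta>" "flow_x U \<tau> \<zeta> 0 = 0"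
  by (simp_all add: flow_u_def flow_x_def)

lemma bounded_bilinear_bracket: "bounded_bilinear (bracket U)"
proof -
  have "bilinear (bracket U)"
    unfolding bilinear_def
    by (auto intro!: linearI simp: bracket_def vec_eq_iff matrix_vector_right_distrib inner_add
        matrix_vector_mult_scaleR)
  then show ?thesis by (simp add: bilinear_conv_bounded_bilinear)
qed

lemma continuous_on_flow_bracket:
  "continuous_on {0..1} (\<lambda>r. (1/2) *\<^sub>R bracket U (flow_x U \<tau> \<zeta> r) (flow_u U \<tau> \<zeta> r))"
  by (intro continuous_intros bounded_bilinear.continuous_on[OF bounded_bilinear_bracket]
      continuous_on_flow_x continuous_on_flow_u)

lemma vector_derivative_eq_integral:
  fixes f :: "real \<Rightarrow> 'a::euclidean_space"
  assumes "\<And>r. r \<in> {0..1} \<Longrightarrow> (f has_vector_derivative f' r) (at r within {0..1})" "f 0 = 0" "r \<in> {0..1}"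
  shows "f r = integral {0..r} f'"
proof -
  have "(f' has_integral (f r - f 0)) {0..r}"
  proof (rule fundamental_theorem_of_calculus)
    show "(f has_vector_derivative f' y) (at y within {0..r})" if "y \<in> {0..r}" for y
      by (rule has_vector_derivative_within_subset[OF assms(1)]) (use that assms(3) in auto)
  qed (use assms(3) in auto)
  then show ?thesis using assms(2) by (simp add: integral_unique)
qed

text \<open>Two first integrals determine the curve: the vertical covector is constant, after which
  the velocity solves v' = W v and exp (- r W) v(r) is constant.\<close>

lemma ham_curve_unique:
  assumes U: "step_two U" and c: "ham_curve (sr_ham U) g p" and g0: "g 0 = gid" and p0: "p 0 = (\<zeta>, \<tau>)"
  shows "g 1 = (flow_x U \<tau> \<zeta> 1, integral {0..1} (\<lambda>r. (1/2) *\<^sub>R bracket U (flow_x U \<tau> \<zeta> r) (flow_u U \<tau> \<zeta> r)))"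
proof -
  define v where "v r = velocity U (g r) (p r)" for r
  have dg: "(g has_vector_derivative (v r, (1/2) *\<^sub>R bracket U (fst (g r)) (v r))) (at r within {0..1})"
    and dp: "(p has_vector_derivative ((1/2) *\<^sub>R eap (Wop U (snd (p r))) (v r), 0)) (at r within {0..1})"
    if "r \<in> {0..1}" for r
    using c that unfolding ham_curve_iff[OF U] v_def by blast+
  have dfg: "((\<lambda>r. fst (g r)) has_vector_derivative v r) (at r within {0..1})"
    and dsg: "((\<lambda>r. snd (g r)) has_vector_derivative (1/2) *\<^sub>R bracket U (fst (g r)) (v r)) (at r within {0..1})"
    and dfp: "((\<lambda>r. fst (p r)) has_vector_derivative (1/2) *\<^sub>R eap (Wop U (snd (p r))) (v r)) (at r within {0..1})"
    and dsp: "((\<lambda>r. snd (p r)) has_vector_derivative 0) (at r within {0..1})"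
    if "r \<in> {0..1}" for r
    using bounded_linear.has_vector_derivative[OF bounded_linear_fst dg[OF that]]
      bounded_linear.has_vector_derivative[OF bounded_linear_snd dg[OF that]]
      bounded_linear.has_vector_derivative[OF bounded_linear_fst dp[OF that]]
      bounded_linear.has_vector_derivative[OF bounded_linear_snd dp[OF that]] by simp_all
  have conv: "convex {0..1::real}" by simp
  obtain c0 where "\<And>r. r \<in> {0..1} \<Longrightarrow> snd (p r) = c0"
    using has_vector_derivative_zero_constant[OF conv dsp] by blast
  then have \<tau>: "snd (p r) = \<tau>" if "r \<in> {0..1}" for r
    using that p0 by (metis atLeastAtMost_iff order_refl snd_conv zero_le_one)
  let ?W = "Wop U \<tau>"
  have dv: "(v has_vector_derivative eap ?W (v r)) (at r within {0..1})" if r: "r \<in> {0..1}" for r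
  proof -
    have "((\<lambda>r. fst (p r) + (1/2) *\<^sub>R eap ?W (fst (g r))) has_vector_derivative
        ((1/2) *\<^sub>R eap ?W (v r) + (1/2) *\<^sub>R eap ?W (v r))) (at r within {0..1})"
      using has_vector_derivative_add[OF dfp[OF r] bounded_linear.has_vector_derivative[OF
          bounded_linear_compose[OF bounded_linear_scaleR_right eap.bounded_linear_right] dfg[OF r], of "1/2" ?W]]
        \<tau>[OF r] by simp
    then have "((\<lambda>r. fst (p r) + (1/2) *\<^sub>R eap ?W (fst (g r))) has_vector_derivative eap ?W (v r)) (at r within {0..1})"
      by (simp flip: scaleR_add_left)
    then show ?thesis
      by (rule has_vector_derivative_transform[OF r, rotated]) (simp add: v_def velocity_def \<tau>)
  qed
  have "((\<lambda>r. eap (exp (r *\<^sub>R - ?W)) (v r)) has_vector_derivative 0) (at r within {0..1})" if r: "r \<in> {0..1}" for r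
  proof -
    have "((\<lambda>r. exp (r *\<^sub>R - ?W)) has_vector_derivative (exp (r *\<^sub>R - ?W) * - ?W)) (at r within {0..1})"
      by (rule exp_scaleR_has_vector_derivative_right)
    from bounded_bilinear.has_vector_derivative[OF bounded_bilinear_eap this dv[OF r]]
    show ?thesis by (simp add: eap.minus_left eap.minus_right)
  qed
  then obtain c1 where c1: "\<And>r. r \<in> {0..1} \<Longrightarrow> eap (exp (r *\<^sub>R - ?W)) (v r) = c1"
    using has_vector_derivative_zero_constant[OF conv] by blast
  have "v 0 = \<zeta>" using g0 p0 by (simp add: v_def velocity_def gid_def eap.zero_right)
  then have "c1 = \<zeta>" using c1[of 0] by simp
  have v: "v r = flow_u U \<tau> \<zeta> r" if "r \<in> {0..1}" for r
  proof -
    have "flow_u U \<tau> \<zeta> r = eap (exp (r *\<^sub>R ?W) * exp (- (r *\<^sub>R ?W))) (v r)"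
      using c1[OF that] \<open>c1 = \<zeta>\<close> by (simp add: flow_u_def)
    then show ?thesis by (simp only: exp_minus_cancel eap_one)
  qed
  have x: "fst (g r) = flow_x U \<tau> \<zeta> r" if "r \<in> {0..1}" for r
    unfolding flow_x_def
    by (rule vector_derivative_eq_integral[OF _ _ that]) (use dfg v g0 in \<open>auto simp: gid_def\<close>)
  moreover have "snd (g 1) = integral {0..1} (\<lambda>r. (1/2) *\<^sub>R bracket U (flow_x U \<tau> \<zeta> r) (flow_u U \<tau> \<zeta> r))"
    by (rule vector_derivative_eq_integral) (use dsg v x g0 in \<open>auto simp: gid_def\<close>)
  ultimately show ?thesis by (simp add: prod_eq_iff)
qed

lemma sr_exp_flow:
  assumes U: "step_two U"
  shows "sr_exp U (\<zeta>, \<tau>) = (flow_x U \<tau> \<zeta> 1, integral {0..1} (\<lambda>r. (1/2) *\<^sub>R bracket U (flow_x U \<tau> \<zeta> r) (flow_u U \<tau> \<zeta> r)))"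
  unfolding sr_exp_def
proof (rule the_equality)
  let ?u = "flow_u U \<tau> \<zeta>" and ?x = "flow_x U \<tau> \<zeta>" and ?W = "Wop U \<tau>"
  define t where "t r = integral {0..r} (\<lambda>r. (1/2) *\<^sub>R bracket U (?x r) (?u r))" for r
  define g where "g r = (?x r, t r)" for r
  \<comment> \<open>The horizontal covector must offset the term (1/2) W x in the velocity.\<close>
  define p where "p r = (?u r - (1/2) *\<^sub>R eap ?W (?x r), \<tau>)" for r
  have vel: "velocity U (g r) (p r) = ?u r" for r by (simp add: velocity_def g_def p_def)
  have "ham_curve (sr_ham U) g p"
    unfolding ham_curve_iff[OF U] vel
  proof (intro ballI conjI)
    fix r :: real assume r: "r \<in> {0..1}"
    have "(t has_vector_derivative (1/2) *\<^sub>R bracket U (?x r) (?u r)) (at r within {0..1})"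
      unfolding t_def[abs_def]
      by (rule integral_has_vector_derivative[OF continuous_on_flow_bracket r])
    then show "(g has_vector_derivative (?u r, (1/2) *\<^sub>R bracket U (fst (g r)) (?u r))) (at r within {0..1})"
      unfolding g_def[abs_def] using flow_x_has_derivative[OF r] by (auto intro: has_vector_derivative_Pair)
    have "((\<lambda>r. ?u r - (1/2) *\<^sub>R eap ?W (?x r)) has_vector_derivative
        (eap ?W (?u r) - (1/2) *\<^sub>R eap ?W (?u r))) (at r within {0..1})"
      by (intro has_vector_derivative_diff flow_u_has_derivative
          bounded_linear.has_vector_derivative[OF bounded_linear_compose[OF bounded_linear_scaleR_right eap.bounded_linear_right]]
          flow_x_has_derivative r)
    moreover have "eap ?W (?u r) - (1/2) *\<^sub>R eap ?W (?u r) = (1/2) *\<^sub>R eap ?W (?u r)"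
      by (simp add: vec_eq_iff)
    ultimately show "(p has_vector_derivative ((1/2) *\<^sub>R eap (Wop U (snd (p r))) (?u r), 0)) (at r within {0..1})"
      unfolding p_def[abs_def] by (intro has_vector_derivative_Pair) auto
  qed
  moreover have "g 0 = gid" "p 0 = (\<zeta>, \<tau>)" by (simp_all add: g_def p_def t_def gid_def eap.zero_right)
  moreover have "g 1 = (?x 1, integral {0..1} (\<lambda>r. (1/2) *\<^sub>R bracket U (?x r) (?u r)))" by (simp add: g_def t_def)
  ultimately show "\<exists>g p. ham_curve (sr_ham U) g p \<and> g 0 = gid \<and> p 0 = (\<zeta>, \<tau>) \<and>
      g 1 = (?x 1, integral {0..1} (\<lambda>r. (1/2) *\<^sub>R bracket U (?x r) (?u r)))" by blast
qed (use ham_curve_unique[OF U] in blast)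

lemma eap_exp_sbes:
  "eap (exp (Wop U \<theta>)) v = eap (sbes U 0 \<theta>) v + eap (Wop U \<theta>) (eap (sbes U 1 \<theta>) v) + eap (Wop U \<theta>) (eap (sbes U 0 \<theta>) v)"
  "eap (exp (- Wop U \<theta>)) v = eap (sbes U 0 \<theta>) v + eap (Wop U \<theta>) (eap (sbes U 1 \<theta>) v) - eap (Wop U \<theta>) (eap (sbes U 0 \<theta>) v)"
  unfolding exp_bes
  by (simp_all add: eap.add_left eap.diff_left sbes_def power2_eq_square)

text \<open>The endpoint is the integral of exp ((2r-1) W) \<eta>, formally (sinh W / W) \<eta>. To
  avoid dividing by W, the flow is added to its reflection under r \<mapsto> 1 - r: the two
  velocities sum to twice a hyperbolic cosine, whose primitive is an explicit power series.\<close>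

lemma flow_x_end:
  fixes U :: "'m::finite \<Rightarrow> real^'q^'q"
  shows "flow_x U (2 *\<^sub>R \<theta>) (eap (exp (- Wop U \<theta>)) \<eta>) 1 = eap (sbes U 0 \<theta>) \<eta>"
proof -
  let ?W = "Wop U \<theta>" and ?\<zeta> = "eap (exp (- Wop U \<theta>)) \<eta>"
  let ?u = "flow_u U (2 *\<^sub>R \<theta>) ?\<zeta>" and ?x = "flow_x U (2 *\<^sub>R \<theta>) ?\<zeta>"
  have W2: "Wop U (2 *\<^sub>R \<theta>) = 2 *\<^sub>R ?W"
    by (rule linear_scale[OF bounded_linear.linear[OF bounded_linear_Wop]])
  have u: "?u r = eap (exp ((2 * r - 1) *\<^sub>R ?W)) \<eta>" for r
  proof -
    have "exp (r *\<^sub>R (2 *\<^sub>R ?W)) * exp (- ?W) = exp (r *\<^sub>R (2 *\<^sub>R ?W) + - ?W)"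
      by (rule exp_add_commuting[symmetric]) simp
    moreover have "r *\<^sub>R (2 *\<^sub>R ?W) + - ?W = (2 * r - 1) *\<^sub>R ?W"
      by (simp add: algebra_simps)
    ultimately show ?thesis
      unfolding flow_u_def W2 eap_mult[symmetric] by simp
  qed
  \<comment> \<open>G y stands for (sinh (y W) / W) \<eta> and ch y for cosh (y W) \<eta>.\<close>
  define G where "G y = eap (y *\<^sub>R bes 0 (y\<^sup>2 *\<^sub>R ?W\<^sup>2)) \<eta>" for y :: real
  define ch where "ch y = eap (bes 0 (y\<^sup>2 *\<^sub>R ?W\<^sup>2) + (y\<^sup>2 *\<^sub>R ?W\<^sup>2) * bes 1 (y\<^sup>2 *\<^sub>R ?W\<^sup>2)) \<eta>" for y :: real
  have dG: "(G has_vector_derivative ch y) (at y)" for y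
  proof -
    obtain D where D: "(bes 0 has_derivative D) (at (y\<^sup>2 *\<^sub>R ?W\<^sup>2))"
      and Dc: "\<And>h. h * (y\<^sup>2 *\<^sub>R ?W\<^sup>2) = (y\<^sup>2 *\<^sub>R ?W\<^sup>2) * h \<Longrightarrow> D h = (1/2) *\<^sub>R (bes 1 (y\<^sup>2 *\<^sub>R ?W\<^sup>2) * h)"
      using bes_has_derivative_ex[of 0 "y\<^sup>2 *\<^sub>R ?W\<^sup>2"] unfolding One_nat_def by blast
    have "((\<lambda>y. y\<^sup>2 *\<^sub>R ?W\<^sup>2) has_vector_derivative (2 * y) *\<^sub>R ?W\<^sup>2) (at y)"
      by (auto intro!: derivative_eq_intros simp: has_vector_derivative_def)
    then have "((\<lambda>y. bes 0 (y\<^sup>2 *\<^sub>R ?W\<^sup>2)) has_derivative (\<lambda>h. D (h *\<^sub>R ((2 * y) *\<^sub>R ?W\<^sup>2)))) (at y)"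
      unfolding has_vector_derivative_def
      by (rule has_derivative_compose[where f = "\<lambda>y. y\<^sup>2 *\<^sub>R ?W\<^sup>2" and g = "bes 0" and g' = D, OF _ D])
    moreover have "D (h *\<^sub>R ((2 * y) *\<^sub>R ?W\<^sup>2)) = h *\<^sub>R (y *\<^sub>R (bes 1 (y\<^sup>2 *\<^sub>R ?W\<^sup>2) * ?W\<^sup>2))" for h
      by (subst Dc) simp_all
    ultimately have "((\<lambda>y. bes 0 (y\<^sup>2 *\<^sub>R ?W\<^sup>2)) has_vector_derivative y *\<^sub>R (bes 1 (y\<^sup>2 *\<^sub>R ?W\<^sup>2) * ?W\<^sup>2)) (at y)"
      by (simp add: has_vector_derivative_def)
    from bounded_bilinear.has_vector_derivative[OF bounded_bilinear_scaleR has_vector_derivative_id this]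
    have "((\<lambda>y. y *\<^sub>R bes 0 (y\<^sup>2 *\<^sub>R ?W\<^sup>2)) has_vector_derivative
        (y *\<^sub>R (y *\<^sub>R (bes 1 (y\<^sup>2 *\<^sub>R ?W\<^sup>2) * ?W\<^sup>2)) + bes 0 (y\<^sup>2 *\<^sub>R ?W\<^sup>2))) (at y)"
      by simp
    moreover have "bes 1 (y\<^sup>2 *\<^sub>R ?W\<^sup>2) * ?W\<^sup>2 = ?W\<^sup>2 * bes 1 (y\<^sup>2 *\<^sub>R ?W\<^sup>2)"
      by (rule bes_commute) simp
    ultimately have "((\<lambda>y. y *\<^sub>R bes 0 (y\<^sup>2 *\<^sub>R ?W\<^sup>2)) has_vector_derivative
        (bes 0 (y\<^sup>2 *\<^sub>R ?W\<^sup>2) + (y\<^sup>2 *\<^sub>R ?W\<^sup>2) * bes 1 (y\<^sup>2 *\<^sub>R ?W\<^sup>2))) (at y)"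
      by (simp add: power2_eq_square[of y] add.commute)
    from bounded_linear.has_vector_derivative[OF eap.bounded_linear_left this, of \<eta>]
    show ?thesis unfolding G_def[abs_def] ch_def .
  qed
  have uu: "?u r + ?u (1 - r) = 2 *\<^sub>R ch (2 * r - 1)" for r
  proof -
    have "(2 * (1 - r) - 1) *\<^sub>R ?W = - ((2 * r - 1) *\<^sub>R ?W)" by (simp add: algebra_simps)
    moreover have "((2 * r - 1) *\<^sub>R ?W)\<^sup>2 = (2 * r - 1)\<^sup>2 *\<^sub>R ?W\<^sup>2" by (simp add: power2_eq_square)
    ultimately show ?thesis
      unfolding u ch_def eap.add_left[symmetric] eap.scaleR_left[symmetric]
      by (simp only: exp_bes) (simp add: scaleR_2)
  qed
  have "((\<lambda>r. ?x r - ?x (1 - r) - G (2 * r - 1)) has_vector_derivative 0) (at r within {0..1})" if r: "r \<in> {0..1}" for r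
  proof -
    have "((\<lambda>r. 1 - r) has_vector_derivative (-1)) (at r within {0..1})"
      by (auto intro!: derivative_eq_intros simp: has_vector_derivative_def)
    moreover have "(?x has_vector_derivative ?u (1 - r)) (at (1 - r) within (\<lambda>r. 1 - r) ` {0..1})"
      using flow_x_has_derivative[of "1 - r"] r by simp
    ultimately have d2: "((\<lambda>r. ?x (1 - r)) has_vector_derivative (-1) *\<^sub>R ?u (1 - r)) (at r within {0..1})"
      using vector_diff_chain_within[of "\<lambda>r. 1 - r" "-1" r "{0..1}" ?x "?u (1 - r)"] by (simp add: o_def)
    have "((\<lambda>r. 2 * r - 1) has_vector_derivative 2) (at r within {0..1})"
      by (auto intro!: derivative_eq_intros simp: has_vector_derivative_def)
    then have d3: "((\<lambda>r. G (2 * r - 1)) has_vector_derivative 2 *\<^sub>R ch (2 * r - 1)) (at r within {0..1})"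
      using vector_diff_chain_within[of "\<lambda>r. 2 * r - 1" 2 r "{0..1}" G "ch (2 * r - 1)"]
        has_vector_derivative_at_within[OF dG] by (simp add: o_def)
    from has_vector_derivative_diff[OF has_vector_derivative_diff[OF flow_x_has_derivative[OF r, of U "2 *\<^sub>R \<theta>" ?\<zeta>] d2] d3]
    show ?thesis using uu[of r] by simp
  qed
  then obtain c where c: "\<And>r. r \<in> {0..1} \<Longrightarrow> ?x r - ?x (1 - r) - G (2 * r - 1) = c"
    using has_vector_derivative_zero_constant[of "{0..1::real}" "\<lambda>r. ?x r - ?x (1 - r) - G (2 * r - 1)"] by auto
  \<comment> \<open>The values at r = 0 and r = 1 agree; as G is odd, this reads 2 x(1) = 2
    G(1).\<close>
  have "?x 0 - ?x 1 - G (-1) = ?x 1 - ?x 0 - G 1" using c[of 0] c[of 1] by simp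
  moreover have "G 1 = eap (sbes U 0 \<theta>) \<eta>" "G (-1) = - eap (sbes U 0 \<theta>) \<eta>"
    by (simp_all add: G_def sbes_def eap.minus_left)
  ultimately have "?x 1 + ?x 1 = eap (sbes U 0 \<theta>) \<eta> + eap (sbes U 0 \<theta>) \<eta>" by (simp add: algebra_simps)
  then have "2 *\<^sub>R ?x 1 = 2 *\<^sub>R eap (sbes U 0 \<theta>) \<eta>" by (simp only: scaleR_2)
  then show ?thesis by simp
qed


section \<open>First variation of the flow in the vertical covector\<close>

lemma Wop_scale: "Wop U (c *\<^sub>R \<theta>) = c *\<^sub>R Wop U \<theta>"
  by (rule linear_scale[OF bounded_linear.linear[OF bounded_linear_Wop]])

lemma Wop_add: "Wop U (\<theta> + \<theta>') = Wop U \<theta> + Wop U \<theta>'"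
  by (rule linear_add[OF bounded_linear.linear[OF bounded_linear_Wop]])

text \<open>The curve belonging to \<open>\<theta> + \<epsilon> \<delta>\<close> is paired with the one belonging to \<open>\<theta>\<close>: the product
  rule gives an identity that is exact in \<open>\<epsilon>\<close>, so that no derivative of the flow in the parameter is
  needed, only its continuity.\<close>

lemma flow_pairing:
  fixes U :: "'m::finite \<Rightarrow> real^'q^'q" and \<epsilon> :: real and \<theta> \<delta> :: "real^'m" and \<eta> :: "real^'q"
  defines "u \<equiv> \<lambda>\<epsilon>. flow_u U (2 *\<^sub>R (\<theta> + \<epsilon> *\<^sub>R \<delta>)) (eap (exp (- Wop U (\<theta> + \<epsilon> *\<^sub>R \<delta>))) \<eta>)"
    and "x \<equiv> \<lambda>\<epsilon>. flow_x U (2 *\<^sub>R (\<theta> + \<epsilon> *\<^sub>R \<delta>)) (eap (exp (- Wop U (\<theta> + \<epsilon> *\<^sub>R \<delta>))) \<eta>)"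
  assumes U: "step_two U"
  shows "2 * \<epsilon> * integral {0..1} (\<lambda>r. eap (Wop U \<delta>) (u \<epsilon> r) \<bullet> x 0 r)
    = eap (exp (Wop U (\<theta> + \<epsilon> *\<^sub>R \<delta>))) \<eta> \<bullet> eap (sbes U 0 \<theta>) \<eta>
      - eap (sbes U 0 (\<theta> + \<epsilon> *\<^sub>R \<delta>)) \<eta> \<bullet> eap (exp (- Wop U \<theta>)) \<eta>"
proof -
  let ?W = "Wop U \<theta>" and ?V = "Wop U \<delta>" and ?W\<epsilon> = "Wop U (\<theta> + \<epsilon> *\<^sub>R \<delta>)"
  have du: "(u e has_vector_derivative 2 *\<^sub>R eap (Wop U (\<theta> + e *\<^sub>R \<delta>)) (u e r)) (at r within {0..1})" for e r
    using flow_u_has_derivative[of U "2 *\<^sub>R (\<theta> + e *\<^sub>R \<delta>)"]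
    unfolding u_def Wop_scale eap.scaleR_left by blast
  have dx: "(x e has_vector_derivative u e r) (at r within {0..1})" if "r \<in> {0..1}" for e r
    unfolding x_def u_def by (rule flow_x_has_derivative[OF that])
  have init: "u e 0 = eap (exp (- Wop U (\<theta> + e *\<^sub>R \<delta>))) \<eta>" "x e 0 = 0" for e by (simp_all add: u_def x_def)
  have x1: "x e 1 = eap (sbes U 0 (\<theta> + e *\<^sub>R \<delta>)) \<eta>" for e
    unfolding x_def by (rule flow_x_end)
  have u1: "u e 1 = eap (exp (Wop U (\<theta> + e *\<^sub>R \<delta>))) \<eta>" for e
  proof -
    let ?A = "Wop U (\<theta> + e *\<^sub>R \<delta>)"
    have "exp (2 *\<^sub>R ?A) * exp (- ?A) = exp (2 *\<^sub>R ?A + - ?A)"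
      by (rule exp_add_commuting[symmetric]) simp
    moreover have "u e 1 = eap (exp (2 *\<^sub>R ?A) * exp (- ?A)) \<eta>"
      by (simp only: u_def flow_u_def Wop_scale eap_mult scaleR_one)
    ultimately show ?thesis by (simp add: scaleR_2)
  qed
  have Wx: "2 *\<^sub>R eap ?W (x 0 r) = u 0 r - u 0 0" if r: "r \<in> {0..1}" for r
  proof -
    have d: "((\<lambda>r. 2 *\<^sub>R eap ?W (x 0 r) - u 0 r) has_vector_derivative 0) (at r within {0..1})" if "r \<in> {0..1}" for r
      using has_vector_derivative_diff[OF bounded_linear.has_vector_derivative[OF
          bounded_linear_compose[OF bounded_linear_scaleR_right eap.bounded_linear_right] dx[OF that, of 0], of 2 ?W] du[of 0 r]]
      by simp
    obtain c where c: "\<And>r. r \<in> {0..1} \<Longrightarrow> 2 *\<^sub>R eap ?W (x 0 r) - u 0 r = c"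
      using has_vector_derivative_zero_constant[OF _ d] by auto
    have "2 *\<^sub>R eap ?W (x 0 r) - u 0 r = - u 0 0"
      using c[OF r] c[of 0] init(2)[of 0] by (simp add: eap.zero_right)
    then show ?thesis by (simp add: algebra_simps)
  qed
  \<comment> \<open>By skewness and \<open>Wx\<close>, the W(\<theta>)-part of the derivative is - u
    \<epsilon> r \<bullet> (u 0 r - u 0 0). It cancels the remaining terms and only the contribution
    of \<epsilon> \<delta> survives.\<close>
  have "((\<lambda>r. u \<epsilon> r \<bullet> x 0 r - x \<epsilon> r \<bullet> u 0 0) has_vector_derivative
      2 * \<epsilon> * (eap ?V (u \<epsilon> r) \<bullet> x 0 r)) (at r within {0..1})" if r: "r \<in> {0..1}" for r
  proof -
    have "((\<lambda>r. u \<epsilon> r \<bullet> x 0 r - x \<epsilon> r \<bullet> u 0 0) has_vector_derivative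
      (u \<epsilon> r \<bullet> u 0 r + (2 *\<^sub>R eap ?W\<epsilon> (u \<epsilon> r)) \<bullet> x 0 r) - u \<epsilon> r \<bullet> u 0 0) (at r within {0..1})"
      by (intro has_vector_derivative_diff bounded_bilinear.has_vector_derivative[OF bounded_bilinear_inner]
          bounded_linear.has_vector_derivative[OF bounded_linear_inner_left] du dx r)
    moreover have "(2 *\<^sub>R eap ?W\<epsilon> (u \<epsilon> r)) \<bullet> x 0 r
        = 2 * \<epsilon> * (eap ?V (u \<epsilon> r) \<bullet> x 0 r) - u \<epsilon> r \<bullet> (2 *\<^sub>R eap ?W (x 0 r))"
      by (simp add: Wop_add Wop_scale eap.add_left eap.scaleR_left inner_add_left Wop_skew[OF U, of \<theta>])
    ultimately show ?thesis unfolding Wx[OF r] by (simp add: inner_diff_right)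
  qed
  then have "((\<lambda>r. 2 * \<epsilon> * (eap ?V (u \<epsilon> r) \<bullet> x 0 r)) has_integral
      ((u \<epsilon> 1 \<bullet> x 0 1 - x \<epsilon> 1 \<bullet> u 0 0) - (u \<epsilon> 0 \<bullet> x 0 0 - x \<epsilon> 0 \<bullet> u 0 0))) {0..1}"
    by (intro fundamental_theorem_of_calculus) auto
  from integral_unique[OF this]
  have "integral {0..1} (\<lambda>r. 2 * \<epsilon> * (eap ?V (u \<epsilon> r) \<bullet> x 0 r)) = u \<epsilon> 1 \<bullet> x 0 1 - x \<epsilon> 1 \<bullet> u 0 0"
    by (simp add: init)
  then show ?thesis using x1[of \<epsilon>] x1[of 0] u1[of \<epsilon>] init(1)[of 0] by simp
qed

text \<open>Divide \<open>flow_pairing\<close> by the perturbation size and let it tend to 0: F is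
  continuous and R vanishes at 0, so 2 F(0) is the derivative of R at 0. The area integral is
  thereby traded for \<theta>-derivatives of endpoint data.\<close>

lemma flow_area_derivative:
  fixes U :: "'m::finite \<Rightarrow> real^'q^'q" and \<theta> :: "real^'m" and \<eta> :: "real^'q"
  defines "\<zeta> \<equiv> eap (exp (- Wop U \<theta>)) \<eta>"
  assumes U: "step_two U"
    and d0: "((\<lambda>\<theta>. eap (sbes U 0 \<theta>) \<eta>) has_derivative D0) (at \<theta>)"
    and d1: "((\<lambda>\<theta>. eap (sbes U 1 \<theta>) \<eta>) has_derivative D1) (at \<theta>)"
  shows "2 * (integral {0..1} (\<lambda>r. bracket U (flow_x U (2 *\<^sub>R \<theta>) \<zeta> r) (flow_u U (2 *\<^sub>R \<theta>) \<zeta> r)) \<bullet> \<delta>)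
    = - ((eap (Wop U \<delta>) (eap (sbes U 1 \<theta>) \<eta>) + eap (Wop U \<theta>) (D1 \<delta>)) \<bullet> eap (sbes U 0 \<theta>) \<eta>
        - D0 \<delta> \<bullet> eap (Wop U \<theta>) (eap (sbes U 1 \<theta>) \<eta>))"
proof -
  let ?W = "Wop U \<theta>" and ?V = "Wop U \<delta>"
  let ?I0 = "eap (sbes U 0 \<theta>) \<eta>" and ?I1 = "eap (sbes U 1 \<theta>) \<eta>"
  define u where "u e = flow_u U (2 *\<^sub>R (\<theta> + e *\<^sub>R \<delta>)) (eap (exp (- Wop U (\<theta> + e *\<^sub>R \<delta>))) \<eta>)" for e
  define x where "x = flow_x U (2 *\<^sub>R \<theta>) \<zeta>"
  define F where "F e = integral {0..1} (\<lambda>r. eap ?V (u e r) \<bullet> x r)" for e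
  define R where "R e = eap (exp (Wop U (\<theta> + e *\<^sub>R \<delta>))) \<eta> \<bullet> ?I0
      - eap (sbes U 0 (\<theta> + e *\<^sub>R \<delta>)) \<eta> \<bullet> eap (exp (- ?W)) \<eta>" for e
  have R: "2 * e * F e = R e" for e
    using flow_pairing[OF U, of e \<delta> \<theta> \<eta>] by (simp add: F_def R_def u_def x_def \<zeta>_def)
  have u0: "u 0 = flow_u U (2 *\<^sub>R \<theta>) \<zeta>" by (simp add: u_def \<zeta>_def)
  have contF: "continuous_on {-1..1} F"
  proof -
    have "continuous_on ({-1..1} \<times> cbox 0 1) (\<lambda>(e, r). eap ?V (u e r) \<bullet> x r)"
    proof -
      have W: "continuous_on S (\<lambda>p :: real \<times> real. Wop U (g p))" if "continuous_on S g" for S g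
        using bounded_linear.continuous_on[OF bounded_linear_Wop that] .
      have c: "continuous_on S (\<lambda>p :: real \<times> real. exp (f p :: 'q endo))" if "continuous_on S f" for S f
        by (rule continuous_on_compose2[OF continuous_on_exp_algebra[of UNIV] that]) auto
      have x: "continuous_on ({-1..1} \<times> cbox 0 1) (\<lambda>p :: real \<times> real. x (snd p))"
        by (rule continuous_on_compose2[OF continuous_on_flow_x[of U "2 *\<^sub>R \<theta>" \<zeta>, folded x_def]])
           (auto intro!: continuous_intros)
      show ?thesis
        unfolding u_def flow_u_def case_prod_unfold
        by (intro continuous_on_inner x bounded_bilinear.continuous_on[OF bounded_bilinear_eap] c W
            continuous_intros)
    qed
    from integral_continuous_on_param[OF this] show ?thesis unfolding F_def by simp
  qed
  have dE: "((\<lambda>\<theta>. eap (exp (Wop U \<theta>)) \<eta>) has_derivative (\<lambda>h. D0 h + (eap (Wop U h) ?I1 + eap ?W (D1 h))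
      + (eap (Wop U h) ?I0 + eap ?W (D0 h)))) (at \<theta>)"
    unfolding eap_exp_sbes
    using has_derivative_add[OF has_derivative_add[OF d0 eap.FDERIV[OF Wop_has_derivative d1]] eap.FDERIV[OF Wop_has_derivative d0]]
    by (simp add: add.commute)
  have line: "((\<lambda>e. \<theta> + e *\<^sub>R \<delta>) has_derivative (\<lambda>h. h *\<^sub>R \<delta>)) (at 0)"
    by (auto intro!: derivative_eq_intros)
  have dE': "((\<lambda>e. eap (exp (Wop U (\<theta> + e *\<^sub>R \<delta>))) \<eta>) has_derivative (\<lambda>h. D0 (h *\<^sub>R \<delta>) + (eap (Wop U (h *\<^sub>R \<delta>)) ?I1 + eap ?W (D1 (h *\<^sub>R \<delta>)))
      + (eap (Wop U (h *\<^sub>R \<delta>)) ?I0 + eap ?W (D0 (h *\<^sub>R \<delta>))))) (at 0)"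
    by (rule has_derivative_compose[where f = "\<lambda>e. \<theta> + e *\<^sub>R \<delta>" and g = "\<lambda>\<theta>. eap (exp (Wop U \<theta>)) \<eta>", OF line])
       (use dE in simp)
  have d0': "((\<lambda>e. eap (sbes U 0 (\<theta> + e *\<^sub>R \<delta>)) \<eta>) has_derivative (\<lambda>h. D0 (h *\<^sub>R \<delta>))) (at 0)"
    by (rule has_derivative_compose[where f = "\<lambda>e. \<theta> + e *\<^sub>R \<delta>" and g = "\<lambda>\<theta>. eap (sbes U 0 \<theta>) \<eta>", OF line])
       (use d0 in simp)
  let ?R' = "(D0 \<delta> + (eap ?V ?I1 + eap ?W (D1 \<delta>)) + (eap ?V ?I0 + eap ?W (D0 \<delta>))) \<bullet> ?I0
      - D0 \<delta> \<bullet> eap (exp (- ?W)) \<eta>"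
  have lin: "D0 (h *\<^sub>R \<delta>) = h *\<^sub>R D0 \<delta>" "D1 (h *\<^sub>R \<delta>) = h *\<^sub>R D1 \<delta>" for h
    using has_derivative_bounded_linear[OF d0] has_derivative_bounded_linear[OF d1]
    by (simp_all add: linear_scale bounded_linear.linear)
  have "(R has_derivative (\<lambda>h. (D0 (h *\<^sub>R \<delta>) + (eap (Wop U (h *\<^sub>R \<delta>)) ?I1 + eap ?W (D1 (h *\<^sub>R \<delta>)))
      + (eap (Wop U (h *\<^sub>R \<delta>)) ?I0 + eap ?W (D0 (h *\<^sub>R \<delta>)))) \<bullet> ?I0 - D0 (h *\<^sub>R \<delta>) \<bullet> eap (exp (- ?W)) \<eta>)) (at 0)"
    unfolding R_def[abs_def]
    by (intro has_derivative_diff has_derivative_inner_left dE' d0')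
  moreover have "(D0 (h *\<^sub>R \<delta>) + (eap (Wop U (h *\<^sub>R \<delta>)) ?I1 + eap ?W (D1 (h *\<^sub>R \<delta>)))
      + (eap (Wop U (h *\<^sub>R \<delta>)) ?I0 + eap ?W (D0 (h *\<^sub>R \<delta>)))) \<bullet> ?I0 - D0 (h *\<^sub>R \<delta>) \<bullet> eap (exp (- ?W)) \<eta> = ?R' * h" for h
    unfolding lin Wop_scale eap.scaleR_left eap.scaleR_right
    by (simp add: inner_add_left inner_add_right algebra_simps)
  ultimately have "(R has_real_derivative ?R') (at 0)"
    by (simp add: has_field_derivative_def mult_commute_abs)
  moreover have "R 0 = 0" using R[of 0] by simp
  ultimately have "(\<lambda>e. R e / e) \<midarrow>0\<rightarrow> ?R'" unfolding DERIV_def by simp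
  moreover have "eventually (\<lambda>e. R e / e = 2 * F e) (at 0)"
    unfolding eventually_at_filter by (rule always_eventually) (auto simp: R[symmetric])
  ultimately have l1: "(\<lambda>e. 2 * F e) \<midarrow>0\<rightarrow> ?R'"
    using tendsto_cong[of "\<lambda>e. R e / e" "\<lambda>e. 2 * F e" "at 0"] by blast
  have "isCont F 0" by (rule continuous_on_interior[OF contF]) (simp add: interior_atLeastAtMost_real)
  then have l2: "(\<lambda>e. 2 * F e) \<midarrow>0\<rightarrow> 2 * F 0" unfolding isCont_def by (intro tendsto_intros)
  have "2 * F 0 = ?R'" by (rule LIM_unique[OF l2 l1])
  \<comment> \<open>By skewness \<open>?V ?I0\<close> is orthogonal to \<open>?I0\<close>, and the
    terms with \<open>?W (D0 \<delta>)\<close> and with \<open>?W ?I0\<close> cancel each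
    other.\<close>
  moreover have "?R' = (eap ?V ?I1 + eap ?W (D1 \<delta>)) \<bullet> ?I0 - D0 \<delta> \<bullet> eap ?W ?I1"
  proof -
    have "eap ?V ?I0 \<bullet> ?I0 = 0" using Wop_skew[OF U, of \<delta> ?I0 ?I0] by (simp add: inner_commute)
    moreover have "eap ?W (D0 \<delta>) \<bullet> ?I0 = - (D0 \<delta> \<bullet> eap ?W ?I0)" by (rule Wop_skew[OF U])
    ultimately show ?thesis
      unfolding eap_exp_sbes by (simp add: inner_add_left inner_add_right inner_diff_right)
  qed
  moreover have "integral {0..1} (\<lambda>r. bracket U (flow_x U (2 *\<^sub>R \<theta>) \<zeta> r) (flow_u U (2 *\<^sub>R \<theta>) \<zeta> r)) \<bullet> \<delta> = - F 0"
  proof -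
    have "continuous_on {0..1} (\<lambda>r. bracket U (flow_x U (2 *\<^sub>R \<theta>) \<zeta> r) (flow_u U (2 *\<^sub>R \<theta>) \<zeta> r))"
      by (intro bounded_bilinear.continuous_on[OF bounded_bilinear_bracket] continuous_on_flow_x continuous_on_flow_u)
    then have "(\<lambda>r. bracket U (flow_x U (2 *\<^sub>R \<theta>) \<zeta> r) (flow_u U (2 *\<^sub>R \<theta>) \<zeta> r)) integrable_on {0..1}"
      by (rule integrable_continuous_real)
    from integral_linear[OF this bounded_linear_inner_left[of \<delta>]]
    have "integral {0..1} (\<lambda>r. bracket U (flow_x U (2 *\<^sub>R \<theta>) \<zeta> r) (flow_u U (2 *\<^sub>R \<theta>) \<zeta> r)) \<bullet> \<delta>
      = integral {0..1} (\<lambda>r. bracket U (flow_x U (2 *\<^sub>R \<theta>) \<zeta> r) (flow_u U (2 *\<^sub>R \<theta>) \<zeta> r) \<bullet> \<delta>)"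
      by (simp add: o_def)
    also have "\<dots> = integral {0..1} (\<lambda>r. - (eap ?V (u 0 r) \<bullet> x r))"
    proof (intro integral_cong)
      have "bracket U a b \<bullet> \<delta> = - (eap ?V b \<bullet> a)" for a b
        by (simp only: bracket_inner Wop_skew[OF U, of \<delta> a b] inner_commute[of a])
      then show "bracket U (flow_x U (2 *\<^sub>R \<theta>) \<zeta> r) (flow_u U (2 *\<^sub>R \<theta>) \<zeta> r) \<bullet> \<delta> = - (eap ?V (u 0 r) \<bullet> x r)" for r
        by (simp only: u0 x_def)
    qed
    finally show ?thesis by (simp add: F_def)
  qed
  ultimately show ?thesis by simp
qed

section \<open>Critical points and geodesics\<close>

text \<open>The vectors D j \<delta> stay unknown. Differentiating the recurrence in \<theta>
  relates those at k, k+1 and k+2, and skewness of W(\<theta>) and W(\<delta>) turns the boundary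
  expression at k+1 into the one at k plus a multiple of one new summand.\<close>

lemma area_identity:
  fixes U :: "'m::finite \<Rightarrow> real^'q^'q" and \<theta> :: "real^'m" and \<eta> :: "real^'q"
  assumes U: "step_two U"
    and D: "\<And>j. ((\<lambda>\<theta>. eap (sbes U j \<theta>) \<eta>) has_derivative D j) (at \<theta>)"
  shows "4 * (snd (sr_exp U (eap (exp (- Wop U \<theta>)) \<eta>, 2 *\<^sub>R \<theta>)) \<bullet> \<delta>)
    = 2 * (\<Sum>j=1..k. eap (Wop U \<delta>) (eap (sbes U (j - 1) \<theta>) \<eta>) \<bullet> eap (sbes U j \<theta>) \<eta>)
      - ((eap (Wop U \<delta>) (eap (sbes U (Suc k) \<theta>) \<eta>) + eap (Wop U \<theta>) (D (Suc k) \<delta>)) \<bullet> eap (sbes U k \<theta>) \<eta>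
         - D k \<delta> \<bullet> eap (Wop U \<theta>) (eap (sbes U (Suc k) \<theta>) \<eta>))"
proof (induction k)
  case 0
  have "continuous_on {0..1} (\<lambda>r. bracket U (flow_x U \<tau> \<zeta> r) (flow_u U \<tau> \<zeta> r))" for \<tau> \<zeta>
    by (intro bounded_bilinear.continuous_on[OF bounded_bilinear_bracket] continuous_on_flow_x continuous_on_flow_u)
  then have "integral {0..1} (\<lambda>r. (1/2) *\<^sub>R bracket U (flow_x U \<tau> \<zeta> r) (flow_u U \<tau> \<zeta> r))
      = (1/2) *\<^sub>R integral {0..1} (\<lambda>r. bracket U (flow_x U \<tau> \<zeta> r) (flow_u U \<tau> \<zeta> r))" for \<tau> \<zeta>
    by (intro integral_cmul)
  then show ?case
    using flow_area_derivative[OF U D[of 0], of "D 1" \<delta>] D[of 1] by (simp add: sr_exp_flow[OF U])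
next
  case (Suc k)
  let ?I = "\<lambda>j. eap (sbes U j \<theta>) \<eta>" and ?W = "eap (Wop U \<theta>)" and ?V = "eap (Wop U \<delta>)"
  have rec: "eap (Wop U \<theta>) (eap (sbes U j \<theta>) \<eta>)
      = (2 * real j + 3) *\<^sub>R eap (sbes U (Suc j) \<theta>) \<eta> + eap (Wop U \<theta>) (eap (sbes U (Suc (Suc j)) \<theta>) \<eta>)" for j \<theta>
    unfolding eap_mult[symmetric] sbes_recurrence[of U \<theta> j] by (simp add: eap.add_left eap.scaleR_left)
  have "((\<lambda>\<theta>. eap (Wop U \<theta>) (eap (sbes U k \<theta>) \<eta>)) has_derivative
      (\<lambda>h. ?W (D k h) + eap (Wop U h) (?I k))) (at \<theta>)"
    by (rule eap.FDERIV[OF Wop_has_derivative D])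
  moreover have "((\<lambda>\<theta>. eap (Wop U \<theta>) (eap (sbes U k \<theta>) \<eta>)) has_derivative
      (\<lambda>h. (2 * real k + 3) *\<^sub>R D (Suc k) h + (?W (D (Suc (Suc k)) h) + eap (Wop U h) (?I (Suc (Suc k)))))) (at \<theta>)"
    unfolding rec[of _ k]
    by (intro has_derivative_add has_derivative_scaleR_right D eap.FDERIV[OF Wop_has_derivative D])
  ultimately have "(\<lambda>h. ?W (D k h) + eap (Wop U h) (?I k))
      = (\<lambda>h. (2 * real k + 3) *\<^sub>R D (Suc k) h + (?W (D (Suc (Suc k)) h) + eap (Wop U h) (?I (Suc (Suc k)))))"
    by (rule has_derivative_unique)
  from fun_cong[OF this, of \<delta>]
  have a: "?V (?I (Suc (Suc k))) + ?W (D (Suc (Suc k)) \<delta>) = ?V (?I k) + ?W (D k \<delta>) - (2 * real k + 3) *\<^sub>R D (Suc k) \<delta>"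
    by (simp add: algebra_simps)
  have b: "?W (?I (Suc (Suc k))) = ?W (?I k) - (2 * real k + 3) *\<^sub>R ?I (Suc k)"
    using rec[of \<theta> k] by simp
  have "?V (?I (Suc k)) \<bullet> ?I k = - (?V (?I k) \<bullet> ?I (Suc k))"
    using Wop_skew[OF U, of \<delta> "?I (Suc k)" "?I k"] by (simp only: inner_commute)
  moreover have "?W (D (Suc k) \<delta>) \<bullet> ?I k = - (D (Suc k) \<delta> \<bullet> ?W (?I k))" by (rule Wop_skew[OF U])
  moreover have "?W (D k \<delta>) \<bullet> ?I (Suc k) = - (D k \<delta> \<bullet> ?W (?I (Suc k)))" by (rule Wop_skew[OF U])
  ultimately have "(?V (?I (Suc (Suc k))) + ?W (D (Suc (Suc k)) \<delta>)) \<bullet> ?I (Suc k) - D (Suc k) \<delta> \<bullet> ?W (?I (Suc (Suc k)))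
      = 2 * (?V (?I k) \<bullet> ?I (Suc k)) + ((?V (?I (Suc k)) + ?W (D (Suc k) \<delta>)) \<bullet> ?I k - D k \<delta> \<bullet> ?W (?I (Suc k)))"
    unfolding a b by (simp add: inner_add_left inner_diff_left inner_diff_right)
  then show ?case using Suc by simp
qed

text \<open>With n = W^k \<eta> the curve required by \<open>phi_has_derivative\<close> runs through
  i_k(W) \<eta>, so its derivatives are those occurring in \<open>area_identity\<close>.\<close>

lemma bop_hop_power:
  "eap (bop U k \<theta>) (eap (Wop U \<theta> ^ k) v) = eap (sbes U k \<theta>) v"
  "eap (hop U k \<theta>) (eap (Wop U \<theta> ^ k) v) = eap (Wop U \<theta>) (eap (sbes U (Suc k) \<theta>) v)"
proof -
  show "eap (bop U k \<theta>) (eap (Wop U \<theta> ^ k) v) = eap (sbes U k \<theta>) v"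
    by (simp only: eap_mult[symmetric] bop_commute_Wop_power sbes_def)
  have "hop U k \<theta> * Wop U \<theta> ^ k = (Wop U \<theta>)\<^sup>2 * (Wop U \<theta> ^ k * bop U (Suc k) \<theta>)"
    by (simp only: hop_def mult.assoc bop_commute_Wop_power)
  also have "\<dots> = Wop U \<theta> * sbes U (Suc k) \<theta>"
    by (simp add: sbes_def mult.assoc power2_eq_square)
  finally show "eap (hop U k \<theta>) (eap (Wop U \<theta> ^ k) v) = eap (Wop U \<theta>) (eap (sbes U (Suc k) \<theta>) v)"
    by (simp only: eap_mult[symmetric])
qed

lemma sbes_three_term:
  assumes "1 \<le> j"
  shows "eap (Wop U \<theta>) (eap (sbes U (j - 1) \<theta>) \<eta>)
      = (2 * real j + 1) *\<^sub>R eap (sbes U j \<theta>) \<eta> + eap (Wop U \<theta>) (eap (sbes U (Suc j) \<theta>) \<eta>)"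
proof -
  obtain i where "j = Suc i" using assms by (cases j) auto
  then show ?thesis
    unfolding eap_mult[symmetric] by (simp only: diff_Suc_1 sbes_recurrence[of U \<theta> i]) (simp add: eap.add_left eap.scaleR_left add.commute)
qed

abbreviation ssign :: "nat \<Rightarrow> real" where
  "ssign j \<equiv> (-1) ^ j / sqrt 2"

text \<open>The alternating sign turns the recurrence into the block equations. The scalar c is free
  because the equations are homogeneous: it is 1 / sqrt 2 for the gradient and 1 in the solution of
  the equations.\<close>

lemma crit_term_sbes:
  assumes S: "\<And>j. j \<le> k \<Longrightarrow> S j = (c * (-1) ^ j) *\<^sub>R eap (sbes U j \<theta>) \<eta>"
    and M: "M = (c * (-1) ^ k) *\<^sub>R eap (Wop U \<theta>) (eap (sbes U (Suc k) \<theta>) \<eta>)" and j: "j \<in> {1..k}"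
  shows "crit_term U k \<theta> M S j = 0"
proof -
  have T: "(if j < k then eap (Wop U \<theta>) (S (Suc j)) else - M)
      = (- (c * (-1) ^ j)) *\<^sub>R eap (Wop U \<theta>) (eap (sbes U (Suc j) \<theta>) \<eta>)"
    using j by (auto simp: S M eap.scaleR_right eap.minus_right)
  have s: "(-1::real) ^ (j - 1) = - ((-1) ^ j)" using j by (cases j) auto
  have "S (j - 1) = (- (c * (-1) ^ j)) *\<^sub>R eap (sbes U (j - 1) \<theta>) \<eta>"
  proof -
    have "j - 1 \<le> k" using j by auto
    then show ?thesis by (simp only: S s) simp
  qed
  moreover have "eap (Wop U \<theta>) (eap (sbes U (j - 1) \<theta>) \<eta>)
      = (2 * real j + 1) *\<^sub>R eap (sbes U j \<theta>) \<eta> + eap (Wop U \<theta>) (eap (sbes U (Suc j) \<theta>) \<eta>)"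
    by (rule sbes_three_term) (use j in simp)
  moreover have "S j = (c * (-1) ^ j) *\<^sub>R eap (sbes U j \<theta>) \<eta>" using j by (simp add: S)
  ultimately show ?thesis
    unfolding crit_term_def T by (simp only: eap.scaleR_right) (simp add: algebra_simps)
qed

text \<open>At a point built from \<eta> the only obstruction to criticality is the mismatch in the
  t-component. Both directions of the correspondence are read off from this.\<close>

lemma phi_gradient:
  fixes U :: "'m::finite \<Rightarrow> real^'q^'q" and s :: "(real^'q)^'k::{finite,linorder}"
  assumes U: "step_two U" and k: "k = CARD('k)" and inj: "\<And>v. eap (bop U k \<theta>) v = 0 \<Longrightarrow> v = 0"
    and s: "\<And>j. j \<in> {1..k} \<Longrightarrow> blk s j = ssign j *\<^sub>R eap (sbes U j \<theta>) \<eta>"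
    and g: "fst g = eap (sbes U 0 \<theta>) \<eta>"
  shows "((\<lambda>(s', \<theta>'). phi U g s' \<theta>') has_derivative
    (\<lambda>(ds, d\<theta>). 4 * ((snd g - snd (sr_exp U (eap (exp (- Wop U \<theta>)) \<eta>, 2 *\<^sub>R \<theta>))) \<bullet> d\<theta>))) (at (s, \<theta>))"
proof -
  have k1: "1 \<le> k" using k by (simp add: Suc_le_eq)
  have "\<exists>D. ((\<lambda>\<theta>. eap (sbes U j \<theta>) \<eta>) has_derivative D) (at \<theta>)" for j
    using sbes_has_derivative_ex[of U j \<theta>] bounded_linear.has_derivative[OF eap.bounded_linear_left] by blast
  then obtain D where D: "\<And>j. ((\<lambda>\<theta>. eap (sbes U j \<theta>) \<eta>) has_derivative D j) (at \<theta>)" by metis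
  let ?I = "\<lambda>j. eap (sbes U j \<theta>) \<eta>" and ?W = "eap (Wop U \<theta>)" and ?c = "ssign k"
  define n where "n \<theta>' = ?c *\<^sub>R eap (Wop U \<theta>' ^ k) \<eta>" for \<theta>'
  have N: "eap (bop U k \<theta>') (n \<theta>') = ?c *\<^sub>R eap (sbes U k \<theta>') \<eta>"
    and M: "eap (hop U k \<theta>') (n \<theta>') = ?c *\<^sub>R eap (Wop U \<theta>') (eap (sbes U (Suc k) \<theta>') \<eta>)" for \<theta>'
    by (simp_all only: n_def eap.scaleR_right bop_hop_power)
  have dN: "((\<lambda>\<theta>'. eap (bop U k \<theta>') (n \<theta>')) has_derivative (\<lambda>h. ?c *\<^sub>R D k h)) (at \<theta>)"
    unfolding N by (intro has_derivative_scaleR_right D)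
  have dM: "((\<lambda>\<theta>'. eap (hop U k \<theta>') (n \<theta>')) has_derivative
      (\<lambda>h. ?c *\<^sub>R (?W (D (Suc k) h) + eap (Wop U h) (?I (Suc k))))) (at \<theta>)"
    unfolding M by (intro has_derivative_scaleR_right eap.FDERIV[OF Wop_has_derivative D])
  have sk: "blk s k = eap (bop U k \<theta>) (n \<theta>)" using s[of k] k1 by (simp add: N)
  have S: "seqS (fst g) s j = (1 / sqrt 2 * (-1) ^ j) *\<^sub>R ?I j" if "j \<le> k" for j
    using that s[of j] g by (auto simp: seqS_def)
  have crit: "crit_term U k \<theta> (eap (hop U k \<theta>) (n \<theta>)) (seqS (fst g) s) j = 0" if "j \<in> {1..k}" for j
    by (rule crit_term_sbes[OF S _ that]) (simp_all add: M)
  \<comment> \<open>The factor -1/2 turns the 4 of the gradient into the -2 that matches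
    \<open>area_identity\<close>.\<close>
  have sg: "ssign (j - 1) * ssign j = - (1/2)" if "1 \<le> j" for j
    using that by (cases j) (auto simp: power_mult_distrib[symmetric])
  have cc: "?c * ?c = 1/2" by (simp add: power_mult_distrib[symmetric])
  have "4 * (\<Sum>j=1..k. blk ds j \<bullet> crit_term U k \<theta> (eap (hop U k \<theta>) (n \<theta>)) (seqS (fst g) s) j)
      + 4 * (snd g \<bullet> d\<theta> + (\<Sum>j=1..k. eap (Wop U d\<theta>) (seqS (fst g) s (j - 1)) \<bullet> seqS (fst g) s j))
      + 2 * ((?c *\<^sub>R (?W (D (Suc k) d\<theta>) + eap (Wop U d\<theta>) (?I (Suc k)))) \<bullet> blk s k - eap (hop U k \<theta>) (n \<theta>) \<bullet> (?c *\<^sub>R D k d\<theta>))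
    = 4 * ((snd g - snd (sr_exp U (eap (exp (- Wop U \<theta>)) \<eta>, 2 *\<^sub>R \<theta>))) \<bullet> d\<theta>)" for ds :: "(real^'q)^'k::{finite,linorder}" and d\<theta>
  proof -
    have 1: "(\<Sum>j=1..k. blk ds j \<bullet> crit_term U k \<theta> (eap (hop U k \<theta>) (n \<theta>)) (seqS (fst g) s) j) = 0"
      by (intro sum.neutral) (simp add: crit)
    have 2: "(\<Sum>j=1..k. eap (Wop U d\<theta>) (seqS (fst g) s (j - 1)) \<bullet> seqS (fst g) s j)
        = - (1/2) * (\<Sum>j=1..k. eap (Wop U d\<theta>) (?I (j - 1)) \<bullet> ?I j)"
      unfolding sum_distrib_left
    proof (intro sum.cong refl)
      fix j assume j: "j \<in> {1..k}"
      have "eap (Wop U d\<theta>) (seqS (fst g) s (j - 1)) \<bullet> seqS (fst g) s j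
          = (ssign (j - 1) * ssign j) * (eap (Wop U d\<theta>) (?I (j - 1)) \<bullet> ?I j)"
      proof -
        have le: "j - 1 \<le> k" "j \<le> k" using j by auto
        show ?thesis unfolding S[OF le(1)] S[OF le(2)] eap.scaleR_right inner_scaleR_left inner_scaleR_right by simp
      qed
      then show "eap (Wop U d\<theta>) (seqS (fst g) s (j - 1)) \<bullet> seqS (fst g) s j = - (1/2) * (eap (Wop U d\<theta>) (?I (j - 1)) \<bullet> ?I j)"
        using sg[of j] j by (simp only: atLeastAtMost_iff)
    qed
    have 3: "(?c *\<^sub>R (?W (D (Suc k) d\<theta>) + eap (Wop U d\<theta>) (?I (Suc k)))) \<bullet> blk s k - eap (hop U k \<theta>) (n \<theta>) \<bullet> (?c *\<^sub>R D k d\<theta>)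
        = (1/2) * ((eap (Wop U d\<theta>) (?I (Suc k)) + ?W (D (Suc k) d\<theta>)) \<bullet> ?I k - D k d\<theta> \<bullet> ?W (?I (Suc k)))"
    proof -
      have "(?c *\<^sub>R (?W (D (Suc k) d\<theta>) + eap (Wop U d\<theta>) (?I (Suc k)))) \<bullet> blk s k - eap (hop U k \<theta>) (n \<theta>) \<bullet> (?c *\<^sub>R D k d\<theta>)
        = (?c * ?c) * ((?W (D (Suc k) d\<theta>) + eap (Wop U d\<theta>) (?I (Suc k))) \<bullet> ?I k) - (?c * ?c) * (?W (?I (Suc k)) \<bullet> D k d\<theta>)"
        unfolding sk N M inner_scaleR_left inner_scaleR_right by (simp only: mult.assoc)
      then show ?thesis unfolding cc by (simp add: algebra_simps inner_commute)
    qed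
    show ?thesis
      unfolding 1 2 3 inner_diff_left using area_identity[OF U D, of d\<theta> k] by simp
  qed
  then show ?thesis using phi_has_derivative[OF U k inj dN dM sk, of g] by simp
qed

section \<open>Recovering \<eta> from a critical point\<close>

lemma linear_image_eq_of_inj:
  fixes f :: "'a::euclidean_space \<Rightarrow> 'a"
  assumes f: "linear f" and R: "subspace R" "f ` R \<subseteq> R" and inj: "\<And>v. v \<in> R \<Longrightarrow> f v = 0 \<Longrightarrow> v = 0"
  shows "f ` R = R"
proof (rule subspace_dim_equal)
  show "subspace (f ` R)" by (rule linear_subspace_image[OF f R(1)])
  have "inj_on f (span R)"
  proof (rule inj_onI)
    fix x y assume xy: "x \<in> span R" "y \<in> span R" "f x = f y"
    then have "x - y \<in> R" using R(1) by (metis span_eq_iff subspace_diff)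
    then show "x = y" using inj[of "x - y"] xy(3) by (simp add: linear_diff[OF f])
  qed
  then show "dim (f ` R) \<ge> dim R" using dim_image_eq[OF f] by simp
qed (use R in auto)

text \<open>Pairing W^2 v with v gives - |W v|^2. Consequently W is injective on its own
  range.\<close>

lemma Wop_sq_zero:
  assumes U: "step_two U" and "eap (Wop U \<theta>) (eap (Wop U \<theta>) v) = 0"
  shows "eap (Wop U \<theta>) v = 0"
  using Wop_skew[OF U, of \<theta> v "eap (Wop U \<theta>) v"] assms(2) by simp

lemma Wop_power_zero:
  assumes U: "step_two U" and "eap (Wop U \<theta> ^ Suc n) v = 0"
  shows "eap (Wop U \<theta>) v = 0"
  using assms(2)
proof (induction n)
  case (Suc n)
  have "eap (Wop U \<theta>) (eap (Wop U \<theta>) (eap (Wop U \<theta> ^ n) v)) = 0" using Suc.prems by simp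
  then have "eap (Wop U \<theta> ^ Suc n) v = 0" using Wop_sq_zero[OF U] by simp
  then show ?case by (rule Suc.IH)
qed simp

text \<open>On the kernel of W only the values i_0(0) = 1 and i_j(0) = 0 for j \<ge> 1
  remain.\<close>

lemma sbes_kernel:
  assumes "eap (Wop U \<theta>) v = 0"
  shows "eap (sbes U 0 \<theta>) v = v" "eap (sbes U (Suc j) \<theta>) v = 0"
proof -
  have "(Wop U \<theta>)\<^sup>2 = Wop U \<theta> * Wop U \<theta>" by (simp add: power2_eq_square)
  then have w: "eap ((Wop U \<theta>)\<^sup>2) v = 0" using assms by (simp add: eap.zero_right)
  have "(\<lambda>n. besc 0 n *\<^sub>R eap (((Wop U \<theta>)\<^sup>2) ^ n) v) = (\<lambda>n. if n = 0 then v else 0)"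
  proof
    show "besc 0 n *\<^sub>R eap (((Wop U \<theta>)\<^sup>2) ^ n) v = (if n = 0 then v else 0)" for n
      by (cases n) (simp_all only: power_Suc2 eap_mult w, simp_all add: besc_def eap.zero_right)
  qed
  then have "(\<lambda>n. if n = 0 then v else 0) sums eap (bop U 0 \<theta>) v" using eap_bes_sums[of 0 "(Wop U \<theta>)\<^sup>2" v] by simp
  moreover have "(\<lambda>n. if n = 0 then v else 0) sums v" using sums_single[of 0 "\<lambda>_. v"] by simp
  ultimately have "eap (bop U 0 \<theta>) v = v" by (rule sums_unique2)
  then show "eap (sbes U 0 \<theta>) v = v" by (simp add: sbes_def)
  have "eap (sbes U (Suc j) \<theta>) v = eap (bop U (Suc j) \<theta> * Wop U \<theta> ^ Suc j) v"
    by (simp only: sbes_def bop_commute_Wop_power)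
  also have "\<dots> = eap (bop U (Suc j) \<theta>) (eap (Wop U \<theta> ^ j) (eap (Wop U \<theta>) v))"
    by (simp only: power_Suc2 eap_mult)
  finally show "eap (sbes U (Suc j) \<theta>) v = 0" by (simp add: assms eap.zero_right)
qed

text \<open>The vanishing of i_k(W) v puts v into the kernel of W, where i_0(W) is the identity.
  This gives injectivity of the correspondence: x and the last block already determine
  \<eta>.\<close>

lemma sbes_jointly_injective:
  assumes U: "step_two U" and inj: "\<And>v. eap (bop U k \<theta>) v = 0 \<Longrightarrow> v = 0" and k: "1 \<le> k"
    and z: "eap (sbes U 0 \<theta>) v = 0" "eap (sbes U k \<theta>) v = 0"
  shows "v = 0"
proof -
  have "eap (Wop U \<theta> ^ k) v = 0" using inj z(2) by (simp flip: bop_hop_power(1))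
  then have "eap (Wop U \<theta>) v = 0" using Wop_power_zero[OF U] k by (cases k) (auto simp del: power_Suc)
  then show ?thesis using sbes_kernel(1) z(1) by metis
qed

text \<open>On the range of \<open>W\<close>, where \<open>W\<close> is invertible, \<open>\<eta>\<close> is determined by \<open>S\<^sub>k\<close>; its component in the
  kernel of \<open>W\<close> is that of \<open>S\<^sub>0\<close>. The remaining \<open>S\<^sub>j\<close> follow by downward recurrence.\<close>

lemma crit_term_solution:
  assumes U: "step_two U" and inj: "\<And>v. eap (bop U k \<theta>) v = 0 \<Longrightarrow> v = 0" and k: "1 \<le> k"
    and Sk: "S k = eap (bop U k \<theta>) y"
    and crit: "\<And>j. j \<in> {1..k} \<Longrightarrow> crit_term U k \<theta> (eap (hop U k \<theta>) y) S j = 0"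
  shows "\<exists>\<eta>. \<forall>j\<le>k. S j = (-1) ^ j *\<^sub>R eap (sbes U j \<theta>) \<eta>"
proof -
  let ?W = "eap (Wop U \<theta>)" and ?a = "eap (bop U k \<theta>)"
  define R where "R = range ?W"
  have lin: "linear (eap A)" for A using eap.bounded_linear_right bounded_linear.linear by blast
  have subR: "subspace R" unfolding R_def by (rule linear_subspace_image[OF lin subspace_UNIV])
  have WR: "?W v \<in> R" for v by (simp add: R_def)
  have inR: "v = 0" if "v \<in> R" "?W v = 0" for v
    using that Wop_sq_zero[OF U] by (auto simp: R_def)
  have RW: "\<exists>z\<in>R. ?W z = v" if "v \<in> R" for v
  proof -
    have "?W ` R = R" by (rule linear_image_eq_of_inj[OF lin subR]) (use WR inR in auto)
    then show ?thesis using that by (metis imageE)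
  qed
  have RWn: "\<exists>z\<in>R. eap (Wop U \<theta> ^ n) z = v" if "v \<in> R" for n v
    using that
  proof (induction n arbitrary: v)
    case (Suc n)
    obtain z where z: "z \<in> R" "?W z = v" using RW[OF Suc.prems] by blast
    obtain z' where z': "z' \<in> R" "eap (Wop U \<theta> ^ n) z' = z" using Suc.IH[OF z(1)] by blast
    show ?case using z(2) z' by (intro bexI[of _ z']) auto
  qed simp
  have "?a ` R \<subseteq> R"
  proof
    fix v assume "v \<in> ?a ` R"
    then obtain w where "v = eap (bop U k \<theta> * Wop U \<theta>) w" by (auto simp: R_def)
    then show "v \<in> R" by (simp add: bop_commute_Wop R_def)
  qed
  then have aR: "?a ` R = R" by (rule linear_image_eq_of_inj[OF lin subR]) (rule inj)
  \<comment> \<open>The j-th equation expresses S j through vectors in the range of W, as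
    \<open>hop\<close> begins with W^2. Only S 0 may have a kernel component.\<close>
  have SR: "S j \<in> R" if j: "j \<in> {1..k}" for j
  proof -
    have T: "(if j < k then ?W (S (Suc j)) else - eap (hop U k \<theta>) y) \<in> R"
      using subspace_neg[OF subR WR] WR by (auto simp: hop_def power2_eq_square)
    have "(2 * real j + 1) *\<^sub>R S j = (if j < k then ?W (S (Suc j)) else - eap (hop U k \<theta>) y) - ?W (S (j - 1))"
      using crit[OF j] by (simp add: crit_term_def algebra_simps)
    then have "(2 * real j + 1) *\<^sub>R S j \<in> R" using subspace_diff[OF subR T WR] by simp
    then have "(1 / (2 * real j + 1)) *\<^sub>R ((2 * real j + 1) *\<^sub>R S j) \<in> R" by (rule subspace_scale[OF subR])
    moreover have "2 * real j + 1 \<noteq> 0" by simp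
    ultimately show ?thesis by simp
  qed
  \<comment> \<open>S k lies in the range, which \<open>bop\<close> maps onto itself; injectivity on
    the whole space identifies y with the preimage found there.\<close>
  have "y \<in> R"
  proof -
    have "S k \<in> ?a ` R" using SR[of k] k aR by simp
    then obtain w where "w \<in> R" "?a y = ?a w" using Sk by auto
    then show ?thesis using inj[of "y - w"] by (simp add: eap.diff_right)
  qed
  then obtain z where z: "z \<in> R" "eap (Wop U \<theta> ^ k) z = y" using RWn by blast
  obtain xR xK where x: "xR \<in> span R" "\<And>w. w \<in> span R \<Longrightarrow> orthogonal xK w" "S 0 = xR + xK"
    using orthogonal_subspace_decomp_exists[of R "S 0"] by metis
  have spanR: "span R = R" using subR by (simp add: span_eq_iff)
  \<comment> \<open>For skew W, a vector orthogonal to the range lies in the kernel.\<close>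
  have xK: "?W xK = 0"
  proof -
    have "xK \<bullet> ?W (?W xK) = 0" using x(2) WR spanR by (simp add: orthogonal_def)
    then have "?W xK \<bullet> ?W xK = 0" by (simp add: Wop_skew[OF U, of \<theta> xK])
    then show ?thesis by simp
  qed
  \<comment> \<open>The sign on z cancels the one in J k, and xK is seen by J 0 only.\<close>
  define \<eta> where "\<eta> = (-1) ^ k *\<^sub>R z + xK"
  define J where "J j = (-1) ^ j *\<^sub>R eap (sbes U j \<theta>) \<eta>" for j
  have sb: "eap (sbes U (Suc j) \<theta>) \<eta> = (-1) ^ k *\<^sub>R eap (sbes U (Suc j) \<theta>) z" for j
    by (simp add: \<eta>_def eap.add_right eap.scaleR_right sbes_kernel[OF xK])
  have kSuc: "k = Suc (k - 1)" using k by simp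
  have ss: "(-1::real) ^ k * (-1) ^ k = 1" by (simp flip: power_mult_distrib)
  have Jk: "J k = S k"
  proof -
    have "eap (sbes U k \<theta>) \<eta> = (-1) ^ k *\<^sub>R eap (sbes U k \<theta>) z" using sb[of "k - 1"] k by simp
    then show ?thesis
      by (simp add: J_def ss Sk z(2)[symmetric] bop_hop_power(1))
  qed
  have M: "eap (hop U k \<theta>) y = (-1) ^ k *\<^sub>R ?W (eap (sbes U (Suc k) \<theta>) \<eta>)"
    unfolding sb z(2)[symmetric] bop_hop_power(2) by (simp add: eap.scaleR_right ss)
  have Jcrit: "crit_term U k \<theta> (eap (hop U k \<theta>) y) J j = 0" if "j \<in> {1..k}" for j
    by (rule crit_term_sbes[where c = 1, OF _ _ that]) (simp_all add: J_def M)
  have d: "(2 * real j + 1) *\<^sub>R (S j - J j) + ?W (S (j - 1) - J (j - 1))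
      = (if j < k then ?W (S (Suc j) - J (Suc j)) else 0)" if "j \<in> {1..k}" for j
    using crit[OF that] Jcrit[OF that] by (auto simp: crit_term_def eap.diff_right algebra_simps)
  have JR: "J j \<in> R" if "1 \<le> j" for j
  proof -
    obtain i where "j = Suc i" using \<open>1 \<le> j\<close> by (cases j) auto
    then have "eap (sbes U j \<theta>) \<eta> = ?W (eap (Wop U \<theta> ^ i * bop U j \<theta>) \<eta>)" by (simp add: sbes_def)
    then show ?thesis unfolding J_def using WR subspace_scale[OF subR] by metis
  qed
  \<comment> \<open>Downward induction: once the terms from index j on agree, equation j gives W (S
    (j-1) - J (j-1)) = 0. For j - 1 \<ge> 1 both vectors lie in the range, where W is injective; for
    j = 1 this kernel statement is what the case of S 0 uses below.\<close>
  have main: "i < k \<Longrightarrow> S (k - i) = J (k - i) \<and> ?W (S (k - Suc i) - J (k - Suc i)) = 0" for i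
  proof (induction i)
    case 0
    then show ?case using d[of k] k Jk by simp
  next
    case (Suc i)
    let ?j = "k - Suc i"
    have j: "?j \<in> {1..k}" "?j < k" "Suc ?j = k - i" using Suc.prems by auto
    have "S ?j - J ?j \<in> R" using j by (intro subspace_diff[OF subR] SR JR) auto
    then have e: "S ?j - J ?j = 0" by (rule inR) (use Suc in simp)
    then have "?W (S (?j - 1) - J (?j - 1)) = 0"
      using d[OF j(1)] j Suc by (simp add: eap.zero_right)
    then show ?case using e by simp
  qed
  have "S 0 = J 0"
  proof -
    have W0: "?W (S 0 - J 0) = 0" using main[of "k - 1"] k by simp
    have "J 0 = (-1) ^ k *\<^sub>R eap (sbes U 0 \<theta>) z + xK"
      by (simp add: J_def \<eta>_def eap.add_right eap.scaleR_right sbes_kernel[OF xK])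
    moreover have "eap (sbes U 0 \<theta>) z \<in> R"
    proof -
      obtain w where "z = ?W w" using z(1) by (auto simp: R_def)
      then have "eap (sbes U 0 \<theta>) z = eap (sbes U 0 \<theta> * Wop U \<theta>) w" by simp
      then show ?thesis by (simp add: sbes_commute_Wop R_def)
    qed
    ultimately have "S 0 - J 0 \<in> R"
      using x(1,3) spanR by (auto intro!: subspace_diff[OF subR] subspace_scale[OF subR])
    from inR[OF this W0] show ?thesis by simp
  qed
  moreover have "S j = J j" if "1 \<le> j" "j \<le> k" for j
    using main[of "k - j"] that by simp
  ultimately have "S j = J j" if "j \<le> k" for j using that by (cases "j = 0") auto
  then show ?thesis unfolding J_def by blast
qed


theorem mainTheorem6:
  fixes U :: "'m::finite \<Rightarrow> real^'q^'q"
    and k :: nat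
    and A :: "(('q,'m) grp \<times> (real^'q) \<times> (real^'m)) set"
    and B :: "(('q,'m) grp \<times> ((real^'q)^'k::{finite,linorder}) \<times> (real^'m)) set"
  assumes "step_two U"
    and "k = CARD('k)"
    and "A = {(g, \<zeta>, \<theta>). \<theta> \<in> Omega U k \<and> sr_exp U (\<zeta>, 2 *\<^sub>R \<theta>) = g \<and> g \<noteq> gid}"
    and "B = {(g, s, \<theta>). g \<noteq> gid \<and> \<theta> \<in> Omega U k \<and>
                GDERIV (\<lambda>(s', \<theta>'). phi U g s' \<theta>') (s, \<theta>) :> 0}"
  shows "\<exists>F. bij_betw F A B \<and>
           (\<forall>g \<zeta> \<theta>. (g, \<zeta>, \<theta>) \<in> A \<longrightarrow> (\<exists>s. F (g, \<zeta>, \<theta>) = (g, s, \<theta>)))"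
proof -
  note U = assms(1) and k = assms(2) and A = assms(3) and B = assms(4)
  have k1: "1 \<le> k" using k by (simp add: Suc_le_eq)
  define sol :: "real^'m \<Rightarrow> real^'q \<Rightarrow> (real^'q)^'k::{finite,linorder}" where
    "sol \<theta> \<eta> = (SOME s. \<forall>j\<in>{1..k}. blk s j = ssign j *\<^sub>R eap (sbes U j \<theta>) \<eta>)" for \<theta> \<eta>
  have sol: "blk (sol \<theta> \<eta>) j = ssign j *\<^sub>R eap (sbes U j \<theta>) \<eta>" if "j \<in> {1..k}" for \<theta> \<eta> j
    using someI_ex[OF ex_blk[where 'k = 'k, of "\<lambda>j. ssign j *\<^sub>R eap (sbes U j \<theta>) \<eta>"]] that
    unfolding sol_def k by blast
  \<comment> \<open>exp(W) \<zeta> is the velocity at the midpoint r = 1/2, the centre of the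
    expansion in 2r - 1.\<close>
  define F where "F = (\<lambda>(g :: ('q,'m) grp, \<zeta>, \<theta>). (g, sol \<theta> (eap (exp (Wop U \<theta>)) \<zeta>), \<theta>))"
  have canc: "eap (exp (- Wop U \<theta>)) (eap (exp (Wop U \<theta>)) \<zeta>) = \<zeta>"
    "eap (exp (Wop U \<theta>)) (eap (exp (- Wop U \<theta>)) \<zeta>) = \<zeta>" for \<theta> \<zeta>
    unfolding eap_mult[symmetric] exp_minus_cancel by simp_all
  have fst_exp: "fst (sr_exp U (eap (exp (- Wop U \<theta>)) \<eta>, 2 *\<^sub>R \<theta>)) = eap (sbes U 0 \<theta>) \<eta>" for \<theta> \<eta>
    by (simp add: sr_exp_flow[OF U] flow_x_end)
  have inj: "v = 0" if "\<theta> \<in> Omega U k" "eap (bop U k \<theta>) v = 0" for \<theta> v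
    using Omega_imp_inj[OF U that] .
  have maps: "F (g, \<zeta>, \<theta>) \<in> B" if "(g, \<zeta>, \<theta>) \<in> A" for g \<zeta> \<theta>
  proof -
    let ?\<eta> = "eap (exp (Wop U \<theta>)) \<zeta>"
    have a: "\<theta> \<in> Omega U k" "sr_exp U (\<zeta>, 2 *\<^sub>R \<theta>) = g" "g \<noteq> gid" using that by (auto simp: A)
    have "fst g = eap (sbes U 0 \<theta>) ?\<eta>" using fst_exp[of \<theta> ?\<eta>] a(2) by (simp add: canc)
    from phi_gradient[OF U k inj[OF a(1)] sol this]
    have "((\<lambda>(s', \<theta>'). phi U g s' \<theta>') has_derivative (\<lambda>(ds, d\<theta>). 0)) (at (sol \<theta> ?\<eta>, \<theta>))"
      by (simp add: canc a(2))
    then have "GDERIV (\<lambda>(s', \<theta>'). phi U g s' \<theta>') (sol \<theta> ?\<eta>, \<theta>) :> 0"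
      by (simp add: gderiv_def case_prod_unfold)
    then show ?thesis using a by (simp add: F_def B)
  qed
  have surj: "\<exists>\<zeta>. (g, \<zeta>, \<theta>) \<in> A \<and> F (g, \<zeta>, \<theta>) = (g, s, \<theta>)" if "(g, s, \<theta>) \<in> B" for g s \<theta>
  proof -
    let ?S = "seqS (fst g) s"
    have b: "\<theta> \<in> Omega U k" "g \<noteq> gid" and grad: "((\<lambda>(s', \<theta>'). phi U g s' \<theta>') has_derivative (\<lambda>h. 0)) (at (s, \<theta>))"
      using that by (simp_all add: B gderiv_def)
    note inj' = inj[OF b(1)]
    have lin: "linear (eap (bop U k \<theta>))" using eap.bounded_linear_right bounded_linear.linear by blast
    have "surj (eap (bop U k \<theta>))"
      by (rule linear_injective_imp_surjective[OF lin]) (use inj' in \<open>auto simp: linear_injective_0[OF lin]\<close>)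
    then obtain y where y: "blk s k = eap (bop U k \<theta>) y" by (meson surjE)
    obtain N' where N': "((\<lambda>\<theta>'. eap (bop U k \<theta>') y) has_derivative N') (at \<theta>)"
      using bop_has_derivative_ex[of k U \<theta>] bounded_linear.has_derivative[OF eap.bounded_linear_left] by blast
    obtain M' where M': "((\<lambda>\<theta>'. eap (hop U k \<theta>') y) has_derivative M') (at \<theta>)"
      using hop_has_derivative_ex[of U k \<theta>] bounded_linear.has_derivative[OF eap.bounded_linear_left] by blast
    let ?c = "crit_term U k \<theta> (eap (hop U k \<theta>) y) ?S"
    \<comment> \<open>Testing the vanishing differential with d\<theta> = 0 and with ds equal to the
      block gradients themselves gives a zero sum of squares. No \<eta> is known yet, so the curve n
      is the constant y.\<close>
    have crit: "?c j = 0" if "j \<in> {1..k}" for j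
    proof -
      obtain ds :: "(real^'q)^'k::{finite,linorder}" where ds: "\<And>j. j \<in> {1..k} \<Longrightarrow> blk ds j = ?c j"
        using ex_blk[where 'k = 'k, of ?c] unfolding k by blast
      have "N' 0 = 0" "M' 0 = 0"
        using has_derivative_bounded_linear[OF N'] has_derivative_bounded_linear[OF M']
        by (simp_all add: bounded_linear.linear linear_0)
      moreover have "Wop U 0 = 0" using Wop_scale[of U 0 0] by simp
      moreover have "(\<lambda>h. 0) = (\<lambda>(ds :: (real^'q)^'k::{finite,linorder}, d\<theta>). 4 * (\<Sum>j=1..k. blk ds j \<bullet> ?c j)
          + 4 * (snd g \<bullet> d\<theta> + (\<Sum>j=1..k. eap (Wop U d\<theta>) (?S (j - 1)) \<bullet> ?S j))
          + 2 * (M' d\<theta> \<bullet> blk s k - eap (hop U k \<theta>) y \<bullet> N' d\<theta>))"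
        by (rule has_derivative_unique[OF grad phi_has_derivative[where n = "\<lambda>_. y" and g = g, OF U k inj' N' M' y]])
      from fun_cong[OF this, of "(ds, 0)"]
      have "0 = 4 * (\<Sum>j=1..k. blk ds j \<bullet> ?c j)
          + 4 * (snd g \<bullet> 0 + (\<Sum>j=1..k. eap (Wop U 0) (?S (j - 1)) \<bullet> ?S j))
          + 2 * (M' 0 \<bullet> blk s k - eap (hop U k \<theta>) y \<bullet> N' 0)"
        by (simp only: prod.case)
      ultimately have "(\<Sum>j=1..k. blk ds j \<bullet> ?c j) = 0" by (simp add: eap.zero_left)
      also have "(\<Sum>j=1..k. blk ds j \<bullet> ?c j) = (\<Sum>j=1..k. ?c j \<bullet> ?c j)"
        by (intro sum.cong refl) (simp add: ds)
      finally have "\<forall>j\<in>{1..k}. ?c j \<bullet> ?c j = 0" by (subst (asm) sum_nonneg_eq_0_iff) auto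
      then show ?thesis using that by simp
    qed
    have "?S k = eap (bop U k \<theta>) y" using y k1 by (simp add: seqS_def)
    from crit_term_solution[OF U inj' k1 this crit]
    obtain \<eta>' where \<eta>': "\<And>j. j \<le> k \<Longrightarrow> ?S j = (-1) ^ j *\<^sub>R eap (sbes U j \<theta>) \<eta>'" by blast
    \<comment> \<open>\<open>crit_term_solution\<close> yields the signs without the factor 1 / sqrt
      2 contained in \<open>ssign\<close>.\<close>
    define \<eta> where "\<eta> = sqrt 2 *\<^sub>R \<eta>'"
    define \<zeta> where "\<zeta> = eap (exp (- Wop U \<theta>)) \<eta>"
    have s: "blk s j = ssign j *\<^sub>R eap (sbes U j \<theta>) \<eta>" if "j \<in> {1..k}" for j
      using \<eta>'[of j] that by (simp add: seqS_def \<eta>_def eap.scaleR_right)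
    have g: "fst g = eap (sbes U 0 \<theta>) \<eta>"
    proof -
      have "sqrt 2 *\<^sub>R ?S 0 = eap (sbes U 0 \<theta>) \<eta>" using \<eta>'[of 0] by (simp add: \<eta>_def eap.scaleR_right)
      then show ?thesis by (simp add: seqS_def)
    qed
    have "(\<lambda>h. 0) = (\<lambda>(ds :: (real^'q)^'k::{finite,linorder}, d\<theta>). 4 * ((snd g - snd (sr_exp U (\<zeta>, 2 *\<^sub>R \<theta>))) \<bullet> d\<theta>))"
      unfolding \<zeta>_def by (rule has_derivative_unique[OF grad phi_gradient[OF U k inj' s g]])
    \<comment> \<open>Evaluated at the mismatch itself, the remaining linear form is a squared
      norm.\<close>
    from fun_cong[OF this, of "(0, snd g - snd (sr_exp U (\<zeta>, 2 *\<^sub>R \<theta>)))"]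
    have "snd g = snd (sr_exp U (\<zeta>, 2 *\<^sub>R \<theta>))" by simp
    then have e: "sr_exp U (\<zeta>, 2 *\<^sub>R \<theta>) = g" using fst_exp[of \<theta> \<eta>] g by (simp add: \<zeta>_def prod_eq_iff)
    have "sol \<theta> \<eta> = s" by (rule blk_eqI) (use sol s in \<open>simp add: k\<close>)
    then have "F (g, \<zeta>, \<theta>) = (g, s, \<theta>)" by (simp add: F_def \<zeta>_def canc)
    then show ?thesis using e b by (intro exI[of _ \<zeta>]) (simp add: A)
  qed
  have inj_on: "inj_on F A"
  proof (rule inj_onI)
    fix p p' assume p: "p \<in> A" "p' \<in> A" "F p = F p'"
    obtain g \<zeta> \<theta> where pe: "p = (g, \<zeta>, \<theta>)" by (cases p) auto
    obtain g' \<zeta>' \<theta>' where pe': "p' = (g', \<zeta>', \<theta>')" by (cases p') auto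
    let ?\<eta> = "eap (exp (Wop U \<theta>)) \<zeta>" and ?\<eta>' = "eap (exp (Wop U \<theta>)) \<zeta>'"
    have eq: "g' = g" "\<theta>' = \<theta>" and seq: "sol \<theta> ?\<eta> = sol \<theta> ?\<eta>'" using p(3) by (auto simp: pe pe' F_def)
    have a: "\<theta> \<in> Omega U k" "sr_exp U (\<zeta>, 2 *\<^sub>R \<theta>) = g" "sr_exp U (\<zeta>', 2 *\<^sub>R \<theta>) = g"
      using p(1,2) by (auto simp: A pe pe' eq)
    have "eap (sbes U 0 \<theta>) ?\<eta> = eap (sbes U 0 \<theta>) ?\<eta>'"
      using fst_exp[of \<theta> ?\<eta>] fst_exp[of \<theta> ?\<eta>'] a by (simp add: canc)
    then have z0: "eap (sbes U 0 \<theta>) (?\<eta> - ?\<eta>') = 0" by (simp only: eap.diff_right) simp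
    have "eap (sbes U k \<theta>) ?\<eta> = eap (sbes U k \<theta>) ?\<eta>'"
      using sol[of k \<theta> ?\<eta>] sol[of k \<theta> ?\<eta>'] k1 seq by simp
    then have zk: "eap (sbes U k \<theta>) (?\<eta> - ?\<eta>') = 0" by (simp only: eap.diff_right) simp
    have "?\<eta> - ?\<eta>' = 0"
      by (rule sbes_jointly_injective[OF U inj[OF a(1)] k1 z0 zk])
    then have "?\<eta> = ?\<eta>'" by simp
    then have "\<zeta> = \<zeta>'" by (metis canc(1))
    then show "p = p'" by (simp add: pe pe' eq)
  qed
  have "F ` A = B"
  proof (intro equalityI subsetI)
    fix b assume "b \<in> F ` A"
    then show "b \<in> B" using maps by auto
  next
    fix b assume b: "b \<in> B"
    obtain g s \<theta> where be: "b = (g, s, \<theta>)" by (cases b) auto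
    from surj[OF b[unfolded be]] show "b \<in> F ` A" unfolding be by (metis imageI)
  qed
  then have "bij_betw F A B" using inj_on by (simp add: bij_betw_def)
  moreover have "\<exists>s. F (g, \<zeta>, \<theta>) = (g, s, \<theta>)" for g \<zeta> \<theta> by (simp add: F_def)
  ultimately show ?thesis by blast
qed

end
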